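(* Let $f^*\in\mathcal H$ and consider the regression model $Y_i=f^*(X_i)+\varepsilon_i$, $1\le i\le n$, where $X_1,\dots,X_n$ are i.i.d. with law $d\rho$, and $\varepsilon_1,\dots,\varepsilon_n$ are i.i.d., centered, with variance $\sigma^2>0$, independent of the $X_i$. For $\lambda>0$ let $\widehat f_n^\lambda$ be the full kernel ridge regression estimator $$\widehat f_n^\lambda(x)=\sum_{i=1}^n\widehat c_i\,\mathbb K(X_i,x),\qquad (\widehat c_1,\dots,\widehat c_n)^T=\Big(\big[\mathbb K(X_i,X_j)\big]_{1\le i,j\le n}+n\lambda I_n\Big)^{-1}(Y_1,\dots,Y_n)^T .$$ Assume: (H0) $T_{\mathbb K}$ is one-to-one on $L^2(\mathbf X,dP)$; (H1) $d\rho$ is absolutely continuous with respect to $dP$ and $\frac{d\rho}{dP}$ is bounded on $\mathbf X$; (H2) the random matrix $[\varphi_j(X_i)]_{1\le i\le n,1\le j\le N}$ has full rank; (H3) $\max\big(\frac1n\sum_{j=1}^N\widetilde\omega_j^2,\ \frac1n\sum_{j=1}^N{\omega_j'}^2\big)\le 1$, where $\widetilde\pi_Nf^*=\sum_{j=1}^N\widetilde\omega_j\frac1n\mathbb K(X_j,\cdot)$ and $\pi_Nf^*=\sum_{j=1}^N\omega_j'\frac1n\mathbb K_N(X_j,\cdot)$; (where (H2) and (H3) are assumed for all integers $1\le N\le n$), and for every $k\ge1$, $\sum_{i\ge k}\frac{(i-k+1)\lambda_i\|\varphi_i\|_\rho^2}{\lambda_k\|\varphi_k\|_\rho^2}<+\infty$.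 Assume also that for some real $a\ge0$, $\|\varphi_k\|_\infty\lesssim k^{a/2}$ for all $k\ge1$. Then, for a suitable (optimal) choice of the regularization parameter $\lambda=\lambda_n>0$, the full estimator satisfies the following rates. (i) If for some $b>0$ and integer $N_b\geq 1$, $\lambda_k\lesssim e^{-bk}$ for all $k\ge N_b$, then $$\mathbb E\Big[\frac1n\sum_{i=1}^n\big(\widehat f_n^\lambda(X_i)-f^*(X_i)\big)^2\Big]=O\Big(\sigma^2\max\Big(\frac{N_b}{n},\frac1{bn}\log\big(\tfrac n{\sigma^2}\big)\Big)\Big).$$ (ii) If for some $s>a$ and integer $N_s\geq 1$, $\lambda_k\lesssim k^{-2s}$ for all $k\ge N_s$, then, with $\gamma=\min(1,2-a)$, $$\mathbb E\Big[\frac1n\sum_{i=1}^n\big(\widehat f_n^\lambda(X_i)-f^*(X_i)\big)^2\Big]=O\Big(\max\Big(\sigma^2\frac{N_s}{n},\big(\tfrac n{\sigma^2}\big)^{-\frac{2s+\gamma-1}{2s+\gamma}}\Big)\Big).$$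
   Context: Let $d\ge 1$ and let $\mathbf X\subset\mathbb R^d$ be compact. Let $\mathbb K:\mathbf X\times\mathbf X\to\mathbb R$ be a Mercer kernel, i.e. continuous, symmetric and positive definite. Let $dP$ be a probability measure with support $\mathbf X$ and $d\rho$ a probability measure supported on $\mathbf X$. Define $T_{\mathbb K}f(x)=\int_{\mathbf X}\mathbb K(x,y)f(y)\,dP(y)$ on $L^2(\mathbf X,dP)$; its eigenvalues are positive, $\lambda_1\ge\lambda_2\ge\cdots>0$ (with multiplicity), with corresponding continuous eigenfunctions $(\varphi_k)_{k\ge1}$ orthonormal in $L^2(\mathbf X,dP)$. $\|\cdot\|_\infty$ is the sup norm on $\mathbf X$ and $\|\varphi_k\|_\rho^2=\int_{\mathbf X}|\varphi_k|^2\,d\rho$. The reproducing kernel Hilbert space is $$\mathcal H=\Big\{f=\sum_{k\ge1}a_k(f)\varphi_k:\ \|f\|_{\mathcal H}^2=\sum_{k\ge1}\frac{|a_k(f)|^2}{\lambda_k}<\infty\Big\},\qquad a_k(f)=\langle f,\varphi_k\rangle_{L^2(\mathbf X,dP)}.$$ Let $\mathcal H_N=\mathrm{Span}\{\frac1n\mathbb K(X_j,\cdot):1\le j\le N\}$ and $\mathcal F_N=\mathrm{Span}\{\varphi_1,\dots,\varphi_N\}$; $\widetilde\pi_N$ and $\pi_N$ denote the $L^2(\mathbf X,dP)$-orthogonal projections onto $\mathcal H_N$ and $\mathcal F_N$ respectively. The truncated kernel is $\mathbb K_N(x,y)=\sum_{m=1}^N\lambda_m\varphi_m(x)\varphi_m(y)$;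 it is part of the setting that $\pi_Nf^*$ can be expanded as $\sum_{j=1}^N\omega_j'\frac1n\mathbb K_N(X_j,\cdot)$. (H2) and (H3) are understood to hold almost surely in the sample. $\mathbb E$ is the expectation over sample and noise. $u_k\lesssim v_k$ means $u_k\le Cv_k$ with $C>0$ independent of $k$. The symbol $O$ is understood as $n\to\infty$, with implied constant independent of $n$. *)

theory Defs
  imports "HOL-Probability.Probability" "Jordan_Normal_Form.DL_Rank"
    "Jordan_Normal_Form.Gauss_Jordan_Elimination"
begin

text \<open>
  Measures on the compact domain \<open>D\<close> live on the Borel sets of the subspace \<open>D\<close>, so their
  space is \<open>D\<close> itself. Eigenvalues \<open>lam k\<close>, eigenfunctions \<open>phi k\<close> and samples
  \<open>x i\<close> are indexed from 1; the values at index 0 are irrelevant. Kernels and functions are total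
  on the ambient type, but only their values on \<open>D\<close> matter.
\<close>

definition prob_on :: "'a::topological_space set \<Rightarrow> 'a measure \<Rightarrow> bool" where
  "prob_on D P \<longleftrightarrow> prob_space P \<and> sets P = sets (restrict_space borel D)"

definition measure_support :: "'a::topological_space measure \<Rightarrow> 'a set" where
  "measure_support P =
     {x \<in> space P. \<forall>U. open U \<longrightarrow> x \<in> U \<longrightarrow> emeasure P (U \<inter> space P) > 0}"

text \<open>
  As usual for Mercer kernels, positive definite means that all Gram matrices are positive
  semidefinite.
\<close>

definition mercer_kernel :: "'a::topological_space set \<Rightarrow> ('a \<Rightarrow> 'a \<Rightarrow> real) \<Rightarrow> bool" where
  "mercer_kernel D K \<longleftrightarrow>
     continuous_on (D \<times> D) (\<lambda>(x, y). K x y) \<and>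
     (\<forall>x\<in>D. \<forall>y\<in>D. K x y = K y x) \<and>
     (\<forall>(m::nat) x c. (\<forall>i<m. x i \<in> D) \<longrightarrow> (\<Sum>i<m. \<Sum>j<m. c i * c j * K (x i) (x j)) \<ge> 0)"

definition square_integrable :: "'a measure \<Rightarrow> ('a \<Rightarrow> real) \<Rightarrow> bool" where
  "square_integrable P f \<longleftrightarrow> f \<in> borel_measurable P \<and> integrable P (\<lambda>x. (f x)\<^sup>2)"

definition L2_inner :: "'a measure \<Rightarrow> ('a \<Rightarrow> real) \<Rightarrow> ('a \<Rightarrow> real) \<Rightarrow> real" where
  "L2_inner P f g = (LINT x|P. f x * g x)"

definition L2_norm_sq :: "'a measure \<Rightarrow> ('a \<Rightarrow> real) \<Rightarrow> real" where
  "L2_norm_sq P f = L2_inner P f f"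

definition sup_norm_on :: "'a set \<Rightarrow> ('a \<Rightarrow> real) \<Rightarrow> real" where
  "sup_norm_on D f = (SUP x\<in>D. \<bar>f x\<bar>)"

definition kernel_op :: "'a measure \<Rightarrow> ('a \<Rightarrow> 'a \<Rightarrow> real) \<Rightarrow> ('a \<Rightarrow> real) \<Rightarrow> 'a \<Rightarrow> real" where
  "kernel_op P K f x = (LINT y|P. K x y * f y)"

definition kernel_op_one_to_one :: "'a measure \<Rightarrow> ('a \<Rightarrow> 'a \<Rightarrow> real) \<Rightarrow> bool" where
  "kernel_op_one_to_one P K \<longleftrightarrow>
     (\<forall>f g. square_integrable P f \<longrightarrow> square_integrable P g \<longrightarrow>
        (AE x in P. kernel_op P K f x = kernel_op P K g x) \<longrightarrow> (AE x in P. f x = g x))"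

definition eigenfunction ::
  "'a measure \<Rightarrow> ('a \<Rightarrow> 'a \<Rightarrow> real) \<Rightarrow> real \<Rightarrow> ('a \<Rightarrow> real) \<Rightarrow> bool" where
  "eigenfunction P K \<mu> f \<longleftrightarrow>
     square_integrable P f \<and> \<not> (AE x in P. f x = 0) \<and>
     (AE x in P. kernel_op P K f x = \<mu> * f x)"

text \<open>
  The last clause says that \<open>lam\<close> lists every nonzero eigenvalue with its multiplicity: the
  eigenspace of \<open>\<mu>\<close> is spanned by those \<open>phi k\<close> with \<open>lam k = \<mu>\<close>. Completeness of
  \<open>phi\<close> in \<open>L\<^sup>2\<close> is not built in.
\<close>

definition eigensystem ::
  "'a::topological_space set \<Rightarrow> 'a measure \<Rightarrow> ('a \<Rightarrow> 'a \<Rightarrow> real) \<Rightarrow> (nat \<Rightarrow> real) \<Rightarrow>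
   (nat \<Rightarrow> 'a \<Rightarrow> real) \<Rightarrow> bool" where
  "eigensystem D P K lam phi \<longleftrightarrow>
     (\<forall>k\<ge>1. lam k > 0 \<and> lam (Suc k) \<le> lam k) \<and>
     (\<forall>k\<ge>1. continuous_on D (phi k) \<and> eigenfunction P K (lam k) (phi k)) \<and>
     (\<forall>j\<ge>1. \<forall>k\<ge>1. L2_inner P (phi j) (phi k) = (if j = k then 1 else 0)) \<and>
     (\<forall>\<mu> f. \<mu> \<noteq> 0 \<longrightarrow> eigenfunction P K \<mu> f \<longrightarrow>
        (\<exists>I c. finite I \<and> I \<subseteq> {k. k \<ge> 1 \<and> lam k = \<mu>} \<and>
           (AE x in P. f x = (\<Sum>k\<in>I. c k * phi k x))))"

text \<open>
  Elements of the reproducing kernel Hilbert space are genuine functions on \<open>D\<close> (they get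
  evaluated at the sample points), so their eigenfunction expansion is required pointwise.
\<close>

definition rkhs ::
  "'a set \<Rightarrow> 'a measure \<Rightarrow> (nat \<Rightarrow> real) \<Rightarrow> (nat \<Rightarrow> 'a \<Rightarrow> real) \<Rightarrow> ('a \<Rightarrow> real) set" where
  "rkhs D P lam phi =
     {f. square_integrable P f \<and>
         (\<lambda>k. \<bar>L2_inner P f (phi k)\<bar>\<^sup>2 / lam k) summable_on {1..} \<and>
         (\<forall>x\<in>D. ((\<lambda>k. L2_inner P f (phi k) * phi k x) has_sum f x) {1..})}"

definition trunc_kernel ::
  "(nat \<Rightarrow> real) \<Rightarrow> (nat \<Rightarrow> 'a \<Rightarrow> real) \<Rightarrow> nat \<Rightarrow> 'a \<Rightarrow> 'a \<Rightarrow> real" where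
  "trunc_kernel lam phi N x y = (\<Sum>m=1..N. lam m * phi m x * phi m y)"

definition fun_span :: "nat \<Rightarrow> (nat \<Rightarrow> 'a \<Rightarrow> real) \<Rightarrow> ('a \<Rightarrow> real) set" where
  "fun_span N g = {f. \<exists>c. f = (\<lambda>y. \<Sum>j=1..N. c j * g j y)}"

definition is_L2_projection ::
  "'a measure \<Rightarrow> ('a \<Rightarrow> real) set \<Rightarrow> ('a \<Rightarrow> real) \<Rightarrow> ('a \<Rightarrow> real) \<Rightarrow> bool" where
  "is_L2_projection P V f g \<longleftrightarrow>
     g \<in> V \<and> (\<forall>h\<in>V. L2_inner P (\<lambda>y. f y - g y) h = 0)"

text \<open>Matrices are indexed from 0, samples and eigenfunctions from 1; hence the shifts by one.\<close>

definition full_rank_design ::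
  "(nat \<Rightarrow> 'a \<Rightarrow> real) \<Rightarrow> nat \<Rightarrow> nat \<Rightarrow> (nat \<Rightarrow> 'a) \<Rightarrow> bool" where
  "full_rank_design phi n N x \<longleftrightarrow>
     vec_space.rank n (mat n N (\<lambda>(i, j). phi (Suc j) (x (Suc i)))) = min n N"

text \<open>
  Here \<open>w\<close> and \<open>w'\<close> are the coefficients of the projections of \<open>f\<close> onto the spans of
  \<open>K (x j) / n\<close> and of \<open>phi j\<close> for \<open>1 \<le> j \<le> N\<close>, respectively.
\<close>

definition bounded_coefficients ::
  "'a measure \<Rightarrow> ('a \<Rightarrow> 'a \<Rightarrow> real) \<Rightarrow> (nat \<Rightarrow> real) \<Rightarrow> (nat \<Rightarrow> 'a \<Rightarrow> real) \<Rightarrow> ('a \<Rightarrow> real) \<Rightarrow>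
   nat \<Rightarrow> nat \<Rightarrow> (nat \<Rightarrow> 'a) \<Rightarrow> bool" where
  "bounded_coefficients P K lam phi f n N x \<longleftrightarrow>
     (\<exists>w w'.
        is_L2_projection P (fun_span N (\<lambda>j y. 1 / real n * K (x j) y)) f
          (\<lambda>y. \<Sum>j=1..N. w j * (1 / real n * K (x j) y)) \<and>
        is_L2_projection P (fun_span N phi) f
          (\<lambda>y. \<Sum>j=1..N. w' j * (1 / real n * trunc_kernel lam phi N (x j) y)) \<and>
        max (1 / real n * (\<Sum>j=1..N. (w j)\<^sup>2)) (1 / real n * (\<Sum>j=1..N. (w' j)\<^sup>2)) \<le> 1)"

definition krr_coeffs ::
  "('a \<Rightarrow> 'a \<Rightarrow> real) \<Rightarrow> nat \<Rightarrow> real \<Rightarrow> (nat \<Rightarrow> 'a) \<Rightarrow> (nat \<Rightarrow> real) \<Rightarrow> real Matrix.vec" where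
  "krr_coeffs K n reg x y =
     the (mat_inverse (mat n n (\<lambda>(i, j). K (x (Suc i)) (x (Suc j))) + (real n * reg) \<cdot>\<^sub>m 1\<^sub>m n))
       *\<^sub>v Matrix.vec n (\<lambda>i. y (Suc i))"

definition krr_estimator ::
  "('a \<Rightarrow> 'a \<Rightarrow> real) \<Rightarrow> nat \<Rightarrow> real \<Rightarrow> (nat \<Rightarrow> 'a) \<Rightarrow> (nat \<Rightarrow> real) \<Rightarrow> 'a \<Rightarrow> real" where
  "krr_estimator K n reg x y z =
     (\<Sum>i<n. vec_index (krr_coeffs K n reg x y) i * K (x (Suc i)) z)"

text \<open>Regression model \<open>Y i = f (x i) + eps i\<close>; mean squared error at the sample points.\<close>

definition krr_risk ::
  "'w measure \<Rightarrow> ('a \<Rightarrow> 'a \<Rightarrow> real) \<Rightarrow> ('a \<Rightarrow> real) \<Rightarrow> (nat \<Rightarrow> 'w \<Rightarrow> 'a) \<Rightarrow> (nat \<Rightarrow> 'w \<Rightarrow> real) \<Rightarrow>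
   nat \<Rightarrow> real \<Rightarrow> real" where
  "krr_risk M K f X eps n reg =
     (LINT \<omega>|M. 1 / real n * (\<Sum>i=1..n.
        (krr_estimator K n reg (\<lambda>j. X j \<omega>) (\<lambda>j. f (X j \<omega>) + eps j \<omega>) (X i \<omega>) - f (X i \<omega>))\<^sup>2))"

definition iid_design ::
  "'w measure \<Rightarrow> 'a measure \<Rightarrow> (nat \<Rightarrow> 'w \<Rightarrow> 'a) \<Rightarrow> bool" where
  "iid_design M \<rho> X \<longleftrightarrow>
     prob_space.indep_vars M (\<lambda>_. \<rho>) X {1..} \<and> (\<forall>i\<ge>1. distr M \<rho> (X i) = \<rho>)"

definition iid_noise :: "'w measure \<Rightarrow> real \<Rightarrow> (nat \<Rightarrow> 'w \<Rightarrow> real) \<Rightarrow> bool" where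
  "iid_noise M \<sigma> eps \<longleftrightarrow>
     prob_space.indep_vars M (\<lambda>_. borel) eps {1..} \<and>
     (\<forall>i\<ge>1. distr M borel (eps i) = distr M borel (eps 1)) \<and>
     (\<forall>i\<ge>1. square_integrable M (eps i) \<and> (LINT \<omega>|M. eps i \<omega>) = 0 \<and>
        prob_space.variance M (eps i) = \<sigma>\<^sup>2)"

definition design_indep_noise ::
  "'w measure \<Rightarrow> 'a measure \<Rightarrow> (nat \<Rightarrow> 'w \<Rightarrow> 'a) \<Rightarrow> (nat \<Rightarrow> 'w \<Rightarrow> real) \<Rightarrow> bool" where
  "design_indep_noise M \<rho> X eps \<longleftrightarrow>
     prob_space.indep_set M
       (sets (vimage_algebra (space M) (\<lambda>\<omega>. \<lambda>i\<in>{1..}. X i \<omega>) (PiM {1..} (\<lambda>_. \<rho>))))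
       (sets (vimage_algebra (space M) (\<lambda>\<omega>. \<lambda>i\<in>{1..}. eps i \<omega>) (PiM {1..} (\<lambda>_. borel))))"

end

theory Submission
  imports Defs "HOL-Complex_Analysis.Great_Picard"
begin

text \<open>
  Conditionally on the design, the risk splits into squared bias and variance. The bias is at most a
  multiple of \<open>reg\<close> because \<open>f\<close> lies in the reproducing kernel Hilbert space. The variance is at
  most \<open>\<sigma>\<^sup>2 / n\<close> times the trace of the hat matrix \<open>G (G + n reg I)\<^sup>-\<^sup>1\<close>. Expanding the Gram matrix
  \<open>G\<close> by Mercer's theorem, each of the first \<open>N\<close> rank-one terms contributes at most 1 to this trace,
  and the others contribute in expectation at most a multiple of \<open>\<Sum>k>N. lam k\<close> divided by \<open>reg\<close>,
  since \<open>\<rho>\<close> has a bounded density with respect to \<open>P\<close>. Choosing \<open>N\<close> and \<open>reg\<close> gives the rates.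
  Mercer's theorem reduces to the fact that the form of the kernel vanishes on the continuous
  functions orthogonal to all eigenfunctions; otherwise a compactness argument would produce an
  eigenfunction that is missing from the list.
\<close>

text \<open>Kernel, target and estimator are evaluated at the sample, so the kernel expansion must
  hold at every point. The spectral part therefore works with continuous functions, where full
  support of \<open>P\<close> turns almost sure identities into pointwise ones. Positivity of the
  kernel is given for finite point sets and has to be carried over to integrals; random points do
  this. The eigensystem lists the eigenvalues exhaustively without asserting completeness, and
  exhaustiveness is what the contradiction uses. Up to constants the risk bound has three terms:
  \<open>reg\<close>, \<open>N / n\<close>, and the eigenvalue tail beyond \<open>N\<close> divided
  by \<open>n * reg\<close>. For exponential decay, \<open>N\<close> near \<open>ln n / b\<close>
  and \<open>reg = 1 / n\<close> make the tail term of order \<open>1 / n\<close>. For tails of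
  order N^(1 - 2s), \<open>N\<close> near n^(1 / (2s + 1)) and \<open>reg\<close> = n^(-2s / (2s +
  1)) give all three the same order; the resulting exponent is at least the required one because
  \<gamma> is at most 1. The noise level is fixed, so its powers go into the constant.\<close>

section \<open>Preliminaries on quadratic polynomials, product measures and generated
  sigma-algebras\<close>

text \<open>No sign of \<open>r\<close> is assumed: \<open>ip_T_nonneg\<close> applies this while
  the sign of the leading coefficient is still open.\<close>

lemma quadratic_nonneg_discriminant:
  fixes p q r :: real
  assumes "\<And>t. 0 \<le> p + 2 * t * q + t\<^sup>2 * r"
  shows "q\<^sup>2 \<le> p * r"
proof (cases "r = 0")
  case True
  have "q = 0"
  proof (rule ccontr)
    \<comment> \<open>With \<open>r = 0\<close> the polynomial is affine in the argument, and the
      chosen argument gives the value -1.\<close>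
    assume "q \<noteq> 0" with assms[of "-(p + 1) / (2 * q)"] True show False by (simp add: field_simps)
  qed
  then show ?thesis using True by simp
next
  case False
  have "r \<ge> 0"
  proof (rule ccontr)
    assume "\<not> r \<ge> 0"
    \<comment> \<open>Adding the inequalities at \<open>t\<close> and \<open>-t\<close> removes the
      linear term; the square root chosen below then leaves \<open>p - \<bar>p\<bar> - 1\<close>,
      which is negative.\<close>
    then have r: "r < 0" by simp
    have "0 \<le> p + 2 * t * q + t\<^sup>2 * r" "0 \<le> p + 2 * (-t) * q + (-t)\<^sup>2 * r" for t using assms by blast+
    then have "0 \<le> p + t\<^sup>2 * r" for t by (smt (verit) mult_minus_left mult_minus_right power2_minus)
    from this[of "sqrt ((\<bar>p\<bar> + 1) / - r)"] have "0 \<le> p + (\<bar>p\<bar> + 1) / - r * r"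
      using r by (simp add: divide_nonneg_neg real_sqrt_pow2_iff del: minus_divide_right)
    moreover have "(\<bar>p\<bar> + 1) / - r * r = - (\<bar>p\<bar> + 1)" using r by simp
    ultimately show False by linarith
  qed
  with False have r: "r > 0" by simp
  have "0 \<le> p + 2 * (-q/r) * q + (-q/r)\<^sup>2 * r" by (rule assms)
  then have "0 \<le> r * (p + 2 * (-q/r) * q + (-q/r)\<^sup>2 * r)" using r by simp
  also have "\<dots> = p * r - q\<^sup>2" using r by (simp add: field_simps power2_eq_square)
  finally show ?thesis by simp
qed

text \<open>The preimage of a rectangle is a cylinder over \<open>{i, j}\<close>, and rectangles
  determine a product measure. It evaluates the off-diagonal terms of the random quadratic form in
  \<open>K_psd_point_function\<close>.\<close>

lemma distr_PiM_pair:
  assumes M: "\<And>i. i \<in> I \<Longrightarrow> prob_space (M i)" and ij: "i \<in> I" "j \<in> I" "i \<noteq> j"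
  shows "distr (PiM I M) (M i \<Otimes>\<^sub>M M j) (\<lambda>\<omega>. (\<omega> i, \<omega> j)) = M i \<Otimes>\<^sub>M M j"
proof (rule pair_measure_eqI[symmetric])
  show "sigma_finite_measure (M i)" "sigma_finite_measure (M j)"
    using M ij by (auto intro: prob_space_imp_sigma_finite)
next
  fix A B assume AB: "A \<in> sets (M i)" "B \<in> sets (M j)"
  let ?F = "\<lambda>k. if k = i then A else B"
  have F: "?F k \<in> sets (M k)" if "k \<in> {i, j}" for k using that AB by auto
  have meas: "(\<lambda>\<omega>. (\<omega> i, \<omega> j)) \<in> measurable (PiM I M) (M i \<Otimes>\<^sub>M M j)"
    using ij by (intro measurable_Pair measurable_component_singleton)
  have "emeasure (distr (PiM I M) (M i \<Otimes>\<^sub>M M j) (\<lambda>\<omega>. (\<omega> i, \<omega> j))) (A \<times> B) =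
        emeasure (PiM I M) ((\<lambda>\<omega>. (\<omega> i, \<omega> j)) -` (A \<times> B) \<inter> space (PiM I M))"
    using AB by (intro emeasure_distr meas) auto
  also have "(\<lambda>\<omega>. (\<omega> i, \<omega> j)) -` (A \<times> B) \<inter> space (PiM I M) = prod_emb I M {i, j} (Pi\<^sub>E {i, j} ?F)"
    using ij by (auto simp: prod_emb_def space_PiM PiE_iff)
  also have "emeasure (PiM I M) \<dots> = (\<Prod>k\<in>{i, j}. emeasure (M k) (?F k))"
    using ij F by (intro emeasure_PiM_emb M) auto
  also have "\<dots> = emeasure (M i) A * emeasure (M j) B" using ij by simp
  finally show "emeasure (M i) A * emeasure (M j) B =
    emeasure (distr (PiM I M) (M i \<Otimes>\<^sub>M M j) (\<lambda>\<omega>. (\<omega> i, \<omega> j))) (A \<times> B)" by simp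
qed simp

text \<open>Lets independence of the sigma-algebras of the whole design and the whole noise sequence
  pass to real functions of them.\<close>

lemma sigma_sets_vimage_compose:
  assumes X: "\<And>\<omega>. \<omega> \<in> \<Omega> \<Longrightarrow> X \<omega> \<in> space S" and g: "g \<in> measurable S T"
  shows "sigma_sets \<Omega> {(\<lambda>\<omega>. g (X \<omega>)) -` A \<inter> \<Omega> |A. A \<in> sets T} \<subseteq> sets (vimage_algebra \<Omega> X S)"
proof -
  let ?V = "vimage_algebra \<Omega> X S"
  have "X \<in> measurable ?V S" using X by (intro measurable_vimage_algebra1) auto
  from measurable_sets[OF measurable_compose[OF this g]]
  have "{(\<lambda>\<omega>. g (X \<omega>)) -` A \<inter> \<Omega> |A. A \<in> sets T} \<subseteq> sets ?V" by auto
  from sets.sigma_sets_subset[OF this] show ?thesis by simp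
qed

subsection \<open>Integral operators with a Mercer kernel\<close>

locale mercer_space =
  fixes D :: "'a::euclidean_space set" and P :: "'a measure" and K :: "'a \<Rightarrow> 'a \<Rightarrow> real"
  assumes compact_D: "compact D"
    and prob_on_P: "prob_on D P"
    and support_P: "measure_support P = D"
    and kernel: "mercer_kernel D K"
begin

sublocale prob_space P
  using prob_on_P by (simp add: prob_on_def)

abbreviation T where "T \<equiv> kernel_op P K"
abbreviation ip where "ip \<equiv> L2_inner P"

lemma sets_P: "sets P = sets (restrict_space borel D)"
  using prob_on_P by (simp add: prob_on_def)

lemma space_P: "space P = D"
  using sets_eq_imp_space_eq[OF sets_P] by (simp add: space_restrict_space)

lemma K_cont: "continuous_on (D \<times> D) (\<lambda>(x, y). K x y)"
  and K_sym: "x \<in> D \<Longrightarrow> y \<in> D \<Longrightarrow> K x y = K y x"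
  and K_psd: "(\<And>i. i < m \<Longrightarrow> z i \<in> D) \<Longrightarrow> 0 \<le> (\<Sum>i<m. \<Sum>j<m. c i * c j * K (z i) (z j))" for m :: nat
proof -
  show "continuous_on (D \<times> D) (\<lambda>(x, y). K x y)" "x \<in> D \<Longrightarrow> y \<in> D \<Longrightarrow> K x y = K y x"
    using kernel unfolding mercer_kernel_def by blast+
  have "\<forall>(m::nat) x c. (\<forall>i<m. x i \<in> D) \<longrightarrow> (\<Sum>i<m. \<Sum>j<m. c i * c j * K (x i) (x j)) \<ge> 0"
    using kernel unfolding mercer_kernel_def by blast
  from this[rule_format, of m z c]
  show "0 \<le> (\<Sum>i<m. \<Sum>j<m. c i * c j * K (z i) (z j))" if "\<And>i. i < m \<Longrightarrow> z i \<in> D"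
    using that by simp
qed

lemma K_cont_snd: "x \<in> D \<Longrightarrow> continuous_on D (K x)"
  using continuous_on_compose2[OF K_cont, of D "\<lambda>y. (x, y)"]
  by (force intro: continuous_on_Pair continuous_on_const continuous_on_id)

lemma K_cont_diag: "continuous_on D (\<lambda>x. K x x)"
  using continuous_on_compose2[OF K_cont, of D "\<lambda>y. (y, y)"]
  by (force intro: continuous_on_Pair continuous_on_id)

lemma K_nonneg: "x \<in> D \<Longrightarrow> 0 \<le> K x x"
  using K_psd[of "Suc 0" "\<lambda>_. x" "\<lambda>_. 1"] by simp

lemma measurable_cont: "continuous_on D h \<Longrightarrow> h \<in> borel_measurable P"
  using borel_measurable_continuous_on_restrict measurable_cong_sets[OF sets_P refl] by blast

lemma bounded_cont:
  fixes h :: "'a \<Rightarrow> real"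
  assumes "continuous_on D h"
  shows "\<exists>C>0. \<forall>x\<in>D. \<bar>h x\<bar> \<le> C"
proof -
  have "bounded (h ` D)"
    by (intro compact_imp_bounded compact_continuous_image assms compact_D)
  then show ?thesis
    unfolding bounded_pos by auto
qed

lemma integrable_cont [intro]:
  fixes h :: "'a \<Rightarrow> real"
  assumes "continuous_on D h" shows "integrable P h"
proof -
  obtain C where "0 < C" "\<forall>x\<in>D. \<bar>h x\<bar> \<le> C" using bounded_cont[OF assms] by blast
  then show ?thesis
    by (intro integrable_const_bound[of _ C] AE_I2 measurable_cont assms) (auto simp: space_P)
qed

lemma square_integrable_cont: "continuous_on D h \<Longrightarrow> square_integrable P h"
  by (auto simp: square_integrable_def intro!: measurable_cont continuous_intros)

lemma K_bound: "\<exists>C>0. \<forall>x\<in>D. \<forall>y\<in>D. \<bar>K x y\<bar> \<le> C"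
proof -
  have "bounded ((\<lambda>(x, y). K x y) ` (D \<times> D))"
    by (intro compact_imp_bounded compact_continuous_image K_cont compact_Times compact_D)
  then show ?thesis
    unfolding bounded_pos by fastforce
qed

text \<open>The set where two continuous functions differ is relatively open in \<open>D\<close>; if
  it contains a point, that point lies in the support and the set has positive mass.\<close>

lemma AE_cont_eq:
  fixes g h :: "'a \<Rightarrow> real"
  assumes g: "continuous_on D g" and h: "continuous_on D h" and AE: "AE x in P. g x = h x" and x: "x \<in> D"
  shows "g x = h x"
proof (rule ccontr)
  assume neq: "g x \<noteq> h x"
  have "continuous_on D (\<lambda>x. g x - h x)" using g h by (intro continuous_intros)
  then have "openin (top_of_set D) (D \<inter> (\<lambda>x. g x - h x) -` (- {0}))"
    by (rule continuous_openin_preimage_gen) auto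
  then obtain U where U: "open U" "D \<inter> (\<lambda>x. g x - h x) -` (- {0}) = D \<inter> U"
    by (auto simp: openin_open)
  have "x \<in> U" using neq x U by auto
  then have pos: "emeasure P (U \<inter> D) > 0"
    using support_P U x by (auto simp: measure_support_def space_P)
  have "U \<inter> D \<in> sets P"
    unfolding sets_P sets_restrict_space Int_commute[of U] by (intro imageI borel_open U(1))
  moreover have "AE x in P. x \<notin> U \<inter> D"
    using AE by eventually_elim (use U in auto)
  ultimately have "emeasure P (U \<inter> D) = 0"
    using AE_iff_null_sets[of "U \<inter> D" P] by blast
  with pos show False by simp
qed

lemma ip_self_eq_0:
  assumes "continuous_on D h" "ip h h = 0" "x \<in> D" shows "h x = 0"
proof -
  have "integrable P (\<lambda>x. h x * h x)" using assms by (intro integrable_cont continuous_intros)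
  then have "AE x in P. h x * h x = 0"
    using assms integral_nonneg_eq_0_iff_AE[of P "\<lambda>x. h x * h x"] by (auto simp: L2_inner_def)
  then have "AE x in P. h x = 0" by auto
  from AE_cont_eq[OF assms(1) continuous_on_const this assms(3)] show ?thesis .
qed

lemma ip_self_nonneg: "0 \<le> ip h h"
  by (simp add: L2_inner_def)

lemma ip_commute: "ip g h = ip h g"
  by (simp add: L2_inner_def mult.commute)

lemma ip_add: "continuous_on D f \<Longrightarrow> continuous_on D g \<Longrightarrow> continuous_on D h \<Longrightarrow>
    ip f (\<lambda>x. g x + c * h x) = ip f g + c * ip f h"
  unfolding L2_inner_def distrib_left
  by (subst Bochner_Integration.integral_add)
     (auto intro!: continuous_intros simp: mult.left_commute[of _ c])

lemma ip_sum: "continuous_on D f \<Longrightarrow> (\<And>i. i \<in> I \<Longrightarrow> continuous_on D (g i)) \<Longrightarrow>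
    ip f (\<lambda>x. \<Sum>i\<in>I. c i * g i x) = (\<Sum>i\<in>I. c i * ip f (g i))"
  unfolding L2_inner_def sum_distrib_left
  by (subst Bochner_Integration.integral_sum)
     (auto intro!: continuous_intros simp: mult.left_commute[of _ "c _"])

lemma ip_cauchy_schwarz:
  assumes g: "continuous_on D g" and h: "continuous_on D h"
  shows "(ip g h)\<^sup>2 \<le> ip g g * ip h h"
proof (rule quadratic_nonneg_discriminant)
  fix t :: real
  let ?u = "\<lambda>x. g x + t * h x"
  have u: "continuous_on D ?u" using g h by (intro continuous_intros)
  have "ip ?u ?u = ip ?u g + t * ip ?u h" by (rule ip_add[OF u g h])
  also have "\<dots> = ip g g + 2 * t * ip g h + t\<^sup>2 * ip h h"
    unfolding ip_commute[of ?u] ip_add[OF g g h] ip_add[OF h g h]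
    by (simp add: ip_commute[of h g] algebra_simps power2_eq_square)
  finally show "0 \<le> ip g g + 2 * t * ip g h + t\<^sup>2 * ip h h"
    using ip_self_nonneg[of ?u] by simp
qed

section \<open>Equicontinuity and self-adjointness of the integral operator\<close>

text \<open>Uniform continuity of the kernel on the compact set \<open>D \<times> D\<close> yields
  one \<open>d\<close> for all \<open>h\<close>. This uniformity is the equicontinuity that
  Arzela-Ascoli asks for.\<close>

lemma T_equicont:
  assumes "e > 0"
  obtains d where "d > 0"
    "\<And>h x y. continuous_on D h \<Longrightarrow> x \<in> D \<Longrightarrow> y \<in> D \<Longrightarrow> dist x y < d \<Longrightarrow> \<bar>T h x - T h y\<bar> \<le> e * (LINT z|P. \<bar>h z\<bar>)"
proof -
  have "uniformly_continuous_on (D \<times> D) (\<lambda>(x, y). K x y)"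
    by (intro compact_uniformly_continuous K_cont compact_Times compact_D)
  then obtain d where d: "d > 0"
    "\<And>u v. u \<in> D \<times> D \<Longrightarrow> v \<in> D \<times> D \<Longrightarrow> dist u v < d \<Longrightarrow> dist ((\<lambda>(x, y). K x y) u) ((\<lambda>(x, y). K x y) v) < e"
    using assms unfolding uniformly_continuous_on_def by (metis dist_commute)
  have "\<bar>T h x - T h y\<bar> \<le> e * (LINT z|P. \<bar>h z\<bar>)"
    if h: "continuous_on D h" and xy: "x \<in> D" "y \<in> D" "dist x y < d" for h x y
  proof -
    have "T h x - T h y = (LINT z|P. (K x z - K y z) * h z)"
      unfolding kernel_op_def left_diff_distrib using h xy
      by (subst Bochner_Integration.integral_diff) (auto intro!: continuous_intros K_cont_snd)
    also have "\<bar>\<dots>\<bar> \<le> (LINT z|P. \<bar>(K x z - K y z) * h z\<bar>)"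
      by (rule integral_abs_bound)
    also have "\<dots> \<le> (LINT z|P. e * \<bar>h z\<bar>)"
    proof (rule integral_mono)
      fix z assume "z \<in> space P"
      then have "\<bar>K x z - K y z\<bar> < e"
        using d(2)[of "(x, z)" "(y, z)"] xy by (auto simp: space_P dist_Pair_Pair dist_real_def)
      then show "\<bar>(K x z - K y z) * h z\<bar> \<le> e * \<bar>h z\<bar>"
        by (simp add: abs_mult mult_right_mono)
    qed (use h xy in \<open>auto intro!: continuous_intros K_cont_snd\<close>)
    finally show ?thesis using h by simp
  qed
  with d(1) that show ?thesis by blast
qed

lemma T_cont:
  assumes h: "continuous_on D h" shows "continuous_on D (T h)"
  unfolding continuous_on_iff
proof (intro ballI allI impI)
  fix x e assume x: "x \<in> D" and "e > (0::real)"
  let ?I = "LINT z|P. \<bar>h z\<bar>"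
  have I: "?I \<ge> 0" by simp
  \<comment> \<open>The summand 1 covers the case of a vanishing integral and makes the final
    estimate strict.\<close>
  have "e / (?I + 1) > 0" using \<open>e > 0\<close> I by (intro divide_pos_pos) linarith+
  then obtain d where d: "d > 0"
    "\<And>g x y. continuous_on D g \<Longrightarrow> x \<in> D \<Longrightarrow> y \<in> D \<Longrightarrow> dist x y < d \<Longrightarrow>
      \<bar>T g x - T g y\<bar> \<le> e / (?I + 1) * (LINT z|P. \<bar>g z\<bar>)"
    using T_equicont by blast
  have "?I / (?I + 1) < 1" using I by (subst divide_less_eq_1_pos) linarith+
  then have "e / (?I + 1) * ?I < e" using mult_strict_left_mono[of "?I / (?I + 1)" 1 e] \<open>e > 0\<close> by simp
  then show "\<exists>d>0. \<forall>x'\<in>D. dist x' x < d \<longrightarrow> dist (T h x') (T h x) < e"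
    using d(1) d(2)[OF h _ x] by (intro exI[of _ d]) (fastforce simp: dist_real_def)
qed

text \<open>The kernel is continuous on the closed set \<open>D \<times> D\<close> and arbitrary
  elsewhere. Cutting it off with the indicator gives a Borel function on the whole space that agrees
  with it on the space of the product measure.\<close>

lemma K_measurable_pair: "(\<lambda>z. K (fst z) (snd z)) \<in> borel_measurable (P \<Otimes>\<^sub>M P)"
proof -
  let ?G = "\<lambda>z. indicator (D \<times> D) z *\<^sub>R (\<lambda>(x, y). K x y) z"
  have "closed (D \<times> D)" by (intro compact_imp_closed compact_Times compact_D)
  then have G: "?G \<in> borel_measurable borel"
    by (intro borel_measurable_continuous_on_indicator K_cont) auto
  have id: "(\<lambda>x. x) \<in> measurable P borel"
    by (intro measurable_cont continuous_on_id)
  have "(\<lambda>z. (fst z, snd z)) \<in> measurable (P \<Otimes>\<^sub>M P) borel"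
    unfolding borel_prod[symmetric]
    using measurable_compose[OF measurable_fst id] measurable_compose[OF measurable_snd id]
    by (intro measurable_Pair)
  from measurable_compose[OF this G] have "(\<lambda>z. ?G (fst z, snd z)) \<in> borel_measurable (P \<Otimes>\<^sub>M P)" .
  then show ?thesis
    by (rule measurable_cong[THEN iffD1, rotated]) (auto simp: space_pair_measure space_P)
qed

lemma K_integrable_pair:
  assumes g: "continuous_on D g" and h: "continuous_on D h"
  shows "integrable (P \<Otimes>\<^sub>M P) (\<lambda>z. g (fst z) * h (snd z) * K (fst z) (snd z))"
proof -
  obtain A where A: "0 < A" "\<forall>x\<in>D. \<bar>g x\<bar> \<le> A" using bounded_cont[OF g] by blast
  obtain B where B: "0 < B" "\<forall>x\<in>D. \<bar>h x\<bar> \<le> B" using bounded_cont[OF h] by blast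
  obtain C where C: "0 < C" "\<forall>x\<in>D. \<forall>y\<in>D. \<bar>K x y\<bar> \<le> C" using K_bound by blast
  interpret PP: pair_prob_space P P ..
  note [measurable] = measurable_cont[OF g] measurable_cont[OF h] K_measurable_pair
  show ?thesis
  proof (rule PP.integrable_const_bound[of _ "A * B * C"])
    have "\<bar>g x\<bar> * \<bar>h y\<bar> * \<bar>K x y\<bar> \<le> A * B * C" if "x \<in> D" "y \<in> D" for x y
      using A B C that by (intro mult_mono) auto
    then show "AE z in P \<Otimes>\<^sub>M P. norm (g (fst z) * h (snd z) * K (fst z) (snd z)) \<le> A * B * C"
      by (intro AE_I2) (auto simp: space_pair_measure space_P abs_mult)
  qed measurable
qed

lemma ip_T_pair:
  assumes g: "continuous_on D g" and h: "continuous_on D h"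
  shows "(LINT z|(P \<Otimes>\<^sub>M P). g (fst z) * h (snd z) * K (fst z) (snd z)) = ip g (T h)"
proof -
  interpret PP: pair_prob_space P P ..
  have "(LINT z|(P \<Otimes>\<^sub>M P). g (fst z) * h (snd z) * K (fst z) (snd z)) =
        (LINT x|P. LINT y|P. g x * h y * K x y)"
    using PP.integral_fst'[OF K_integrable_pair[OF g h]] by simp
  also have "\<dots> = (LINT x|P. g x * (LINT y|P. K x y * h y))"
    by (intro Bochner_Integration.integral_cong refl) (simp add: mult.assoc mult.commute[of "K _ _"])
  finally show ?thesis by (simp add: L2_inner_def kernel_op_def)
qed

lemma T_sym:
  assumes g: "continuous_on D g" and h: "continuous_on D h"
  shows "ip g (T h) = ip (T g) h"
proof -
  interpret PP: pair_prob_space P P ..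
  have "ip g (T h) = (LINT x|P. LINT y|P. g x * h y * K x y)"
    unfolding ip_T_pair[OF g h, symmetric]
    using PP.integral_fst'[OF K_integrable_pair[OF g h]] by simp
  also have "\<dots> = (LINT y|P. LINT x|P. g x * h y * K x y)"
    using PP.Fubini_integral[of "\<lambda>x y. g x * h y * K x y"] K_integrable_pair[OF g h]
    by (simp add: case_prod_beta')
  also have "\<dots> = (LINT y|P. (LINT x|P. K y x * g x) * h y)"
    by (intro Bochner_Integration.integral_cong refl, subst integral_mult_left_zero[symmetric],
      intro Bochner_Integration.integral_cong refl) (simp add: space_P K_sym)
  finally show ?thesis by (simp add: L2_inner_def kernel_op_def)
qed

lemma T_add: "continuous_on D g \<Longrightarrow> continuous_on D h \<Longrightarrow> x \<in> D \<Longrightarrow>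
    T (\<lambda>x. g x + c * h x) x = T g x + c * T h x"
  using ip_add[OF K_cont_snd, of x g h c] by (simp add: kernel_op_def L2_inner_def)

lemma T_sum: "(\<And>i. i \<in> I \<Longrightarrow> continuous_on D (g i)) \<Longrightarrow> x \<in> D \<Longrightarrow>
    T (\<lambda>x. \<Sum>i\<in>I. c i * g i x) x = (\<Sum>i\<in>I. c i * T (g i) x)"
  using ip_sum[OF K_cont_snd, of x I g c] by (simp add: kernel_op_def L2_inner_def)

text \<open>
  Apply positive definiteness to the point \<open>x\<close> with weight 1 and to \<open>m\<close> independent random
  points with law \<open>P\<close> and weights \<open>h / m\<close>; the expectation tends to the stated quantity.
\<close>
lemma K_psd_point_function:
  assumes x: "x \<in> D" and h: "continuous_on D h"
  shows "0 \<le> K x x + 2 * T h x + ip h (T h)"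
proof -
  let ?q = "ip h (T h)" and ?d = "LINT y|P. (h y)\<^sup>2 * K y y"
  have main: "0 \<le> K x x + 2 * T h x + ?q + (?d - ?q) / real m" if m: "m > 0" for m :: nat
  proof -
    let ?Q = "PiM {..<m} (\<lambda>_. P)"
    interpret Q: prob_space ?Q by (intro prob_space_PiM prob_space_axioms)
    let ?c = "\<lambda>\<omega> i. h (\<omega> i) / real m"
    let ?G = "\<lambda>i j \<omega>. h (\<omega> i) * h (\<omega> j) * K (\<omega> i) (\<omega> j)"
    have D: "\<omega> i \<in> D" if "\<omega> \<in> space ?Q" "i < m" for \<omega> i
      using that by (auto simp: space_PiM space_P)
    have pos: "0 \<le> K x x + (2 / m) * (\<Sum>i<m. K x (\<omega> i) * h (\<omega> i)) + (1 / m\<^sup>2) * (\<Sum>i<m. \<Sum>j<m. ?G i j \<omega>)"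
      if \<omega>: "\<omega> \<in> space ?Q" for \<omega>
    proof -
      \<comment> \<open>Index 0 carries the fixed point with weight 1; the random points are shifted
        up by one.\<close>
      let ?z = "\<lambda>i. if i = 0 then x else \<omega> (i - 1)" and ?w = "\<lambda>i. if i = 0 then 1 else ?c \<omega> (i - 1)"
      have "0 \<le> (\<Sum>i<Suc m. \<Sum>j<Suc m. ?w i * ?w j * K (?z i) (?z j))"
        using x D[OF \<omega>] by (intro K_psd) auto
      also have "\<dots> = K x x + (\<Sum>j<m. ?c \<omega> j * K x (\<omega> j)) +
          ((\<Sum>i<m. ?c \<omega> i * K (\<omega> i) x) + (\<Sum>i<m. \<Sum>j<m. ?c \<omega> i * ?c \<omega> j * K (\<omega> i) (\<omega> j)))"
        by (simp add: sum.lessThan_Suc_shift sum.distrib del: sum.lessThan_Suc)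
      also have "(\<Sum>i<m. ?c \<omega> i * K (\<omega> i) x) = (\<Sum>j<m. ?c \<omega> j * K x (\<omega> j))"
        using x D[OF \<omega>] by (intro sum.cong refl) (simp add: K_sym)
      also have "(\<Sum>j<m. ?c \<omega> j * K x (\<omega> j)) = (1 / m) * (\<Sum>i<m. K x (\<omega> i) * h (\<omega> i))"
        unfolding sum_distrib_left by (intro sum.cong refl) simp
      also have "(\<Sum>i<m. \<Sum>j<m. ?c \<omega> i * ?c \<omega> j * K (\<omega> i) (\<omega> j)) = (1 / m\<^sup>2) * (\<Sum>i<m. \<Sum>j<m. ?G i j \<omega>)"
        unfolding sum_distrib_left by (intro sum.cong refl) (simp add: power2_eq_square)
      finally show ?thesis by simp
    qed
    have single: "integrable ?Q (\<lambda>\<omega>. g (\<omega> i)) \<and> (LINT \<omega>|?Q. g (\<omega> i)) = (LINT y|P. g y)"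
      if g: "continuous_on D g" and i: "i < m" for g :: "'a \<Rightarrow> real" and i
    proof -
      have "distr ?Q P (\<lambda>\<omega>. \<omega> i) = P"
        using i by (intro distr_PiM_component prob_space_axioms) auto
      moreover have "(\<lambda>\<omega>. \<omega> i) \<in> measurable ?Q P" using i by (intro measurable_component_singleton) auto
      ultimately show ?thesis
        using integral_distr[of "\<lambda>\<omega>. \<omega> i" ?Q P g] integrable_distr[of "\<lambda>\<omega>. \<omega> i" ?Q P g]
          integrable_cont[OF g] measurable_cont[OF g] by auto
    qed
    have pair: "integrable ?Q (?G i j) \<and> (LINT \<omega>|?Q. ?G i j \<omega>) = (if i = j then ?d else ?q)"
      if i: "i < m" "j < m" for i j
    proof (cases "i = j")
      case True
      have "continuous_on D (\<lambda>y. (h y)\<^sup>2 * K y y)" by (intro continuous_intros h K_cont_diag)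
      from single[OF this i(1)] True show ?thesis by (simp add: power2_eq_square)
    next
      case False
      let ?p = "\<lambda>\<omega>. (\<omega> i, \<omega> j)" and ?H = "\<lambda>z. h (fst z) * h (snd z) * K (fst z) (snd z)"
      have d: "distr ?Q (P \<Otimes>\<^sub>M P) ?p = P \<Otimes>\<^sub>M P"
        using i False by (intro distr_PiM_pair[where M = "\<lambda>_. P"] prob_space_axioms) auto
      have "?p \<in> measurable ?Q (P \<Otimes>\<^sub>M P)"
        using i by (intro measurable_Pair measurable_component_singleton) auto
      then show ?thesis
        using integral_distr[of ?p ?Q "P \<Otimes>\<^sub>M P" ?H] integrable_distr[of ?p ?Q "P \<Otimes>\<^sub>M P" ?H] False
          K_integrable_pair[OF h h] ip_T_pair[OF h h] by (simp add: d borel_measurable_integrable)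
    qed
    have Kh: "continuous_on D (\<lambda>y. K x y * h y)" by (intro continuous_intros h K_cont_snd x)
    have 1: "integrable ?Q (\<lambda>\<omega>. \<Sum>i<m. K x (\<omega> i) * h (\<omega> i))"
        "(LINT \<omega>|?Q. (\<Sum>i<m. K x (\<omega> i) * h (\<omega> i))) = (\<Sum>i<m. T h x)"
      using single[OF Kh] by (auto simp: kernel_op_def intro!: Bochner_Integration.integrable_sum)
    have 2: "integrable ?Q (\<lambda>\<omega>. \<Sum>i<m. \<Sum>j<m. ?G i j \<omega>)"
      using pair by (intro Bochner_Integration.integrable_sum) auto
    have "(LINT \<omega>|?Q. (\<Sum>i<m. \<Sum>j<m. ?G i j \<omega>)) = (\<Sum>i<m. LINT \<omega>|?Q. (\<Sum>j<m. ?G i j \<omega>))"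
      using pair by (intro Bochner_Integration.integral_sum Bochner_Integration.integrable_sum) auto
    also have "\<dots> = (\<Sum>i<m. \<Sum>j<m. LINT \<omega>|?Q. ?G i j \<omega>)"
      using pair by (intro sum.cong refl Bochner_Integration.integral_sum) auto
    also have "\<dots> = (\<Sum>i<m. \<Sum>j<m. if i = j then ?d else ?q)"
      using pair by (intro sum.cong refl) auto
    finally have 3: "(LINT \<omega>|?Q. (\<Sum>i<m. \<Sum>j<m. ?G i j \<omega>)) = (\<Sum>i<m. \<Sum>j<m. if i = j then ?d else ?q)" .
    have "0 \<le> (LINT \<omega>|?Q. K x x + (2 / m) * (\<Sum>i<m. K x (\<omega> i) * h (\<omega> i)) + (1 / m\<^sup>2) * (\<Sum>i<m. \<Sum>j<m. ?G i j \<omega>))"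
      by (rule integral_nonneg_AE, rule AE_I2, rule pos)
    also have "\<dots> = K x x + (2 / m) * (LINT \<omega>|?Q. (\<Sum>i<m. K x (\<omega> i) * h (\<omega> i))) +
        (1 / m\<^sup>2) * (LINT \<omega>|?Q. (\<Sum>i<m. \<Sum>j<m. ?G i j \<omega>))"
      using 1(1) 2 by (simp add: Q.prob_space)
    also note 1(2)
    also note 3
    \<comment> \<open>Each row contains one coincidence \<open>i = j\<close>, where both arguments
      of the kernel are the same random point, and \<open>m - 1\<close> independent pairs. Hence the
      mean of the double sum differs from \<open>?q\<close> by a term of order
      \<open>1 / m\<close>.\<close>
    also have "(\<Sum>i<m. \<Sum>j<m. if i = j then ?d else ?q) = (\<Sum>i<m. ?d + (real m - 1) * ?q)"
    proof (rule sum.cong[OF refl])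
      fix i assume i: "i \<in> {..<m}"
      have "(\<Sum>j<m. if i = j then ?d else ?q) = (\<Sum>j<m. ?q + (if i = j then ?d - ?q else 0))"
        by (intro sum.cong) auto
      then show "(\<Sum>j<m. if i = j then ?d else ?q) = ?d + (real m - 1) * ?q"
        using i by (simp add: sum.distrib sum.delta algebra_simps)
    qed
    finally have "0 \<le> K x x + 2 * T h x + (?d + (real m - 1) * ?q) / m"
      using m by (simp add: power2_eq_square)
    then show ?thesis using m by (simp add: field_simps)
  qed
  have "(\<lambda>m. K x x + 2 * T h x + ?q + (?d - ?q) / real m) \<longlonglongrightarrow> K x x + 2 * T h x + ?q + 0"
    by (intro tendsto_add tendsto_const lim_const_over_n)
  moreover have "\<forall>\<^sub>F m in sequentially. 0 \<le> K x x + 2 * T h x + ?q + (?d - ?q) / real m"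
    by (rule eventually_mono[OF eventually_gt_at_top[of 0]]) (rule main)
  ultimately have "0 \<le> K x x + 2 * T h x + ?q + 0"
    by (intro tendsto_lowerbound[where F = sequentially]) auto
  then show ?thesis by simp
qed

text \<open>Scaling \<open>h\<close> turns the inequality into a polynomial in \<open>t\<close>,
  ready for the discriminant argument.\<close>

lemma K_psd_point_function_scaled:
  assumes x: "x \<in> D" and h: "continuous_on D h"
  shows "0 \<le> K x x + 2 * t * T h x + t\<^sup>2 * ip h (T h)"
proof -
  have T: "T (\<lambda>y. t * h y) y = t * T h y" for y
    by (simp add: kernel_op_def mult.left_commute[of _ t])
  have "ip (\<lambda>y. t * h y) (T (\<lambda>y. t * h y)) = t\<^sup>2 * ip h (T h)"
    by (simp add: L2_inner_def T power2_eq_square mult_ac flip: integral_mult_right_zero)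
  moreover have "continuous_on D (\<lambda>y. t * h y)" by (intro continuous_intros h)
  ultimately show ?thesis using K_psd_point_function[OF x, of "\<lambda>y. t * h y"] T by simp
qed

section \<open>Positivity and Cauchy-Schwarz inequalities for the quadratic form of the
  operator\<close>

lemma D_nonempty: "D \<noteq> {}"
  using not_empty space_P by simp

text \<open>A negative value would force \<open>T h x = 0\<close> through the discriminant; the
  remaining polynomial in \<open>t\<close> then has no linear term and a negative leading
  coefficient, which a large \<open>t\<close> refutes.\<close>

lemma ip_T_nonneg:
  assumes h: "continuous_on D h"
  shows "0 \<le> ip h (T h)"
proof (rule ccontr)
  assume neg: "\<not> 0 \<le> ip h (T h)"
  obtain x where x: "x \<in> D" using D_nonempty by blast
  have "(T h x)\<^sup>2 \<le> K x x * ip h (T h)"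
    using K_psd_point_function_scaled[OF x h] by (rule quadratic_nonneg_discriminant)
  moreover have "K x x * ip h (T h) \<le> 0" using K_nonneg[OF x] neg by (simp add: mult_nonneg_nonpos)
  ultimately have "T h x = 0" by (metis order_antisym power2_less_eq_zero_iff order_trans)
  then have "0 \<le> K x x + t\<^sup>2 * ip h (T h)" for t
    using K_psd_point_function_scaled[OF x h, of t] by simp
  from this[of "sqrt ((K x x + 1) / - ip h (T h))"] show False
    using neg K_nonneg[OF x] by (simp add: field_simps)
qed

text \<open>The passage from the form back to the operator. The discriminant bounds the square of
  \<open>T h x\<close> by \<open>K x x * ip h (T h)\<close> at each point, so the conclusion holds
  everywhere on \<open>D\<close>.\<close>

lemma T_eq_0_if_ip_eq_0:
  assumes h: "continuous_on D h" and "ip h (T h) = 0" and x: "x \<in> D"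
  shows "T h x = 0"
  using quadratic_nonneg_discriminant[OF K_psd_point_function_scaled[OF x h]] assms(2) by simp

text \<open>Taken with \<open>T h\<close> in the role of \<open>g\<close>, it converts a bound on
  the form into a bound on the operator norm.\<close>

lemma ip_T_cauchy_schwarz:
  assumes g: "continuous_on D g" and h: "continuous_on D h"
  shows "(ip g (T h))\<^sup>2 \<le> ip g (T g) * ip h (T h)"
proof (rule quadratic_nonneg_discriminant)
  fix t :: real
  let ?u = "\<lambda>x. g x + t * h x"
  have u: "continuous_on D ?u" using g h by (intro continuous_intros)
  have "ip f (T ?u) = ip f (\<lambda>x. T g x + t * T h x)" for f
    unfolding L2_inner_def by (intro Bochner_Integration.integral_cong refl) (simp add: space_P T_add[OF g h])
  then have *: "ip f (T ?u) = ip f (T g) + t * ip f (T h)" if "continuous_on D f" for f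
    using ip_add[OF that T_cont[OF g] T_cont[OF h]] by simp
  have "ip ?u (T ?u) = ip (T ?u) g + t * ip (T ?u) h"
    unfolding ip_commute[of ?u] by (rule ip_add[OF T_cont[OF u] g h])
  also have "\<dots> = ip g (T ?u) + t * ip h (T ?u)" by (simp add: ip_commute)
  also have "\<dots> = ip g (T g) + 2 * t * ip g (T h) + t\<^sup>2 * ip h (T h)"
    using *[OF g] *[OF h] T_sym[OF g h]
    by (simp add: ip_commute[of "T g"] algebra_simps power2_eq_square)
  finally show "0 \<le> ip g (T g) + 2 * t * ip g (T h) + t\<^sup>2 * ip h (T h)"
    using ip_T_nonneg[OF u] by simp
qed

text \<open>Cauchy-Schwarz against the constant 1, whose norm is 1 since \<open>P\<close> is a
  probability measure.\<close>

lemma expectation_abs_le: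
  assumes h: "continuous_on D h" and "ip h h \<le> 1"
  shows "(LINT z|P. \<bar>h z\<bar>) \<le> 1"
proof -
  have "(ip (\<lambda>_. 1) (\<lambda>z. \<bar>h z\<bar>))\<^sup>2 \<le> ip (\<lambda>_. 1) (\<lambda>_. 1) * ip (\<lambda>z. \<bar>h z\<bar>) (\<lambda>z. \<bar>h z\<bar>)"
    using h by (intro ip_cauchy_schwarz continuous_intros)
  then have "(LINT z|P. \<bar>h z\<bar>)\<^sup>2 \<le> 1"
    using assms(2) by (simp add: L2_inner_def prob_space flip: abs_mult)
  then show ?thesis using power2_le_imp_le[of "LINT z|P. \<bar>h z\<bar>" 1] by simp
qed

lemma T_bound: "\<exists>C>0. \<forall>h. continuous_on D h \<longrightarrow> ip h h \<le> 1 \<longrightarrow> (\<forall>x\<in>D. \<bar>T h x\<bar> \<le> C)"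
proof -
  obtain C where C: "C > 0" "\<forall>x\<in>D. \<forall>y\<in>D. \<bar>K x y\<bar> \<le> C" using K_bound by blast
  have "\<bar>T h x\<bar> \<le> C" if h: "continuous_on D h" "ip h h \<le> 1" and x: "x \<in> D" for h x
  proof -
    have "\<bar>T h x\<bar> \<le> (LINT z|P. \<bar>K x z * h z\<bar>)"
      unfolding kernel_op_def by (rule integral_abs_bound)
    also have "\<dots> \<le> (LINT z|P. C * \<bar>h z\<bar>)"
      using C x h(1) by (intro integral_mono integrable_cont continuous_intros K_cont_snd)
        (auto simp: abs_mult space_P intro!: mult_right_mono)
    also have "\<dots> \<le> C * 1"
      using expectation_abs_le[OF h] C(1) by (simp add: mult_left_le)
    finally show ?thesis by simp
  qed
  with C(1) show ?thesis by blast
qed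

lemma ip_self_le:
  assumes h: "continuous_on D h" and le: "\<And>x. x \<in> D \<Longrightarrow> \<bar>h x\<bar> \<le> C"
  shows "ip h h \<le> C\<^sup>2"
proof -
  have "ip h h \<le> (LINT z|P. C\<^sup>2)"
    unfolding L2_inner_def
  proof (rule integral_mono)
    fix x assume "x \<in> space P"
    then have "\<bar>h x\<bar>\<^sup>2 \<le> C\<^sup>2" using le by (intro power_mono) (auto simp: space_P)
    then show "h x * h x \<le> C\<^sup>2" by (simp add: power2_eq_square)
  qed (use h in \<open>auto intro!: integrable_cont continuous_intros\<close>)
  then show ?thesis by (simp add: prob_space)
qed

lemma ip_uniform_limit:
  assumes u: "continuous_on D u" and f: "\<And>n. continuous_on D (f n)" and g: "continuous_on D g"
    and lim: "uniform_limit D f g sequentially"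
  shows "(\<lambda>n. ip u (f n)) \<longlonglongrightarrow> ip u g"
proof (rule tendstoI)
  fix e :: real assume e: "e > 0"
  define A where "A = (LINT z|P. \<bar>u z\<bar>)"
  have A: "A \<ge> 0" by (simp add: A_def)
  have d: "e / (A + 1) > 0" using e A by (intro divide_pos_pos) auto
  from uniform_limitD[OF lim d]
  show "\<forall>\<^sub>F n in sequentially. dist (ip u (f n)) (ip u g) < e"
  proof eventually_elim
    fix n assume n: "\<forall>x\<in>D. dist (f n x) (g x) < e / (A + 1)"
    have "ip u (f n) - ip u g = ip u (\<lambda>x. f n x + (-1) * g x)"
      by (subst ip_add[OF u f g]) simp
    also have "\<bar>\<dots>\<bar> \<le> (LINT z|P. \<bar>u z * (f n z + (-1) * g z)\<bar>)"
      unfolding L2_inner_def by (rule integral_abs_bound)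
    also have "\<dots> \<le> (LINT z|P. \<bar>u z\<bar> * (e / (A + 1)))"
    proof (rule integral_mono)
      fix z assume "z \<in> space P"
      then have "\<bar>f n z - g z\<bar> < e / (A + 1)" using n by (auto simp: space_P dist_real_def)
      then show "\<bar>u z * (f n z + (-1) * g z)\<bar> \<le> \<bar>u z\<bar> * (e / (A + 1))"
        unfolding abs_mult by (intro mult_left_mono) auto
    qed (intro integrable_cont continuous_intros u f g)+
    also have "\<dots> = A * (e / (A + 1))" by (simp add: A_def)
    also have "\<dots> < e"
    proof -
      have "A / (A + 1) < 1" using A by simp
      from mult_strict_right_mono[OF this e] show ?thesis by simp
    qed
    finally show "dist (ip u (f n)) (ip u g) < e" by (simp add: dist_real_def)
  qed
qed

end

subsection \<open>Mercer's theorem\<close>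

locale mercer_eigensystem = mercer_space D P K
  for D :: "'a::euclidean_space set" and P K +
  fixes lam :: "nat \<Rightarrow> real" and phi :: "nat \<Rightarrow> 'a \<Rightarrow> real"
  assumes eigensystem: "eigensystem D P K lam phi"
begin

lemma lam_pos: "k \<ge> 1 \<Longrightarrow> lam k > 0"
  and phi_cont: "k \<ge> 1 \<Longrightarrow> continuous_on D (phi k)"
  and phi_eigen: "k \<ge> 1 \<Longrightarrow> eigenfunction P K (lam k) (phi k)"
  and phi_ortho: "j \<ge> 1 \<Longrightarrow> k \<ge> 1 \<Longrightarrow> ip (phi j) (phi k) = (if j = k then 1 else 0)"
  using eigensystem unfolding eigensystem_def by blast+

lemma eigenfunction_span: "\<mu> \<noteq> 0 \<Longrightarrow> eigenfunction P K \<mu> f \<Longrightarrow>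
    \<exists>I c. finite I \<and> I \<subseteq> {k. k \<ge> 1 \<and> lam k = \<mu>} \<and> (AE x in P. f x = (\<Sum>k\<in>I. c k * phi k x))"
  using eigensystem unfolding eigensystem_def by blast

text \<open>The eigenvalue equation is assumed almost everywhere; both sides are continuous, so it
  holds at every point.\<close>

lemma T_phi:
  assumes k: "k \<ge> 1" and x: "x \<in> D" shows "T (phi k) x = lam k * phi k x"
  using phi_eigen[OF k]
  by (intro AE_cont_eq[OF _ _ _ x] T_cont continuous_intros phi_cont k) (simp add: eigenfunction_def)

lemma T_sum_phi:
  assumes I: "I \<subseteq> {1..}" and x: "x \<in> D"
  shows "T (\<lambda>y. \<Sum>k\<in>I. c k * phi k y) x = (\<Sum>k\<in>I. c k * lam k * phi k x)"
  using I x by (subst T_sum) (auto intro!: phi_cont sum.cong simp: T_phi subset_iff)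

lemma ip_phi_sum:
  assumes I: "I \<subseteq> {1..}" "finite I" and k: "k \<ge> 1"
  shows "ip (phi k) (\<lambda>y. \<Sum>j\<in>I. c j * phi j y) = (if k \<in> I then c k else 0)"
proof -
  have "ip (phi k) (\<lambda>y. \<Sum>j\<in>I. c j * phi j y) = (\<Sum>j\<in>I. c j * ip (phi k) (phi j))"
    using I k by (intro ip_sum phi_cont) auto
  also have "\<dots> = (\<Sum>j\<in>I. if k = j then c k else 0)"
    using I k by (intro sum.cong refl) (auto simp: phi_ortho)
  finally show ?thesis using I by (simp add: sum.delta)
qed

text \<open>A Bessel inequality. For the combination of eigenfunctions with coefficients
  \<open>- phi k x\<close>, the form equals the left-hand sum and \<open>T\<close> at
  \<open>x\<close> equals its negative, so \<open>K_psd_point_function\<close> reads 0 \<le>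
  \<open>K x x\<close> minus twice the sum plus the sum.\<close>

lemma partial_diagonal_le:
  assumes I: "I \<subseteq> {1..}" "finite I" and x: "x \<in> D"
  shows "(\<Sum>k\<in>I. lam k * (phi k x)\<^sup>2) \<le> K x x"
proof -
  let ?h = "\<lambda>y. \<Sum>k\<in>I. (- phi k x) * phi k y"
  have h: "continuous_on D ?h" using I by (intro continuous_intros phi_cont) auto
  have phi_I: "k \<ge> 1" if "k \<in> I" for k using that I by auto
  have "ip ?h (T ?h) = ip ?h (\<lambda>y. \<Sum>k\<in>I. (- phi k x * lam k) * phi k y)"
    unfolding L2_inner_def
    by (intro Bochner_Integration.integral_cong refl arg_cong2[of _ _ _ _ "(*)"] T_sum_phi I(1)) (simp add: space_P)
  also have "\<dots> = (\<Sum>k\<in>I. (- phi k x * lam k) * ip ?h (phi k))"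
    using h phi_I by (intro ip_sum phi_cont) auto
  also have "\<dots> = (\<Sum>k\<in>I. lam k * (phi k x)\<^sup>2)"
  proof (rule sum.cong[OF refl])
    fix k assume k: "k \<in> I"
    have "ip ?h (phi k) = - phi k x"
      unfolding ip_commute[of ?h] ip_phi_sum[OF I phi_I[OF k]] using k by simp
    then show "(- phi k x * lam k) * ip ?h (phi k) = lam k * (phi k x)\<^sup>2" by (simp add: power2_eq_square)
  qed
  finally have q: "ip ?h (T ?h) = (\<Sum>k\<in>I. lam k * (phi k x)\<^sup>2)" .
  have t: "T ?h x = - (\<Sum>k\<in>I. lam k * (phi k x)\<^sup>2)"
    unfolding T_sum_phi[OF I(1) x] sum_negf[symmetric]
    by (intro sum.cong refl) (simp add: power2_eq_square)
  show ?thesis using K_psd_point_function[OF x h] unfolding q t by simp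
qed

section \<open>The orthogonal complement of the eigenfunctions\<close>

text \<open>Restricted to continuous functions, so that members have point values; \<open>T\<close>
  maps the set into itself by \<open>perp_T\<close>.\<close>

definition perp :: "('a \<Rightarrow> real) set" where
  "perp = {h. continuous_on D h \<and> (\<forall>k\<ge>1. ip (phi k) h = 0)}"

lemma perpD: "h \<in> perp \<Longrightarrow> continuous_on D h" "h \<in> perp \<Longrightarrow> k \<ge> 1 \<Longrightarrow> ip (phi k) h = 0"
  by (auto simp: perp_def)

lemma perp_T:
  assumes "h \<in> perp" shows "T h \<in> perp"
proof -
  have "ip (phi k) (T h) = 0" if k: "k \<ge> 1" for k
  proof -
    have "ip (phi k) (T h) = ip (T (phi k)) h" using k perpD(1)[OF assms] by (intro T_sym phi_cont)
    also have "\<dots> = lam k * ip (phi k) h"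
      unfolding L2_inner_def integral_mult_right_zero[symmetric]
      by (intro Bochner_Integration.integral_cong refl) (use k in \<open>simp add: space_P T_phi\<close>)
    finally show ?thesis using perpD(2)[OF assms k] by simp
  qed
  then show ?thesis using T_cont perpD(1)[OF assms] by (simp add: perp_def)
qed

lemma ip_scale: "ip (\<lambda>x. t * g x) (\<lambda>x. t * h x) = t\<^sup>2 * ip g h"
  by (simp add: L2_inner_def power2_eq_square mult_ac flip: integral_mult_right_zero)

lemma T_scale: "T (\<lambda>y. t * h y) = (\<lambda>x. t * T h x)"
  by (rule ext) (simp add: kernel_op_def mult.left_commute[of _ t])

lemma perp_scale: "h \<in> perp \<Longrightarrow> (\<lambda>x. t * h x) \<in> perp"
  by (auto simp: perp_def L2_inner_def mult.left_commute[of _ t] intro!: continuous_intros)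

text \<open>
  If the form did not vanish on the orthogonal complement of the eigenfunctions, a maximising
  sequence on the unit ball would have images converging uniformly, by Arzela-Ascoli, to an
  eigenfunction that is orthogonal to all \<open>phi k\<close>.
\<close>
lemma form_eq_0_on_perp:
  assumes h0: "h0 \<in> perp" shows "ip h0 (T h0) = 0"
proof (rule ccontr)
  assume "ip h0 (T h0) \<noteq> 0"
  then have q0: "ip h0 (T h0) > 0" using ip_T_nonneg[OF perpD(1)[OF h0]] by simp
  define B where "B = {h \<in> perp. ip h h \<le> 1}"
  define \<mu> where "\<mu> = (SUP h\<in>B. ip h (T h))"
  obtain C where C: "C > 0" "\<And>h x. continuous_on D h \<Longrightarrow> ip h h \<le> 1 \<Longrightarrow> x \<in> D \<Longrightarrow> \<bar>T h x\<bar> \<le> C"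
    using T_bound by blast
  have B_cont: "continuous_on D h" and B_ip: "ip h h \<le> 1" and B_perp: "h \<in> perp" if "h \<in> B" for h
    using that perpD(1) by (auto simp: B_def)
  \<comment> \<open>The bound \<open>c\<close> is left free: \<open>C\<close> makes the supremum
    finite, and \<open>\<mu> / 2\<close> later excludes a zero limit.\<close>
  have form_le: "ip h (T h) \<le> c" if h: "h \<in> B" and c: "c \<ge> 0" "\<And>x. x \<in> D \<Longrightarrow> \<bar>T h x\<bar> \<le> c" for h c
  proof -
    have "(ip h (T h))\<^sup>2 \<le> ip h h * ip (T h) (T h)"
      using B_cont[OF h] by (intro ip_cauchy_schwarz T_cont)
    also have "\<dots> \<le> 1 * c\<^sup>2"
      using B_ip[OF h] ip_self_le[OF T_cont[OF B_cont[OF h]] c(2)] ip_self_nonneg by (intro mult_mono) auto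
    finally show ?thesis using power2_le_imp_le[of "ip h (T h)" c] c(1) by simp
  qed
  have bdd: "bdd_above ((\<lambda>h. ip h (T h)) ` B)"
    by (intro bdd_aboveI2[of _ _ C] form_le C less_imp_le[OF C(1)] B_cont B_ip)
  have form_le_\<mu>: "ip h (T h) \<le> \<mu> * ip h h" if h: "h \<in> perp" for h
  proof (cases "ip h h = 0")
    case True
    then have "ip h (T h) = 0"
      using ip_cauchy_schwarz[OF perpD(1)[OF h] T_cont[OF perpD(1)[OF h]]] by simp
    then show ?thesis using True by simp
  next
    case False
    then have r: "ip h h > 0" using ip_self_nonneg[of h] by simp
    let ?t = "1 / sqrt (ip h h)"
    have t: "?t\<^sup>2 = 1 / ip h h" using r by (simp add: power_divide)
    have "ip (\<lambda>x. ?t * h x) (\<lambda>x. ?t * h x) = 1" unfolding ip_scale t using r by simp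
    then have "(\<lambda>x. ?t * h x) \<in> B" using perp_scale[OF h, of ?t] unfolding B_def by auto
    then have "ip (\<lambda>x. ?t * h x) (T (\<lambda>x. ?t * h x)) \<le> \<mu>"
      unfolding \<mu>_def by (intro cSUP_upper bdd)
    then have "1 / ip h h * ip h (T h) \<le> \<mu>" unfolding T_scale ip_scale t .
    then show ?thesis using r by (simp add: field_simps)
  qed
  have \<mu>: "\<mu> > 0"
    using form_le_\<mu>[OF h0] q0 ip_self_nonneg[of h0] by (smt (verit) mult_nonneg_nonpos2 mult_nonpos_nonneg)
  \<comment> \<open>Cauchy-Schwarz for the form at \<open>T h\<close> and \<open>h\<close>, followed
    by division by \<open>ip (T h) (T h)\<close>: on \<open>perp\<close> the supremum of the form
    also bounds the operator norm. The set being invariant under \<open>T\<close> is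
    essential.\<close>
  have T_norm: "ip (T h) (T h) \<le> \<mu>\<^sup>2 * ip h h" if h: "h \<in> perp" for h
  proof -
    have "(ip (T h) (T h))\<^sup>2 \<le> ip (T h) (T (T h)) * ip h (T h)"
      using perpD(1)[OF h] by (intro ip_T_cauchy_schwarz T_cont)
    also have "\<dots> \<le> (\<mu> * ip (T h) (T h)) * (\<mu> * ip h h)"
      using form_le_\<mu>[OF h] form_le_\<mu>[OF perp_T[OF h]] \<mu> ip_self_nonneg
        ip_T_nonneg[OF perpD(1)[OF h]] by (intro mult_mono) auto
    finally have "ip (T h) (T h) * ip (T h) (T h) \<le> ip (T h) (T h) * (\<mu>\<^sup>2 * ip h h)"
      by (simp add: power2_eq_square mult_ac)
    then show ?thesis
      using ip_self_nonneg[of "T h"] ip_self_nonneg[of h] \<mu>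
      by (cases "ip (T h) (T h) = 0") (auto simp: mult_le_cancel_left)
  qed
  have "\<exists>h\<in>B. \<mu> - 1 / real (Suc n) < ip h (T h)" for n
  proof -
    have "\<mu> - 1 / real (Suc n) < Sup ((\<lambda>h. ip h (T h)) ` B)" by (simp add: \<mu>_def)
    moreover have "(\<lambda>_. 0) \<in> B" by (simp add: B_def perp_def L2_inner_def)
    ultimately show ?thesis using less_cSUP_iff[OF _ bdd] by blast
  qed
  then obtain H where H: "\<And>n. H n \<in> B" "\<And>n. \<mu> - 1 / real (Suc n) < ip (H n) (T (H n))"
    by metis
  note Hc = B_cont[OF H(1)] and HV = B_perp[OF H(1)] and Hn = B_ip[OF H(1)]
  obtain g r where g: "continuous_on D g" and r: "strict_mono (r :: nat \<Rightarrow> nat)"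
    and conv: "\<And>e. 0 < e \<Longrightarrow> \<exists>N. \<forall>n x. n \<ge> N \<and> x \<in> D \<longrightarrow> norm (T (H (r n)) x - g x) < e"
  proof (rule Arzela_Ascoli[OF compact_D, of "\<lambda>n. T (H n)" C])
    show "norm (T (H n) x) \<le> C" if "x \<in> D" for n x using C(2)[OF Hc Hn that] by simp
    show "\<exists>d. 0 < d \<and> (\<forall>n y. y \<in> D \<and> norm (x - y) < d \<longrightarrow> norm (T (H n) x - T (H n) y) < e)"
      if x: "x \<in> D" and e: "0 < e" for x e
    proof -
      obtain d where d: "d > 0" "\<And>h x y. continuous_on D h \<Longrightarrow> x \<in> D \<Longrightarrow> y \<in> D \<Longrightarrow> dist x y < d \<Longrightarrow>
          \<bar>T h x - T h y\<bar> \<le> e / 2 * (LINT z|P. \<bar>h z\<bar>)"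
        using T_equicont[of "e / 2"] e by auto
      have "norm (T (H n) x - T (H n) y) < e" if "y \<in> D" "norm (x - y) < d" for n y
      proof -
        have "\<bar>T (H n) x - T (H n) y\<bar> \<le> e / 2 * (LINT z|P. \<bar>H n z\<bar>)"
          using that x by (intro d(2) Hc) (auto simp: dist_norm)
        also have "\<dots> \<le> e / 2 * 1"
          using e by (intro mult_left_mono expectation_abs_le Hc Hn) auto
        finally show ?thesis using e by simp
      qed
      then show ?thesis using d(1) by blast
    qed
  qed blast
  have unif: "uniform_limit D (\<lambda>n. T (H (r n))) g sequentially"
  proof (rule uniform_limitI)
    fix e :: real assume "e > 0"
    from conv[OF this] show "\<forall>\<^sub>F n in sequentially. \<forall>x\<in>D. dist (T (H (r n)) x) (g x) < e"
      unfolding eventually_sequentially by (auto simp: dist_norm)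
  qed
  note lim = ip_uniform_limit[OF _ T_cont[OF Hc] g unif]
  have inv: "(\<lambda>n. 1 / real (Suc (r n))) \<longlonglongrightarrow> 0"
    using LIMSEQ_subseq_LIMSEQ[OF LIMSEQ_Suc[OF lim_1_over_n] r] by (simp add: o_def)
  have gV: "g \<in> perp"
  proof -
    have "ip (phi k) g = 0" if k: "k \<ge> 1" for k
      using lim[OF phi_cont[OF k]] unfolding perpD(2)[OF perp_T[OF HV] k] by (simp add: LIMSEQ_const_iff)
    then show ?thesis using g by (simp add: perp_def)
  qed
  \<comment> \<open>With a zero limit the images would eventually be at most
    \<open>\<mu> / 2\<close> in sup norm, and so would the form values, although these tend to
    \<mu>.\<close>
  have g_nz: "ip g g \<noteq> 0"
  proof
    assume "ip g g = 0"
    then have 0: "g x = 0" if "x \<in> D" for x using ip_self_eq_0[OF g] that by blast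
    have "\<forall>\<^sub>F n in sequentially. \<forall>x\<in>D. dist (T (H (r n)) x) (g x) < \<mu> / 2"
      using \<mu> by (intro uniform_limitD[OF unif]) simp
    moreover have "\<forall>\<^sub>F n in sequentially. 1 / real (Suc (r n)) < \<mu> / 2"
      using \<mu> by (intro order_tendstoD(2)[OF inv]) simp
    ultimately have "\<forall>\<^sub>F n in sequentially. False"
    proof eventually_elim
      case (elim n)
      have "ip (H (r n)) (T (H (r n))) \<le> \<mu> / 2"
        using elim(1) 0 \<mu> by (intro form_le H(1)) (auto simp: dist_real_def intro: less_imp_le)
      then show False using H(2)[of "r n"] elim(2) by linarith
    qed
    then show False by simp
  qed
  have eig: "T g x = \<mu> * g x" if x: "x \<in> D" for x
  proof -
    \<comment> \<open>The residual of the eigenvalue equation along the maximising sequence.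
      Expanding its squared norm and inserting \<open>T_norm\<close> and near-maximality leaves at
      most 2 \<mu> times the gap to the supremum.\<close>
    define E where "E n y = T (H (r n)) y + (- \<mu>) * H (r n) y" for n y
    have Ec: "continuous_on D (E n)" for n unfolding E_def by (intro continuous_intros T_cont Hc)
    have E_norm: "ip (E n) (E n) \<le> 2 * \<mu> * (1 / real (Suc (r n)))" for n
    proof -
      let ?h = "H (r n)"
      note hc = Hc[of "r n"]
      have "E n = (\<lambda>y. T ?h y + (- \<mu>) * ?h y)" by (simp add: E_def fun_eq_iff)
      then have E: "ip f (E n) = ip f (T ?h) + (- \<mu>) * ip f ?h" if "continuous_on D f" for f
        by (simp only: ip_add[OF that T_cont[OF hc] hc])
      have "ip (E n) (E n) = ip (E n) (T ?h) + (- \<mu>) * ip (E n) ?h" by (rule E[OF Ec])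
      also have "ip (E n) (T ?h) = ip (T ?h) (T ?h) + (- \<mu>) * ip ?h (T ?h)"
        using E[OF T_cont[OF hc]] by (simp add: ip_commute[of "E n"] ip_commute[of "T ?h" ?h])
      also have "ip (E n) ?h = ip ?h (T ?h) + (- \<mu>) * ip ?h ?h"
        using E[OF hc] by (simp add: ip_commute[of "E n"])
      also have "ip (T ?h) (T ?h) + - \<mu> * ip ?h (T ?h) + - \<mu> * (ip ?h (T ?h) + - \<mu> * ip ?h ?h) =
          ip (T ?h) (T ?h) - 2 * \<mu> * ip ?h (T ?h) + \<mu>\<^sup>2 * ip ?h ?h"
        by (simp add: algebra_simps power2_eq_square)
      also have "\<dots> \<le> \<mu>\<^sup>2 * 1 - 2 * \<mu> * (\<mu> - 1 / real (Suc (r n))) + \<mu>\<^sup>2 * 1"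
      proof -
        have "\<mu>\<^sup>2 * ip ?h ?h \<le> \<mu>\<^sup>2 * 1" by (intro mult_left_mono Hn) simp
        moreover have "2 * \<mu> * (\<mu> - 1 / real (Suc (r n))) \<le> 2 * \<mu> * ip ?h (T ?h)"
          using \<mu> H(2)[of "r n"] by (intro mult_left_mono) auto
        ultimately show ?thesis using T_norm[OF HV[of "r n"]] by linarith
      qed
      also have "\<dots> = 2 * \<mu> * (1 / real (Suc (r n)))" by (simp add: algebra_simps power2_eq_square)
      finally show ?thesis .
    qed
    \<comment> \<open>The functions \<open>H (r n)\<close> themselves need not converge, only their
      images do. Pairing the residual with \<open>K x\<close> applies \<open>T\<close> once more, so
      that only images remain and the limit can be taken.\<close>
    have "(\<lambda>n. (ip (K x) (E n))\<^sup>2) \<longlonglongrightarrow> 0"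
    proof (rule tendsto_sandwich[OF _ _ tendsto_const])
      show "\<forall>\<^sub>F n in sequentially. (ip (K x) (E n))\<^sup>2 \<le> ip (K x) (K x) * (2 * \<mu> * (1 / real (Suc (r n))))"
      proof (intro always_eventually allI)
        fix n
        have "(ip (K x) (E n))\<^sup>2 \<le> ip (K x) (K x) * ip (E n) (E n)"
          by (intro ip_cauchy_schwarz K_cont_snd x Ec)
        also have "\<dots> \<le> ip (K x) (K x) * (2 * \<mu> * (1 / real (Suc (r n))))"
          by (intro mult_left_mono E_norm ip_self_nonneg)
        finally show "(ip (K x) (E n))\<^sup>2 \<le> ip (K x) (K x) * (2 * \<mu> * (1 / real (Suc (r n))))" .
      qed
      show "(\<lambda>n. ip (K x) (K x) * (2 * \<mu> * (1 / real (Suc (r n))))) \<longlonglongrightarrow> 0"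
        by (intro tendsto_mult_right_zero inv)
    qed simp
    then have "(\<lambda>n. ip (K x) (E n)) \<longlonglongrightarrow> 0" by simp
    moreover have "ip (K x) (E n) = ip (K x) (T (H (r n))) - \<mu> * T (H (r n)) x" for n
      unfolding E_def ip_add[OF K_cont_snd[OF x] T_cont[OF Hc] Hc]
      by (simp add: L2_inner_def kernel_op_def)
    moreover have "(\<lambda>n. ip (K x) (T (H (r n))) - \<mu> * T (H (r n)) x) \<longlonglongrightarrow> ip (K x) g - \<mu> * g x"
      by (intro tendsto_intros lim K_cont_snd x tendsto_uniform_limitI[OF unif x])
    ultimately have "ip (K x) g - \<mu> * g x = 0" using LIMSEQ_unique by (metis (no_types, lifting) ext)
    then show ?thesis by (simp add: L2_inner_def kernel_op_def)
  qed
  have "eigenfunction P K \<mu> g"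
    unfolding eigenfunction_def
  proof (intro conjI notI)
    show "square_integrable P g" by (rule square_integrable_cont[OF g])
    show "AE x in P. kernel_op P K g x = \<mu> * g x" by (rule AE_I2) (simp add: eig space_P)
    assume "AE x in P. g x = 0"
    then have "ip g g = (LINT x|P. 0)"
      unfolding L2_inner_def using measurable_cont[OF g] by (intro integral_cong_AE) auto
    with g_nz show False by simp
  qed
  \<comment> \<open>Exhaustiveness of the list: \<open>g\<close> is almost everywhere a combination
    of eigenfunctions, to all of which it is orthogonal, so its norm vanishes.\<close>
  then have "\<exists>I c. finite I \<and> I \<subseteq> {k. k \<ge> 1 \<and> lam k = \<mu>} \<and> (AE x in P. g x = (\<Sum>k\<in>I. c k * phi k x))"
    by (rule eigenfunction_span[rotated]) (use \<mu> in simp)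
  then obtain I c where I: "finite I" "I \<subseteq> {k. k \<ge> 1 \<and> lam k = \<mu>}" "AE x in P. g x = (\<Sum>k\<in>I. c k * phi k x)"
    by (elim exE conjE)
  have sc: "continuous_on D (\<lambda>x. \<Sum>k\<in>I. c k * phi k x)" using I by (intro continuous_intros phi_cont) auto
  have "ip g g = ip g (\<lambda>x. \<Sum>k\<in>I. c k * phi k x)"
    unfolding L2_inner_def
  proof (rule integral_cong_AE)
    show "AE x in P. g x * g x = g x * (\<Sum>k\<in>I. c k * phi k x)" using I(3) by (rule AE_mp) simp
  qed (intro borel_measurable_times measurable_cont g sc)+
  also have "\<dots> = (\<Sum>k\<in>I. c k * ip g (phi k))" using I by (intro ip_sum g phi_cont) auto
  also have "\<dots> = 0"
    using I perpD(2)[OF gV] by (intro sum.neutral ballI) (auto simp: ip_commute[of g])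
  finally show False using g_nz by simp
qed

section \<open>Pointwise expansion of the kernel\<close>

lemma partial_diagonal_le_lessThan:
  assumes x: "x \<in> D" shows "(\<Sum>k<N. lam (Suc k) * (phi (Suc k) x)\<^sup>2) \<le> K x x"
proof -
  have "(\<Sum>k<N. lam (Suc k) * (phi (Suc k) x)\<^sup>2) = (\<Sum>k\<in>Suc ` {..<N}. lam k * (phi k x)\<^sup>2)"
    by (subst sum.reindex) auto
  also have "\<dots> \<le> K x x" by (intro partial_diagonal_le x) auto
  finally show ?thesis .
qed

lemma diagonal_summable:
  assumes x: "x \<in> D" shows "summable (\<lambda>k. lam (Suc k) * (phi (Suc k) x)\<^sup>2)"
  using partial_diagonal_le_lessThan[OF x] by (intro summableI_nonneg_bounded) (auto simp: lam_pos less_imp_le)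

text \<open>Cauchy-Schwarz on blocks of the series: the factor in \<open>x\<close> is small by
  convergence of the diagonal series at this fixed \<open>x\<close>, and the factor in
  \<open>y\<close> is at most \<open>K y y\<close>, hence bounded uniformly in
  \<open>y\<close>.\<close>

lemma kernel_section_uniformly_Cauchy:
  assumes x: "x \<in> D"
  shows "uniformly_Cauchy_on D (\<lambda>N y. \<Sum>k<N. lam (Suc k) * phi (Suc k) x * phi (Suc k) y)"
proof (rule uniformly_Cauchy_onI')
  fix e :: real assume e: "e > 0"
  obtain C where C: "C > 0" "\<forall>x\<in>D. \<forall>y\<in>D. \<bar>K x y\<bar> \<le> C" using K_bound by blast
  have "e\<^sup>2 / C > 0" using e C by simp
  then obtain M where M: "\<And>m n. m \<ge> M \<Longrightarrow> norm (\<Sum>k\<in>{m..<n}. lam (Suc k) * (phi (Suc k) x)\<^sup>2) < e\<^sup>2 / C"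
    using diagonal_summable[OF x] unfolding summable_Cauchy by blast
  have "dist (\<Sum>k<m. lam (Suc k) * phi (Suc k) x * phi (Suc k) y)
             (\<Sum>k<n. lam (Suc k) * phi (Suc k) x * phi (Suc k) y) < e"
    if y: "y \<in> D" and mn: "m \<ge> M" "n > m" for y m n
  proof -
    let ?s = "\<lambda>k z. sqrt (lam (Suc k)) * phi (Suc k) z"
    have sq: "(?s k z)\<^sup>2 = lam (Suc k) * (phi (Suc k) z)\<^sup>2" for k z
      using lam_pos[of "Suc k"] by (simp add: power_mult_distrib)
    have "(\<Sum>k\<in>{m..<n}. (?s k y)\<^sup>2) \<le> (\<Sum>k<n. (?s k y)\<^sup>2)"
      by (intro sum_mono2) auto
    also have "\<dots> \<le> K y y" unfolding sq by (rule partial_diagonal_le_lessThan[OF y])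
    also have "\<dots> \<le> C" using C(2) y by fastforce
    finally have b: "(\<Sum>k\<in>{m..<n}. (?s k y)\<^sup>2) \<le> C" .
    have a: "(\<Sum>k\<in>{m..<n}. (?s k x)\<^sup>2) < e\<^sup>2 / C" using M[OF mn(1), of n] unfolding sq by simp
    have "(\<Sum>k\<in>{m..<n}. ?s k x * ?s k y)\<^sup>2 \<le> (\<Sum>k\<in>{m..<n}. (?s k x)\<^sup>2) * (\<Sum>k\<in>{m..<n}. (?s k y)\<^sup>2)"
      by (rule Cauchy_Schwarz_ineq_sum)
    also have "\<dots> \<le> (\<Sum>k\<in>{m..<n}. (?s k x)\<^sup>2) * C" by (intro mult_left_mono b sum_nonneg) auto
    also have "\<dots> < e\<^sup>2 / C * C" using a C(1) by (intro mult_strict_right_mono) auto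
    also have "\<dots> = e\<^sup>2" using C(1) by simp
    finally have "\<bar>\<Sum>k\<in>{m..<n}. ?s k x * ?s k y\<bar>\<^sup>2 < e\<^sup>2" unfolding power2_abs .
    then have "\<bar>\<Sum>k\<in>{m..<n}. ?s k x * ?s k y\<bar> < e"
      by (rule power2_less_imp_less) (rule less_imp_le[OF e])
    moreover have "?s k x * ?s k y = lam (Suc k) * phi (Suc k) x * phi (Suc k) y" for k
    proof -
      have "?s k x * ?s k y = (sqrt (lam (Suc k)))\<^sup>2 * phi (Suc k) x * phi (Suc k) y"
        by (simp only: power2_eq_square mult_ac)
      then show ?thesis using lam_pos[of "Suc k"] by simp
    qed
    moreover have "(\<Sum>k<n. lam (Suc k) * phi (Suc k) x * phi (Suc k) y) -
        (\<Sum>k<m. lam (Suc k) * phi (Suc k) x * phi (Suc k) y) =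
        (\<Sum>k\<in>{m..<n}. lam (Suc k) * phi (Suc k) x * phi (Suc k) y)"
      using mn(2) by (simp add: lessThan_atLeast0 sum_diff_nat_ivl)
    ultimately show ?thesis by (simp add: dist_real_def abs_minus_commute)
  qed
  then show "\<exists>M. \<forall>y\<in>D. \<forall>m\<ge>M. \<forall>n>m.
      dist (\<Sum>k<m. lam (Suc k) * phi (Suc k) x * phi (Suc k) y)
           (\<Sum>k<n. lam (Suc k) * phi (Suc k) x * phi (Suc k) y) < e"
    by blast
qed

text \<open>The difference \<open>h\<close> of the section \<open>K x\<close> and the uniform limit
  \<open>s\<close> of its expansion is orthogonal to every eigenfunction, so the form vanishes at
  \<open>h\<close>. This makes \<open>h\<close> orthogonal to \<open>K x\<close>; it is orthogonal
  to \<open>s\<close> as well, being orthogonal to the partial sums. Hence \<open>h\<close> is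
  orthogonal to itself.\<close>

theorem mercer:
  assumes x: "x \<in> D" and y: "y \<in> D"
  shows "(\<lambda>k. lam (Suc k) * phi (Suc k) x * phi (Suc k) y) sums K x y"
proof -
  define S where "S N z = (\<Sum>k<N. lam (Suc k) * phi (Suc k) x * phi (Suc k) z)" for N z
  have S_cont: "continuous_on D (S N)" for N
    unfolding S_def by (intro continuous_intros phi_cont) auto
  have "uniformly_convergent_on D S"
    using kernel_section_uniformly_Cauchy[OF x] unfolding uniformly_convergent_eq_Cauchy S_def .
  then obtain s where s: "uniform_limit D S s sequentially"
    by (auto simp: uniformly_convergent_on_def)
  have s_cont: "continuous_on D s"
    by (rule uniform_limit_theorem[OF _ s]) (simp_all add: S_cont)
  define h where "h = (\<lambda>z. K x z + (-1) * s z)"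
  have h: "continuous_on D h" unfolding h_def by (intro continuous_intros K_cont_snd x s_cont)
  have ip_h: "ip f h = ip f (K x) - ip f s" if "continuous_on D f" for f
    using ip_add[OF that K_cont_snd[OF x] s_cont, of "-1"] by (simp add: h_def)
  note lim = ip_uniform_limit[OF _ S_cont s_cont s]
  have S_sum: "S N = (\<lambda>z. \<Sum>k\<in>Suc ` {..<N}. (lam k * phi k x) * phi k z)" for N
    unfolding S_def by (subst sum.reindex) auto
  have "h \<in> perp"
    unfolding perp_def
  proof (intro CollectI conjI allI impI h)
    fix j :: nat assume j: "j \<ge> 1"
    have "\<forall>\<^sub>F N in sequentially. ip (phi j) (S N) = lam j * phi j x"
    proof (rule eventually_sequentiallyI[of j])
      fix N assume "N \<ge> j"
      then have "j \<in> Suc ` {..<N}" using j by (auto intro!: image_eqI[of _ _ "j - 1"])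
      then show "ip (phi j) (S N) = lam j * phi j x"
        unfolding S_sum by (subst ip_phi_sum) (use j in auto)
    qed
    then have "(\<lambda>N. ip (phi j) (S N)) \<longlonglongrightarrow> lam j * phi j x" by (rule tendsto_eventually)
    with lim[OF phi_cont[OF j]] have "ip (phi j) s = lam j * phi j x" by (rule LIMSEQ_unique)
    moreover have "ip (phi j) (K x) = lam j * phi j x"
      using T_phi[OF j x] by (simp add: kernel_op_def L2_inner_def mult.commute)
    ultimately show "ip (phi j) h = 0" unfolding ip_h[OF phi_cont[OF j]] by simp
  qed
  then have "ip h (T h) = 0" by (rule form_eq_0_on_perp)
  \<comment> \<open>Evaluating at the very point \<open>x\<close> whose section defines
    \<open>h\<close> turns this into orthogonality of \<open>h\<close> and
    \<open>K x\<close>.\<close>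
  then have "T h x = 0" by (intro T_eq_0_if_ip_eq_0 h x)
  then have 1: "ip h (K x) = 0" by (simp add: kernel_op_def L2_inner_def mult.commute)
  have "ip h (S N) = 0" for N
  proof -
    have "ip h (S N) = (\<Sum>k\<in>Suc ` {..<N}. (lam k * phi k x) * ip h (phi k))"
      unfolding S_sum by (intro ip_sum h phi_cont) auto
    also have "\<dots> = 0"
      using perpD(2)[OF \<open>h \<in> perp\<close>] by (intro sum.neutral) (auto simp: ip_commute[of h])
    finally show ?thesis .
  qed
  then have "ip h s = 0" using lim[OF h] by (simp add: LIMSEQ_const_iff)
  with 1 have "ip h h = 0" unfolding ip_h[OF h] by simp
  then have "h y = 0" using ip_self_eq_0[OF h _ y] by simp
  then have "s y = K x y" by (simp add: h_def)
  with tendsto_uniform_limitI[OF s y] show ?thesis by (simp add: sums_def S_def)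
qed

section \<open>Trace formula and the diagonal remainder\<close>

lemma phi_square_integral: "(LINT y|P. lam (Suc k) * (phi (Suc k) y)\<^sup>2) = lam (Suc k)"
  using phi_ortho[of "Suc k" "Suc k"] by (simp add: L2_inner_def power2_eq_square)

lemma phi_square_integrable: "integrable P (\<lambda>y. lam (Suc k) * (phi (Suc k) y)\<^sup>2)"
  by (intro integrable_cont continuous_intros phi_cont) simp

text \<open>The expansion on the diagonal is integrated term by term; its partial sums are dominated
  by \<open>K y y\<close>, and normalisation of the eigenfunctions leaves the eigenvalues.\<close>

lemma trace_formula: "(\<lambda>k. lam (Suc k)) sums (LINT y|P. K y y)"
proof -
  have "(\<lambda>N. LINT y|P. (\<Sum>k<N. lam (Suc k) * (phi (Suc k) y)\<^sup>2)) \<longlonglongrightarrow> (LINT y|P. K y y)"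
  proof (rule integral_dominated_convergence[where w = "\<lambda>y. K y y"])
    show "(\<lambda>y. K y y) \<in> borel_measurable P" by (intro measurable_cont K_cont_diag)
    show "(\<lambda>y. \<Sum>k<N. lam (Suc k) * (phi (Suc k) y)\<^sup>2) \<in> borel_measurable P" for N
      by (intro measurable_cont continuous_intros phi_cont) simp
    show "integrable P (\<lambda>y. K y y)" by (intro integrable_cont K_cont_diag)
    show "AE y in P. (\<lambda>N. \<Sum>k<N. lam (Suc k) * (phi (Suc k) y)\<^sup>2) \<longlonglongrightarrow> K y y"
      using mercer by (intro AE_I2) (simp add: space_P sums_def power2_eq_square mult.assoc)
    show "AE y in P. norm (\<Sum>k<N. lam (Suc k) * (phi (Suc k) y)\<^sup>2) \<le> K y y" for N
    proof (rule AE_I2)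
      fix y assume "y \<in> space P"
      moreover have "0 \<le> (\<Sum>k<N. lam (Suc k) * (phi (Suc k) y)\<^sup>2)"
        by (intro sum_nonneg mult_nonneg_nonneg less_imp_le[OF lam_pos]) auto
      ultimately show "norm (\<Sum>k<N. lam (Suc k) * (phi (Suc k) y)\<^sup>2) \<le> K y y"
        using partial_diagonal_le_lessThan[of y N] by (simp add: space_P)
    qed
  qed
  moreover have "(LINT y|P. (\<Sum>k<N. lam (Suc k) * (phi (Suc k) y)\<^sup>2)) = (\<Sum>k<N. lam (Suc k))" for N
    using phi_square_integrable by (subst Bochner_Integration.integral_sum) (simp_all only: phi_square_integral)
  ultimately show ?thesis by (simp add: sums_def)
qed

text \<open>The remainder of the diagonal series, written as a finite expression so that continuity
  is immediate.\<close>

definition tail_diag :: "nat \<Rightarrow> 'a \<Rightarrow> real" where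
  "tail_diag N y = K y y - (\<Sum>k<N. lam (Suc k) * (phi (Suc k) y)\<^sup>2)"

lemma tail_diag_cont: "continuous_on D (tail_diag N)"
  unfolding tail_diag_def by (intro continuous_intros K_cont_diag phi_cont) simp

lemma tail_diag_nonneg: "y \<in> D \<Longrightarrow> 0 \<le> tail_diag N y"
  using partial_diagonal_le_lessThan[of y N] by (simp add: tail_diag_def)

lemma lam_summable: "summable (\<lambda>k. lam (Suc k))"
  using trace_formula by (rule sums_summable)

lemma integral_tail_diag: "(LINT y|P. tail_diag N y) = (\<Sum>k. lam (Suc (k + N)))"
proof -
  have "(LINT y|P. tail_diag N y) = (LINT y|P. K y y) - (LINT y|P. (\<Sum>k<N. lam (Suc k) * (phi (Suc k) y)\<^sup>2))"
    unfolding tail_diag_def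
    by (intro Bochner_Integration.integral_diff integrable_cont K_cont_diag continuous_intros phi_cont) simp
  also have "(LINT y|P. (\<Sum>k<N. lam (Suc k) * (phi (Suc k) y)\<^sup>2)) = (\<Sum>k<N. lam (Suc k))"
    using phi_square_integrable by (subst Bochner_Integration.integral_sum) (simp_all only: phi_square_integral)
  also have "(LINT y|P. K y y) = (\<Sum>k. lam (Suc k))" by (rule sums_unique[OF trace_formula])
  finally show ?thesis using suminf_split_initial_segment[OF lam_summable, of N] by simp
qed

text \<open>Cauchy-Schwarz for the coefficient sequences, after expanding \<open>f\<close> and \<open>K\<close> in the eigenfunctions.\<close>
lemma rkhs_dominated:
  assumes f: "f \<in> rkhs D P lam phi"
  shows "\<exists>F\<ge>0. \<forall>(n::nat) z c. (\<forall>i<n. z i \<in> D) \<longrightarrow>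
    (\<Sum>i<n. c i * f (z i))\<^sup>2 \<le> F * (\<Sum>i<n. \<Sum>j<n. c i * c j * K (z i) (z j))"
proof -
  define a where "a k = ip f (phi k)" for k
  have img: "Suc ` UNIV = {1..}" by (auto simp: image_iff) (metis Suc_le_D One_nat_def)
  have "(\<lambda>k. \<bar>a k\<bar>\<^sup>2 / lam k) summable_on {1..}" using f by (simp add: rkhs_def a_def)
  then have "((\<lambda>k. \<bar>a k\<bar>\<^sup>2 / lam k) \<circ> Suc) summable_on UNIV"
    unfolding img[symmetric] by (subst (asm) summable_on_reindex) auto
  then have F: "summable (\<lambda>k. (a (Suc k))\<^sup>2 / lam (Suc k))"
    by (auto dest!: summable_on_imp_summable simp: o_def)
  \<comment> \<open>The constant is the squared norm of \<open>f\<close> in the reproducing kernel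
    Hilbert space.\<close>
  define F where "F = (\<Sum>k. (a (Suc k))\<^sup>2 / lam (Suc k))"
  have F_nonneg: "F \<ge> 0"
    unfolding F_def using F by (intro suminf_nonneg divide_nonneg_pos lam_pos) auto
  have fz: "(\<lambda>k. a (Suc k) * phi (Suc k) z) sums f z" if "z \<in> D" for z
  proof -
    have "((\<lambda>k. a k * phi k z) has_sum f z) {1..}" using f that by (simp add: rkhs_def a_def)
    then have "((\<lambda>k. a k * phi k z) \<circ> Suc has_sum f z) UNIV"
      unfolding img[symmetric] by (subst (asm) has_sum_reindex) auto
    then show ?thesis using has_sum_imp_sums by (auto simp: o_def)
  qed
  have "(\<Sum>i<n. c i * f (z i))\<^sup>2 \<le> F * (\<Sum>i<n. \<Sum>j<n. c i * c j * K (z i) (z j))" (is "?L \<le> F * ?q")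
    if z: "\<And>i. i < n \<Longrightarrow> z i \<in> D" for n :: nat and z c
  proof -
    define p where "p k = (\<Sum>i<n. c i * phi k (z i))" for k
    have "(\<lambda>k. \<Sum>i<n. c i * (a (Suc k) * phi (Suc k) (z i))) sums (\<Sum>i<n. c i * f (z i))"
      by (intro sums_sum sums_mult fz z) auto
    then have A: "(\<lambda>k. a (Suc k) * p (Suc k)) sums (\<Sum>i<n. c i * f (z i))"
      by (simp add: p_def sum_distrib_left mult_ac)
    have "(\<lambda>k. \<Sum>i<n. \<Sum>j<n. c i * c j * (lam (Suc k) * phi (Suc k) (z i) * phi (Suc k) (z j))) sums ?q"
      by (intro sums_sum sums_mult mercer z) auto
    moreover have "(\<Sum>i<n. \<Sum>j<n. c i * c j * (lam (Suc k) * phi (Suc k) (z i) * phi (Suc k) (z j))) =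
        lam (Suc k) * (p (Suc k))\<^sup>2" for k
      by (simp add: p_def power2_eq_square sum_product sum_distrib_left mult_ac)
    ultimately have B: "(\<lambda>k. lam (Suc k) * (p (Suc k))\<^sup>2) sums ?q" by simp
    have "(\<Sum>k<N. a (Suc k) * p (Suc k))\<^sup>2 \<le> F * ?q" for N
    proof -
      \<comment> \<open>Distributing the square root of the eigenvalue makes the first factor sum to
        the Hilbert space norm and the second to the quadratic form of the kernel.\<close>
      have "(\<Sum>k<N. a (Suc k) * p (Suc k)) = (\<Sum>k<N. (a (Suc k) / sqrt (lam (Suc k))) * (sqrt (lam (Suc k)) * p (Suc k)))"
        using lam_pos by (intro sum.cong refl) (simp add: less_imp_neq[symmetric])
      also have "\<dots>\<^sup>2 \<le> (\<Sum>k<N. (a (Suc k) / sqrt (lam (Suc k)))\<^sup>2) * (\<Sum>k<N. (sqrt (lam (Suc k)) * p (Suc k))\<^sup>2)"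
        by (rule Cauchy_Schwarz_ineq_sum)
      also have "\<dots> = (\<Sum>k<N. (a (Suc k))\<^sup>2 / lam (Suc k)) * (\<Sum>k<N. lam (Suc k) * (p (Suc k))\<^sup>2)"
        using lam_pos by (simp add: power_divide power_mult_distrib less_imp_le)
      also have "\<dots> \<le> F * ?q"
        unfolding F_def sums_unique[OF B] using lam_pos F_nonneg
        by (intro mult_mono sum_le_suminf F sums_summable[OF B] sum_nonneg)
          (auto simp: less_imp_le F_def[symmetric])
      finally show ?thesis .
    qed
    then show ?thesis
      using A unfolding sums_def by (intro LIMSEQ_le_const2[OF tendsto_power]) auto
  qed
  with F_nonneg show ?thesis by blast
qed

end

subsection \<open>Regularised linear systems\<close>

definition ridge_mat :: "nat \<Rightarrow> (nat \<Rightarrow> nat \<Rightarrow> real) \<Rightarrow> real \<Rightarrow> real mat" where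
  "ridge_mat n G \<mu> = mat n n (\<lambda>(i, j). G i j) + \<mu> \<cdot>\<^sub>m 1\<^sub>m n"

text \<open>Cramer's rule makes the entries of the inverse explicit rational functions of
  \<open>G\<close>, hence measurable in the design. The expression is total: division by a zero
  determinant yields 0.\<close>

definition ridge_inv :: "nat \<Rightarrow> (nat \<Rightarrow> nat \<Rightarrow> real) \<Rightarrow> real \<Rightarrow> nat \<Rightarrow> nat \<Rightarrow> real" where
  "ridge_inv n G \<mu> i j = adj_mat (ridge_mat n G \<mu>) $$ (i, j) / Determinant.det (ridge_mat n G \<mu>)"

lemma ridge_mat_carrier [simp]: "ridge_mat n G \<mu> \<in> carrier_mat n n"
  by (simp add: ridge_mat_def)

lemma ridge_mat_index: "i < n \<Longrightarrow> j < n \<Longrightarrow> ridge_mat n G \<mu> $$ (i, j) = G i j + (if i = j then \<mu> else 0)"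
  by (simp add: ridge_mat_def)

text \<open>By the Leibniz formula the determinant is a polynomial in the entries.\<close>

lemma det_borel_measurable:
  assumes "\<And>\<omega>. A \<omega> \<in> carrier_mat n n"
    and "\<And>i j. i < n \<Longrightarrow> j < n \<Longrightarrow> (\<lambda>\<omega>. A \<omega> $$ (i, j) :: real) \<in> borel_measurable M"
  shows "(\<lambda>\<omega>. Determinant.det (A \<omega>)) \<in> borel_measurable M"
proof -
  have "(\<lambda>\<omega>. \<Sum>p | p permutes {0..<n}. signof p * (\<Prod>i = 0..<n. A \<omega> $$ (i, p i))) \<in> borel_measurable M"
    by (intro borel_measurable_sum borel_measurable_times borel_measurable_prod borel_measurable_const assms(2))
      (auto dest: permutes_in_image)
  then show ?thesis using det_def'[OF assms(1)] by simp
qed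

lemma ridge_inv_borel_measurable:
  assumes G: "\<And>i j. i < n \<Longrightarrow> j < n \<Longrightarrow> (\<lambda>\<omega>. G \<omega> i j) \<in> borel_measurable M" and ij: "i < n" "j < n"
  shows "(\<lambda>\<omega>. ridge_inv n (G \<omega>) \<mu> i j) \<in> borel_measurable M"
proof -
  let ?A = "\<lambda>\<omega>. ridge_mat n (G \<omega>) \<mu>"
  have A: "(\<lambda>\<omega>. ?A \<omega> $$ (i, j)) \<in> borel_measurable M" if "i < n" "j < n" for i j
    using that G by (simp add: ridge_mat_index)
  have del: "mat_delete (?A \<omega>) j i \<in> carrier_mat (n - 1) (n - 1)" for \<omega>
    by (rule mat_delete_carrier[OF ridge_mat_carrier])
  have "(\<lambda>\<omega>. mat_delete (?A \<omega>) j i $$ (k, l)) \<in> borel_measurable M" if "k < n - 1" "l < n - 1" for k l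
    using that carrier_matD[OF ridge_mat_carrier] unfolding mat_delete_def by (auto intro!: A)
  from det_borel_measurable[OF del this]
  have "(\<lambda>\<omega>. cofactor (?A \<omega>) j i) \<in> borel_measurable M" unfolding cofactor_def by measurable
  moreover have "adj_mat (?A \<omega>) $$ (i, j) = cofactor (?A \<omega>) j i" for \<omega>
    using ij carrier_matD[OF ridge_mat_carrier] unfolding adj_mat_def by simp
  moreover have "(\<lambda>\<omega>. Determinant.det (?A \<omega>)) \<in> borel_measurable M"
    by (intro det_borel_measurable[OF ridge_mat_carrier] A)
  ultimately show ?thesis unfolding ridge_inv_def by simp
qed

locale ridge =
  fixes n :: nat and G :: "nat \<Rightarrow> nat \<Rightarrow> real" and \<mu> :: real
  assumes G_sym: "i < n \<Longrightarrow> j < n \<Longrightarrow> G i j = G j i"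
    and G_psd: "0 \<le> (\<Sum>i<n. \<Sum>j<n. c i * c j * G i j)"
    and \<mu>_pos: "\<mu> > 0"
begin

abbreviation "S \<equiv> ridge_mat n G \<mu>"
abbreviation "U \<equiv> ridge_inv n G \<mu>"
text \<open>The entries of G (G + \<mu> I)^-1, written as I - \<mu> (G + \<mu> I)^-1;
  \<open>hat_eq\<close> is the product form.\<close>

abbreviation "hat i j \<equiv> (if i = j then 1 else 0) - \<mu> * U i j"

text \<open>A kernel vector paired with its own image gives a nonnegative form plus \<mu> times its
  squared norm equal to 0, so it vanishes.\<close>

lemma det_ridge_mat: "Determinant.det S \<noteq> 0"
proof
  assume "Determinant.det S = 0"
  then obtain v where v: "v \<in> carrier_vec n" "v \<noteq> 0\<^sub>v n" "S *\<^sub>v v = 0\<^sub>v n"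
    using det_0_iff_vec_prod_zero[OF ridge_mat_carrier] by blast
  have row: "(\<Sum>j<n. G i j * (v $ j)) + \<mu> * (v $ i) = 0" if i: "i < n" for i
  proof -
    have "0 = (S *\<^sub>v v) $ i" using v(3) i by simp
    also have "\<dots> = (\<Sum>j<n. S $$ (i, j) * (v $ j))"
      using v(1) i carrier_matD[OF ridge_mat_carrier, of n G \<mu>]
      by (simp add: scalar_prod_def lessThan_atLeast0)
    also have "\<dots> = (\<Sum>j<n. G i j * (v $ j) + (if j = i then \<mu> * (v $ i) else 0))"
      using i by (intro sum.cong refl) (auto simp: ridge_mat_index algebra_simps)
    finally show ?thesis using i by (simp add: sum.distrib sum.delta)
  qed
  have "0 = (\<Sum>i<n. (v $ i) * ((\<Sum>j<n. G i j * (v $ j)) + \<mu> * (v $ i)))" using row by simp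
  also have "\<dots> = (\<Sum>i<n. \<Sum>j<n. (v $ i) * (v $ j) * G i j) + \<mu> * (\<Sum>i<n. (v $ i)\<^sup>2)"
    by (simp add: distrib_left sum.distrib sum_distrib_left power2_eq_square mult_ac)
  finally have "\<mu> * (\<Sum>i<n. (v $ i)\<^sup>2) \<le> 0" using G_psd[of "\<lambda>i. v $ i"] by linarith
  then have "(\<Sum>i<n. (v $ i)\<^sup>2) \<le> 0" using \<mu>_pos by (simp add: mult_le_0_iff)
  then have "(\<Sum>i<n. (v $ i)\<^sup>2) = 0" by (intro antisym sum_nonneg) auto
  then have "\<forall>i<n. v $ i = 0" by (simp add: sum_nonneg_eq_0_iff)
  then have "v = 0\<^sub>v n" using v(1) by (intro eq_vecI) auto
  with v(2) show False by simp
qed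

lemma ridge_inv_right:
  assumes i: "i < n" and j: "j < n"
  shows "(\<Sum>k<n. G i k * U k j) + \<mu> * U i j = (if i = j then 1 else 0)"
proof -
  let ?d = "Determinant.det S"
  have A: "adj_mat S \<in> carrier_mat n n" "S * adj_mat S = ?d \<cdot>\<^sub>m 1\<^sub>m n"
    using adj_mat[OF ridge_mat_carrier] by blast+
  have "(if i = j then ?d else 0) = (S * adj_mat S) $$ (i, j)" using A(2) i j by simp
  also have "\<dots> = (\<Sum>k<n. S $$ (i, k) * adj_mat S $$ (k, j))"
    using A(1) i j carrier_matD[OF ridge_mat_carrier, of n G \<mu>]
    by (simp add: scalar_prod_def lessThan_atLeast0)
  also have "\<dots> = (\<Sum>k<n. ?d * (S $$ (i, k) * U k j))"
    using det_ridge_mat by (simp add: ridge_inv_def)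
  also have "\<dots> = ?d * (\<Sum>k<n. S $$ (i, k) * U k j)" by (simp add: sum_distrib_left)
  finally have "(\<Sum>k<n. S $$ (i, k) * U k j) = (if i = j then 1 else 0)"
    using det_ridge_mat by (auto split: if_splits)
  also have "(\<Sum>k<n. S $$ (i, k) * U k j) = (\<Sum>k<n. G i k * U k j + (if k = i then \<mu> * U i j else 0))"
    using i by (intro sum.cong refl) (auto simp: ridge_mat_index algebra_simps)
  finally show ?thesis using i by (simp add: sum.distrib sum.delta)
qed

text \<open>Links the computed inverse in the estimator to Cramer's rule: multiplying the adjugate
  identity on the left by that inverse identifies the two.\<close>

lemma mat_inverse_ridge:
  assumes i: "i < n" and j: "j < n"
  shows "the (mat_inverse S) $$ (i, j) = U i j" and "the (mat_inverse S) \<in> carrier_mat n n"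
proof -
  let ?d = "Determinant.det S"
  have "S \<in> Units (ring_mat TYPE(real) n ())"
    using det_non_zero_imp_unit[OF ridge_mat_carrier det_ridge_mat] .
  then obtain B where B: "mat_inverse S = Some B"
    using mat_inverse(1)[OF ridge_mat_carrier, of n G \<mu> "()"] by (cases "mat_inverse S") auto
  from mat_inverse(2)[OF ridge_mat_carrier B]
  have B': "B * S = 1\<^sub>m n" "B \<in> carrier_mat n n" by auto
  have A: "adj_mat S \<in> carrier_mat n n" "S * adj_mat S = ?d \<cdot>\<^sub>m 1\<^sub>m n"
    using adj_mat[OF ridge_mat_carrier] by blast+
  have "adj_mat S = (B * S) * adj_mat S" using A B' by simp
  also have "\<dots> = B * (S * adj_mat S)" using A B' by (intro assoc_mult_mat) auto
  also have "\<dots> = ?d \<cdot>\<^sub>m B" using A B' by (simp add: mult_smult_distrib[OF B'(2) one_carrier_mat])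
  finally have "adj_mat S $$ (i, j) = ?d * B $$ (i, j)" using B' i j by simp
  then show "the (mat_inverse S) $$ (i, j) = U i j" "the (mat_inverse S) \<in> carrier_mat n n"
    using B B' det_ridge_mat by (simp_all add: ridge_inv_def)
qed

lemma solve:
  assumes i: "i < n"
  shows "(\<Sum>k<n. G i k * (\<Sum>j<n. U k j * v j)) + \<mu> * (\<Sum>j<n. U i j * v j) = v i"
proof -
  have "(\<Sum>k<n. G i k * (\<Sum>j<n. U k j * v j)) + \<mu> * (\<Sum>j<n. U i j * v j) =
        (\<Sum>j<n. ((\<Sum>k<n. G i k * U k j) + \<mu> * U i j) * v j)"
  proof -
    have "(\<Sum>k<n. G i k * (\<Sum>j<n. U k j * v j)) = (\<Sum>j<n. \<Sum>k<n. G i k * U k j * v j)"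
      unfolding sum_distrib_left mult.assoc by (rule sum.swap)
    then show ?thesis by (simp add: sum_distrib_left sum_distrib_right distrib_right sum.distrib mult.assoc)
  qed
  also have "\<dots> = (\<Sum>j<n. if j = i then v i else 0)"
    using i by (intro sum.cong refl) (simp add: ridge_inv_right)
  also have "\<dots> = v i" using i by (simp add: sum.delta)
  finally show ?thesis .
qed

text \<open>The energy identity, obtained by pairing (G + \<mu> I) u = v with \<open>u\<close>. The
  bounds on bias, hat matrix and trace all start from it.\<close>

lemma solve_inner:
  fixes v :: "nat \<Rightarrow> real"
  defines "u \<equiv> \<lambda>i. \<Sum>j<n. U i j * v j"
  shows "(\<Sum>i<n. u i * v i) = (\<Sum>i<n. \<Sum>j<n. u i * u j * G i j) + \<mu> * (\<Sum>i<n. (u i)\<^sup>2)"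
proof -
  have "(\<Sum>i<n. u i * v i) = (\<Sum>i<n. u i * ((\<Sum>k<n. G i k * u k) + \<mu> * u i))"
    using solve[of _ v] by (intro sum.cong refl) (simp add: u_def)
  then show ?thesis
    by (simp add: distrib_left sum.distrib sum_distrib_left power2_eq_square mult_ac)
qed

lemma solve_inner_ge: "\<mu> * (\<Sum>i<n. (\<Sum>j<n. U i j * v j)\<^sup>2) \<le> (\<Sum>i<n. (\<Sum>j<n. U i j * v j) * v i)"
  unfolding solve_inner using G_psd by simp

text \<open>Let q be the form of \<open>G\<close> at the solution u and N the squared norm of u. The
  energy identity and the hypothesis on \<open>F\<close> give (q + \<mu> N)^2 \<le> F q, while 4
  \<mu> N q \<le> (q + \<mu> N)^2 always holds. Dividing by q yields \<mu> N \<le> F / 4, the origin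
  of the factor 4.\<close>

lemma bias_bound:
  assumes F: "\<And>c. (\<Sum>i<n. c i * v i)\<^sup>2 \<le> F * (\<Sum>i<n. \<Sum>j<n. c i * c j * G i j)"
    and F_nonneg: "F \<ge> 0"
  shows "(\<Sum>i<n. (\<mu> * (\<Sum>j<n. U i j * v j))\<^sup>2) \<le> \<mu> * F / 4"
proof -
  define u where "u i = (\<Sum>j<n. U i j * v j)" for i
  define q where "q = (\<Sum>i<n. \<Sum>j<n. u i * u j * G i j)"
  define N where "N = (\<Sum>i<n. (u i)\<^sup>2)"
  have eq: "(\<Sum>i<n. u i * v i) = q + \<mu> * N" unfolding u_def q_def N_def by (rule solve_inner)
  have q: "q \<ge> 0" unfolding q_def by (rule G_psd)
  have N: "N \<ge> 0" unfolding N_def by (intro sum_nonneg) auto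
  have le: "(q + \<mu> * N)\<^sup>2 \<le> F * q" using F[of u] unfolding eq q_def .
  have "\<mu> * N \<le> F / 4"
  proof (cases "q = 0")
    case True
    then have "\<mu> * N = 0" using le by simp
    then show ?thesis using F_nonneg by linarith
  next
    case False
    have "4 * (\<mu> * N) * q \<le> (q + \<mu> * N)\<^sup>2 "
      using zero_le_power2[of "q - \<mu> * N"] by (simp add: power2_eq_square algebra_simps)
    with le have "4 * (\<mu> * N) * q \<le> F * q" by linarith
    then show ?thesis using False q by simp
  qed
  then have "\<mu> * (\<mu> * N) \<le> \<mu> * (F / 4)" using \<mu>_pos by (intro mult_left_mono) auto
  moreover have "(\<Sum>i<n. (\<mu> * u i)\<^sup>2) = \<mu> * (\<mu> * N)"
    by (simp add: N_def sum_distrib_left power2_eq_square mult_ac)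
  ultimately show ?thesis by (simp add: u_def)
qed

lemma hat_eq: "i < n \<Longrightarrow> j < n \<Longrightarrow> hat i j = (\<Sum>k<n. G i k * U k j)"
  using ridge_inv_right[of i j] by (simp add: algebra_simps split: if_splits)

lemma unit_sum: "j < n \<Longrightarrow> (\<Sum>k<n. g k * (if k = j then 1 else 0)) = (g j :: real)"
  by (simp add: sum.delta if_distrib cong: if_cong)

lemma diag_ge: "j < n \<Longrightarrow> \<mu> * (\<Sum>i<n. (U i j)\<^sup>2) \<le> U j j"
  using solve_inner_ge[of "\<lambda>k. if k = j then 1 else 0"] by (simp add: unit_sum)

text \<open>The hat matrix has spectrum in [0, 1], so its square has the smaller trace. In place of
  a diagonalisation, each column is expanded and \<open>diag_ge\<close> bounds the quadratic
  term.\<close>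

lemma hat_frobenius_le_trace: "(\<Sum>i<n. \<Sum>j<n. (hat i j)\<^sup>2) \<le> (\<Sum>j<n. hat j j)"
proof -
  have "(\<Sum>i<n. (hat i j)\<^sup>2) \<le> hat j j" if j: "j < n" for j
  proof -
    have "(\<Sum>i<n. (hat i j)\<^sup>2) =
        (\<Sum>i<n. (1 - 2 * \<mu> * U i j) * (if i = j then 1 else 0) + \<mu>\<^sup>2 * (U i j)\<^sup>2)"
      by (intro sum.cong refl) (auto simp: power2_eq_square algebra_simps)
    also have "\<dots> = 1 - 2 * \<mu> * U j j + \<mu> * (\<mu> * (\<Sum>i<n. (U i j)\<^sup>2))"
      unfolding sum.distrib unit_sum[OF j] sum_distrib_left[symmetric] by (simp add: power2_eq_square)
    also have "\<dots> \<le> 1 - 2 * \<mu> * U j j + \<mu> * U j j"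
      using mult_left_mono[OF diag_ge[OF j], of \<mu>] \<mu>_pos by simp
    finally show ?thesis by (simp add: algebra_simps)
  qed
  then have "(\<Sum>j<n. \<Sum>i<n. (hat i j)\<^sup>2) \<le> (\<Sum>j<n. hat j j)" by (intro sum_mono) auto
  then show ?thesis by (subst sum.swap)
qed

lemma hat_diag_le_1: "j < n \<Longrightarrow> hat j j \<le> 1"
proof -
  assume j: "j < n"
  have "0 \<le> \<mu> * (\<Sum>i<n. (U i j)\<^sup>2)" using \<mu>_pos by (intro mult_nonneg_nonneg sum_nonneg) auto
  then have "0 \<le> U j j" using diag_ge[OF j] by linarith
  then show ?thesis using \<mu>_pos by simp
qed

text \<open>A crude bound, but uniform in the design; it provides integrability of products with the
  noise.\<close>

lemma hat_bounded: assumes "i < n" "j < n" shows "\<bar>hat i j\<bar> \<le> real n"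
proof -
  have "(hat i j)\<^sup>2 \<le> (\<Sum>j<n. (hat i j)\<^sup>2)" using assms by (intro member_le_sum) auto
  also have "\<dots> \<le> (\<Sum>i<n. \<Sum>j<n. (hat i j)\<^sup>2)"
    using assms by (intro member_le_sum[of i _ "\<lambda>i. \<Sum>j<n. (hat i j)\<^sup>2"]) (auto intro!: sum_nonneg)
  also have "\<dots> \<le> (\<Sum>j<n. hat j j)" by (rule hat_frobenius_le_trace)
  also have "\<dots> \<le> (\<Sum>j<n. 1)" using hat_diag_le_1 by (intro sum_mono) auto
  also have "\<dots> \<le> (real n)\<^sup>2" using assms by (simp add: power2_eq_square)
  finally show ?thesis using abs_le_square_iff[of "hat i j" "real n"] by simp
qed

text \<open>
  The rank-one terms with index below \<open>N\<close> contribute at most 1 each, the others at most their own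
  trace divided by \<open>\<mu>\<close>.
\<close>
lemma trace_hat_le:
  fixes l :: "nat \<Rightarrow> real" and p :: "nat \<Rightarrow> nat \<Rightarrow> real"
  assumes l: "\<And>k. l k \<ge> 0"
    and G: "\<And>i j. i < n \<Longrightarrow> j < n \<Longrightarrow> (\<lambda>k. l k * p k i * p k j) sums G i j"
  shows "(\<Sum>i<n. hat i i) \<le> N + (\<Sum>i<n. G i i - (\<Sum>k<N. l k * (p k i)\<^sup>2)) / \<mu>"
proof -
  define w where "w k i = (\<Sum>j<n. U i j * p k j)" for k i
  \<comment> \<open>The quadratic form of (G + \<mu> I)^-1 at the vector \<open>p k\<close>; thus
    \<open>l k * \<alpha> k\<close> is the share of the \<open>k\<close>-th rank-one term in the
    trace.\<close>
  define \<alpha> where "\<alpha> k = (\<Sum>i<n. w k i * p k i)" for k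
  have form: "(\<lambda>k. l k * (\<Sum>i<n. c i * p k i)\<^sup>2) sums (\<Sum>i<n. \<Sum>j<n. c i * c j * G i j)" for c
  proof -
    have "(\<lambda>k. \<Sum>i<n. \<Sum>j<n. c i * c j * (l k * p k i * p k j)) sums (\<Sum>i<n. \<Sum>j<n. c i * c j * G i j)"
      by (intro sums_sum sums_mult G) auto
    moreover have "(\<Sum>i<n. \<Sum>j<n. c i * c j * (l k * p k i * p k j)) = l k * (\<Sum>i<n. c i * p k i)\<^sup>2" for k
      by (simp add: power2_eq_square sum_product sum_distrib_left mult_ac)
    ultimately show ?thesis by simp
  qed
  have \<alpha>_eq: "\<alpha> k = (\<Sum>i<n. \<Sum>j<n. w k i * w k j * G i j) + \<mu> * (\<Sum>i<n. (w k i)\<^sup>2)" for k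
    unfolding \<alpha>_def w_def by (rule solve_inner)
  have \<alpha>_ge: "\<mu> * (\<Sum>i<n. (w k i)\<^sup>2) \<le> \<alpha> k" for k unfolding \<alpha>_eq using G_psd by simp
  have \<mu>w: "0 \<le> \<mu> * (\<Sum>i<n. (w k i)\<^sup>2)" for k using \<mu>_pos by (intro mult_nonneg_nonneg sum_nonneg) auto
  have \<alpha>_nonneg: "0 \<le> \<alpha> k" for k using \<alpha>_ge \<mu>w by (rule order_trans[rotated])
  \<comment> \<open>One term of a nonnegative series is at most its sum: \<open>l k\<close> times
    the square of \<open>\<alpha> k\<close> is at most the form of \<open>G\<close> at
    \<open>w k\<close>, which the energy identity bounds by \<open>\<alpha> k\<close>.\<close>
  have le_1: "l k * \<alpha> k \<le> 1" for k
  proof (cases "\<alpha> k = 0")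
    case False
    have "l k * (\<alpha> k)\<^sup>2 \<le> (\<Sum>i<n. \<Sum>j<n. w k i * w k j * G i j)"
      using sum_le_suminf[OF sums_summable[OF form[of "w k"]], of "{k}"] sums_unique[OF form[of "w k"]] l
      by (simp add: \<alpha>_def)
    also have "\<dots> \<le> \<alpha> k" unfolding \<alpha>_eq using \<mu>w by simp
    finally have "\<alpha> k * (l k * \<alpha> k) \<le> \<alpha> k * 1" by (simp add: power2_eq_square mult_ac)
    then show ?thesis using False \<alpha>_nonneg[of k] by (simp add: mult_le_cancel_left)
  qed simp
  \<comment> \<open>The inverse is at most I / \<mu>; this follows from the squared norm of
    \<open>p k\<close> minus \<mu> \<open>w k\<close> being nonnegative.\<close>
  have le_norm: "l k * \<alpha> k \<le> l k * (\<Sum>i<n. (p k i)\<^sup>2) / \<mu>" for k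
  proof -
    have "0 \<le> (\<Sum>i<n. (p k i - \<mu> * w k i)\<^sup>2)" by (intro sum_nonneg) auto
    also have "\<dots> = (\<Sum>i<n. (p k i)\<^sup>2) - 2 * \<mu> * \<alpha> k + \<mu> * (\<mu> * (\<Sum>i<n. (w k i)\<^sup>2))"
      unfolding \<alpha>_def power2_diff sum.distrib sum_subtractf sum_distrib_left
      by (simp add: power2_eq_square mult_ac)
    also have "\<dots> \<le> (\<Sum>i<n. (p k i)\<^sup>2) - 2 * \<mu> * \<alpha> k + \<mu> * \<alpha> k"
      using mult_left_mono[OF \<alpha>_ge, of \<mu> k] \<mu>_pos by simp
    finally have "\<alpha> k \<le> (\<Sum>i<n. (p k i)\<^sup>2) / \<mu>" using \<mu>_pos by (simp add: field_simps)
    from mult_left_mono[OF this l] show ?thesis by simp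
  qed
  have "(\<lambda>k. \<Sum>i<n. \<Sum>j<n. U j i * (l k * p k i * p k j)) sums (\<Sum>i<n. \<Sum>j<n. U j i * G i j)"
    by (intro sums_sum sums_mult G) auto
  moreover have "(\<Sum>i<n. \<Sum>j<n. U j i * (l k * p k i * p k j)) = l k * \<alpha> k" for k
    unfolding \<alpha>_def w_def sum_distrib_left sum_distrib_right by (subst sum.swap) (simp add: mult_ac)
  moreover have "(\<Sum>i<n. \<Sum>j<n. U j i * G i j) = (\<Sum>i<n. hat i i)"
  proof (rule sum.cong[OF refl])
    fix i assume "i \<in> {..<n}"
    then show "(\<Sum>j<n. U j i * G i j) = hat i i" using hat_eq[of i i] by (simp add: mult.commute)
  qed
  ultimately have tr: "(\<lambda>k. l k * \<alpha> k) sums (\<Sum>i<n. hat i i)" by simp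
  have diag: "(\<lambda>k. l k * (\<Sum>i<n. (p k i)\<^sup>2) / \<mu>) sums ((\<Sum>i<n. G i i) / \<mu>)"
  proof (rule sums_divide)
    have "(\<lambda>k. \<Sum>i<n. l k * p k i * p k i) sums (\<Sum>i<n. G i i)" by (intro sums_sum G) auto
    then show "(\<lambda>k. l k * (\<Sum>i<n. (p k i)\<^sup>2)) sums (\<Sum>i<n. G i i)"
      by (simp add: sum_distrib_left power2_eq_square mult_ac)
  qed
  have "(\<Sum>i<n. hat i i) - (\<Sum>k<N. l k * \<alpha> k) \<le> (\<Sum>i<n. G i i) / \<mu> - (\<Sum>k<N. l k * (\<Sum>i<n. (p k i)\<^sup>2) / \<mu>)"
    by (rule sums_le[OF _ sums_split_initial_segment[OF tr] sums_split_initial_segment[OF diag]]) (rule le_norm)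
  moreover have "(\<Sum>k<N. l k * \<alpha> k) \<le> (\<Sum>k<N. 1)" by (intro sum_mono le_1)
  moreover have "(\<Sum>k<N. l k * (\<Sum>i<n. (p k i)\<^sup>2) / \<mu>) = (\<Sum>i<n. \<Sum>k<N. l k * (p k i)\<^sup>2) / \<mu>"
    unfolding sum_divide_distrib sum_distrib_left by (rule sum.swap)
  ultimately show ?thesis by (simp add: sum_subtractf diff_divide_distrib)
qed

end

subsection \<open>Risk of kernel ridge regression\<close>

lemma suminf_exp_tail_le:
  fixes l :: "nat \<Rightarrow> real"
  assumes l: "\<And>k. k \<ge> m \<Longrightarrow> l k \<le> C * exp (- b * real k)" and sm: "summable (\<lambda>k. l (Suc (k + N)))"
    and N: "N \<ge> m" and b: "b > 0" and C: "C > 0"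
  shows "(\<Sum>k. l (Suc (k + N))) \<le> C / (1 - exp (- b)) * exp (- b * real N)"
proof -
  have e: "norm (exp (- b)) < 1" using b by simp
  have "l (Suc (k + N)) \<le> C * exp (- b * real N) * exp (- b) ^ k" for k
  proof -
    have "l (Suc (k + N)) \<le> C * exp (- b * real (Suc (k + N)))" using N by (intro l) simp
    \<comment> \<open>The shift by \<open>Suc\<close> provides one more factor
      \<open>exp (- b)\<close>, which is dropped.\<close>
    also have "\<dots> \<le> C * exp (- b * real N + real k * (- b))"
      using C b by (intro mult_left_mono) (auto simp: algebra_simps)
    also have "\<dots> = C * exp (- b * real N) * exp (- b) ^ k"
      by (simp only: exp_add exp_of_nat_mult mult.assoc)
    finally show ?thesis .
  qed
  then have "(\<Sum>k. l (Suc (k + N))) \<le> (\<Sum>k. C * exp (- b * real N) * exp (- b) ^ k)"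
    by (intro suminf_le sm summable_mult summable_geometric e)
  also have "\<dots> = C * exp (- b * real N) * (1 / (1 - exp (- b)))"
    by (simp only: suminf_mult[OF summable_geometric[OF e]] suminf_geometric[OF e])
  finally show ?thesis by simp
qed

text \<open>The mean value theorem for x^(1 - p) replaces the comparison of the tail with an
  integral.\<close>

lemma powr_le_telescope:
  fixes p x :: real
  assumes p: "p > 1" and x: "x > 0"
  shows "(p - 1) * (x + 1) powr - p \<le> x powr (1 - p) - (x + 1) powr (1 - p)"
proof -
  have "\<exists>z>x. z < x + 1 \<and> (x + 1) powr (1 - p) - x powr (1 - p) = (x + 1 - x) * ((1 - p) * z powr (1 - p - 1))"
    using x by (intro MVT2 has_real_derivative_powr) auto
  then obtain z where z: "x < z" "z < x + 1"
    "(x + 1) powr (1 - p) - x powr (1 - p) = (1 - p) * z powr - p" by auto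
  have "(p - 1) * (x + 1) powr - p \<le> (p - 1) * z powr - p"
    using p x z by (intro mult_left_mono powr_mono2') auto
  then show ?thesis using z(3) by (simp add: algebra_simps)
qed

lemma suminf_powr_tail_le:
  fixes l :: "nat \<Rightarrow> real"
  assumes l: "\<And>k. k \<ge> m \<Longrightarrow> l k \<le> C * real k powr - p" and sm: "summable (\<lambda>k. l (Suc (k + N)))"
    and N: "N \<ge> m" "N \<ge> 1" and p: "p > 1" and C: "C > 0"
  shows "(\<Sum>k. l (Suc (k + N))) \<le> C / (p - 1) * real N powr (1 - p)"
proof (rule suminf_le_const[OF sm])
  fix n
  have "(\<Sum>k<n. l (Suc (k + N))) \<le> (\<Sum>k<n. C / (p - 1) * (real (k + N) powr (1 - p) - real (Suc k + N) powr (1 - p)))"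
  proof (rule sum_mono)
    fix k
    have "l (Suc (k + N)) \<le> C * real (Suc (k + N)) powr - p" using N by (intro l) simp
    also have "\<dots> = C / (p - 1) * ((p - 1) * (real (k + N) + 1) powr - p)" using p by (simp add: add_ac)
    also have "\<dots> \<le> C / (p - 1) * (real (k + N) powr (1 - p) - (real (k + N) + 1) powr (1 - p))"
      using C p N by (intro mult_left_mono powr_le_telescope) auto
    finally show "l (Suc (k + N)) \<le> C / (p - 1) * (real (k + N) powr (1 - p) - real (Suc k + N) powr (1 - p))"
      by (simp add: add_ac)
  qed
  also have "\<dots> = C / (p - 1) * (real N powr (1 - p) - real (n + N) powr (1 - p))"
    unfolding sum_distrib_left[symmetric] by (subst sum_lessThan_telescope'[of "\<lambda>k. real (k + N) powr (1 - p)"]) simp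
  also have "\<dots> \<le> C / (p - 1) * real N powr (1 - p)"
    using C p by (intro mult_left_mono) auto
  finally show "(\<Sum>k<n. l (Suc (k + N))) \<le> C / (p - 1) * real N powr (1 - p)" .
qed

lemma krr_estimator_eq:
  fixes K :: "'a \<Rightarrow> 'a \<Rightarrow> real" and x :: "nat \<Rightarrow> 'a"
    and G :: "nat \<Rightarrow> nat \<Rightarrow> real"
  assumes ridge: "ridge n G (real n * reg)" and G: "G = (\<lambda>i j. K (x (Suc i)) (x (Suc j)))"
  shows "krr_estimator K n reg x y z =
    (\<Sum>k<n. (\<Sum>j<n. ridge_inv n G (real n * reg) k j * y (Suc j)) * K (x (Suc k)) z)"
proof -
  interpret ridge n G "real n * reg" by (rule ridge)
  have "krr_coeffs K n reg x y $ k = (\<Sum>j<n. U k j * y (Suc j))" if k: "k < n" for k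
  proof -
    let ?V = "the (mat_inverse S)"
    have V: "?V \<in> carrier_mat n n" by (rule mat_inverse_ridge(2)[OF k k])
    have "krr_coeffs K n reg x y = ?V *\<^sub>v Matrix.vec n (\<lambda>i. y (Suc i))"
      by (simp add: krr_coeffs_def ridge_mat_def G)
    also have "\<dots> $ k = (\<Sum>j<n. ?V $$ (k, j) * y (Suc j))"
      using V k by (simp add: scalar_prod_def lessThan_atLeast0)
    also have "\<dots> = (\<Sum>j<n. U k j * y (Suc j))"
      using k by (intro sum.cong refl) (simp add: mat_inverse_ridge)
    finally show ?thesis .
  qed
  then show ?thesis unfolding krr_estimator_def by (intro sum.cong refl) simp
qed

context mercer_eigensystem begin

abbreviation gram :: "(nat \<Rightarrow> 'a) \<Rightarrow> nat \<Rightarrow> nat \<Rightarrow> real" where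
  "gram x i j \<equiv> K (x (Suc i)) (x (Suc j))"

lemma ridge_gram:
  assumes "\<And>i. i < n \<Longrightarrow> x (Suc i) \<in> D" and "\<mu> > 0"
  shows "ridge n (gram x) \<mu>"
  using assms K_psd[of n "\<lambda>i. x (Suc i)"] K_sym by unfold_locales auto

text \<open>If (G + \<mu> I) u = y, then the fitted values G u are y - \<mu> u. Linearity in y
  separates the hat matrix acting on the noise from the bias -\<mu> (G + \<mu> I)^-1 f.\<close>

lemma krr_residual:
  assumes x: "\<And>i. i < n \<Longrightarrow> x (Suc i) \<in> D" and pos: "real n * reg > 0" and i: "i < n"
  defines "\<mu> \<equiv> real n * reg"
  defines "U \<equiv> ridge_inv n (gram x) \<mu>"
  shows "krr_estimator K n reg x (\<lambda>j. f (x j) + e j) (x (Suc i)) - f (x (Suc i)) =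
    (\<Sum>j<n. ((if i = j then 1 else 0) - \<mu> * U i j) * e (Suc j)) - \<mu> * (\<Sum>j<n. U i j * f (x (Suc j)))"
proof -
  interpret R: ridge n "gram x" \<mu> unfolding \<mu>_def by (rule ridge_gram[of n x, OF x pos])
  let ?y = "\<lambda>j. f (x (Suc j)) + e (Suc j)"
  have "krr_estimator K n reg x (\<lambda>j. f (x j) + e j) (x (Suc i)) =
      (\<Sum>k<n. (\<Sum>j<n. U k j * ?y j) * K (x (Suc k)) (x (Suc i)))"
    unfolding U_def \<mu>_def by (rule krr_estimator_eq[OF R.ridge_axioms[unfolded \<mu>_def]]) simp
  also have "\<dots> = (\<Sum>k<n. gram x i k * (\<Sum>j<n. U k j * ?y j))"
    using R.G_sym i by (intro sum.cong refl) simp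
  also have "\<dots> = ?y i - \<mu> * (\<Sum>j<n. U i j * ?y j)"
    using R.solve[OF i, of ?y] unfolding U_def by linarith
  also have "(\<Sum>j<n. U i j * ?y j) = (\<Sum>j<n. U i j * f (x (Suc j))) + (\<Sum>j<n. U i j * e (Suc j))"
    by (simp add: distrib_left sum.distrib)
  also have "?y i - \<mu> * ((\<Sum>j<n. U i j * f (x (Suc j))) + (\<Sum>j<n. U i j * e (Suc j))) - f (x (Suc i)) =
     (e (Suc i) - \<mu> * (\<Sum>j<n. U i j * e (Suc j))) - \<mu> * (\<Sum>j<n. U i j * f (x (Suc j)))"
    by (simp add: algebra_simps)
  also have "e (Suc i) - \<mu> * (\<Sum>j<n. U i j * e (Suc j)) =
      (\<Sum>j<n. ((if i = j then 1 else 0) - \<mu> * U i j) * e (Suc j))"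
  proof -
    have "(\<Sum>j<n. ((if i = j then 1 else 0) - \<mu> * U i j) * e (Suc j)) =
        (\<Sum>j<n. (if j = i then e (Suc i) else 0) - \<mu> * (U i j * e (Suc j)))"
      by (intro sum.cong refl) (auto simp: algebra_simps)
    then show ?thesis using i by (simp add: sum_subtractf sum.delta sum_distrib_left)
  qed
  finally show ?thesis by simp
qed

end

section \<open>The regression model with random design\<close>

locale krr_model = mercer_eigensystem D P K lam phi + M: prob_space M
  for D :: "'a::euclidean_space set" and P K lam phi and M :: "'w measure" +
  fixes \<rho> :: "'a measure" and f :: "'a \<Rightarrow> real" and X :: "nat \<Rightarrow> 'w \<Rightarrow> 'a" and eps :: "nat \<Rightarrow> 'w \<Rightarrow> real"
    and \<sigma> :: real
  assumes prob_on_\<rho>: "prob_on D \<rho>"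
    and f_rkhs: "f \<in> rkhs D P lam phi"
    and design: "iid_design M \<rho> X"
    and noise: "iid_noise M \<sigma> eps"
    and indep: "design_indep_noise M \<rho> X eps"
    and ac: "absolutely_continuous P \<rho>"
    and RN_bounded: "\<exists>B. AE x in P. RN_deriv P \<rho> x \<le> ennreal B"
begin

lemma sets_\<rho>: "sets \<rho> = sets P"
  using prob_on_\<rho> by (simp add: prob_on_def sets_P)

lemma space_\<rho>: "space \<rho> = D"
  using sets_eq_imp_space_eq[OF sets_\<rho>] space_P by simp

lemma measurable_\<rho>: "continuous_on D g \<Longrightarrow> g \<in> borel_measurable \<rho>"
  using measurable_cont measurable_cong_sets[OF sets_\<rho> refl] by blast

text \<open>The almost sure bound on the density serves all nonnegative continuous \<open>g\<close>
  at once. It carries the trace tail, computed under \<open>P\<close>, over to the sampling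
  law.\<close>

lemma integral_\<rho>_le:
  "\<exists>B\<ge>0. \<forall>g :: 'a \<Rightarrow> real. continuous_on D g \<longrightarrow> (\<forall>x\<in>D. 0 \<le> g x) \<longrightarrow> (LINT x|\<rho>. g x) \<le> B * (LINT x|P. g x)"
proof -
  obtain B0 where B0: "AE x in P. RN_deriv P \<rho> x \<le> ennreal B0" using RN_bounded by blast
  \<comment> \<open>The given real bound may be negative, where \<open>ennreal\<close> truncates it
    to 0.\<close>
  define B where "B = max B0 0"
  have B: "B \<ge> 0" "AE x in P. RN_deriv P \<rho> x \<le> ennreal B"
    using B0 by (auto simp: B_def elim!: eventually_mono intro: order_trans ennreal_leI)
  have main: "(LINT x|\<rho>. g x) \<le> B * (LINT x|P. g x)"
    if g: "continuous_on D g" "\<forall>x\<in>D. 0 \<le> g x" for g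
  proof -
    have gm: "(\<lambda>x. ennreal (g x)) \<in> borel_measurable P" using measurable_cont[OF g(1)] by measurable
    have nonneg: "AE x in \<rho>. 0 \<le> g x" "AE x in P. 0 \<le> g x"
      using g(2) by (auto intro!: AE_I2 simp: space_P space_\<rho>)
    have "(\<integral>\<^sup>+x. g x \<partial>\<rho>) = (\<integral>\<^sup>+x. RN_deriv P \<rho> x * g x \<partial>P)"
      by (rule RN_deriv_nn_integral[OF ac sets_\<rho> gm])
    also have "\<dots> \<le> (\<integral>\<^sup>+x. ennreal B * g x \<partial>P)"
      using B(2) by (intro nn_integral_mono_AE) (auto elim!: eventually_mono intro: mult_right_mono)
    also have "\<dots> = ennreal B * (\<integral>\<^sup>+x. g x \<partial>P)" by (rule nn_integral_cmult[OF gm])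
    also have "(\<integral>\<^sup>+x. g x \<partial>P) = ennreal (LINT x|P. g x)"
      by (rule nn_integral_eq_integral[OF integrable_cont[OF g(1)] nonneg(2)])
    finally have "(\<integral>\<^sup>+x. g x \<partial>\<rho>) \<le> ennreal (B * (LINT x|P. g x))" using B(1) by (simp add: ennreal_mult')
    moreover have "(LINT x|P. g x) \<ge> 0" by (rule integral_nonneg_AE[OF nonneg(2)])
    ultimately show ?thesis
      unfolding integral_eq_nn_integral[OF measurable_\<rho>[OF g(1)] nonneg(1)]
      using B(1) by (intro enn2real_leI) auto
  qed
  show ?thesis by (intro exI[of _ B] conjI B(1) allI impI) (rule main)
qed

lemma X_measurable: "i \<ge> 1 \<Longrightarrow> X i \<in> measurable M \<rho>"
  and X_distr: "i \<ge> 1 \<Longrightarrow> distr M \<rho> (X i) = \<rho>"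
  using design by (auto simp: iid_design_def M.indep_vars_def)

lemma X_in_D: "i \<ge> 1 \<Longrightarrow> \<omega> \<in> space M \<Longrightarrow> X i \<omega> \<in> D"
  using measurable_space[OF X_measurable] by (simp add: space_\<rho>)

lemma eps_measurable: "i \<ge> 1 \<Longrightarrow> eps i \<in> borel_measurable M"
  and eps_sq_integrable: "i \<ge> 1 \<Longrightarrow> integrable M (\<lambda>\<omega>. (eps i \<omega>)\<^sup>2)"
  and eps_mean: "i \<ge> 1 \<Longrightarrow> (LINT \<omega>|M. eps i \<omega>) = 0"
  using noise by (auto simp: iid_noise_def square_integrable_def)

lemma eps_integrable: "i \<ge> 1 \<Longrightarrow> integrable M (eps i)"
  by (rule M.square_integrable_imp_integrable[OF eps_measurable eps_sq_integrable])

lemma eps_variance: "i \<ge> 1 \<Longrightarrow> (LINT \<omega>|M. (eps i \<omega>)\<^sup>2) = \<sigma>\<^sup>2"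
  using noise eps_mean by (simp add: iid_noise_def)

lemma eps_product:
  assumes "i \<ge> 1" "j \<ge> 1"
  shows "integrable M (\<lambda>\<omega>. eps i \<omega> * eps j \<omega>)"
    and "(LINT \<omega>|M. eps i \<omega> * eps j \<omega>) = (if i = j then \<sigma>\<^sup>2 else 0)"
proof -
  have "integrable M (\<lambda>\<omega>. eps i \<omega> * eps j \<omega>) \<and> (LINT \<omega>|M. eps i \<omega> * eps j \<omega>) = (if i = j then \<sigma>\<^sup>2 else 0)"
  proof (cases "i = j")
    case True
    then show ?thesis
      using eps_sq_integrable[OF assms(1)] eps_variance[OF assms(1)] by (simp add: power2_eq_square)
  next
    case False
    have iv: "M.indep_vars (\<lambda>_. borel) eps {i, j}"
    proof (rule M.indep_vars_subset)
      show "M.indep_vars (\<lambda>_. borel) eps {1..}" using noise unfolding iid_noise_def by (elim conjE)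
    qed (use assms in simp)
    have int: "\<And>k. k \<in> {i, j} \<Longrightarrow> integrable M (eps k)" using assms eps_integrable by auto
    show ?thesis
      using M.indep_vars_integrable[OF _ iv int] M.indep_vars_lebesgue_integral[OF _ iv int] False assms eps_mean
      by simp
  qed
  then show "integrable M (\<lambda>\<omega>. eps i \<omega> * eps j \<omega>)"
    "(LINT \<omega>|M. eps i \<omega> * eps j \<omega>) = (if i = j then \<sigma>\<^sup>2 else 0)" by blast+
qed

abbreviation "design_space \<equiv> PiM {1::nat..} (\<lambda>_. \<rho>)"
abbreviation "XX \<equiv> \<lambda>\<omega>. \<lambda>i\<in>{1..}. X i \<omega>"
abbreviation "EE \<equiv> \<lambda>\<omega>. \<lambda>i\<in>{1..}. eps i \<omega>"

lemma XX_measurable: "XX \<in> measurable M design_space"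
  by (intro measurable_restrict X_measurable) simp

lemma EE_measurable: "EE \<in> measurable M (PiM {1..} (\<lambda>_. borel))"
  by (intro measurable_restrict eps_measurable) simp

text \<open>Functions of the design and of the noise generate sub-sigma-algebras of two independent
  ones, so expectations factorise; boundedness of \<open>g\<close> supplies integrability.\<close>

lemma expectation_design_noise:
  fixes g :: "(nat \<Rightarrow> 'a) \<Rightarrow> real" and e :: "(nat \<Rightarrow> real) \<Rightarrow> real"
  assumes g: "g \<in> borel_measurable design_space" and bd: "\<And>x. x \<in> space design_space \<Longrightarrow> \<bar>g x\<bar> \<le> C"
    and e: "e \<in> borel_measurable (PiM {1..} (\<lambda>_. borel))" and int: "integrable M (\<lambda>\<omega>. e (EE \<omega>))"
  shows "integrable M (\<lambda>\<omega>. g (XX \<omega>) * e (EE \<omega>))"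
    and "(LINT \<omega>|M. g (XX \<omega>) * e (EE \<omega>)) = (LINT \<omega>|M. g (XX \<omega>)) * (LINT \<omega>|M. e (EE \<omega>))"
proof -
  have iv: "M.indep_var borel (\<lambda>\<omega>. g (XX \<omega>)) borel (\<lambda>\<omega>. e (EE \<omega>))"
    unfolding M.indep_var_eq
  proof (intro conjI measurable_compose[OF XX_measurable g] measurable_compose[OF EE_measurable e])
    have 1: "sigma_sets (space M) {(\<lambda>\<omega>. g (XX \<omega>)) -` A \<inter> space M |A. A \<in> sets borel}
        \<subseteq> sets (vimage_algebra (space M) XX design_space)"
      by (rule sigma_sets_vimage_compose[OF measurable_space[OF XX_measurable] g])
    have 2: "sigma_sets (space M) {(\<lambda>\<omega>. e (EE \<omega>)) -` A \<inter> space M |A. A \<in> sets borel}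
        \<subseteq> sets (vimage_algebra (space M) EE (PiM {1..} (\<lambda>_. borel)))"
      by (rule sigma_sets_vimage_compose[OF measurable_space[OF EE_measurable] e])
    have "M.indep_sets (case_bool (sets (vimage_algebra (space M) XX design_space))
        (sets (vimage_algebra (space M) EE (PiM {1..} (\<lambda>_. borel))))) UNIV"
      using indep unfolding design_indep_noise_def M.indep_set_def .
    then show "M.indep_set (sigma_sets (space M) {(\<lambda>\<omega>. g (XX \<omega>)) -` A \<inter> space M |A. A \<in> sets borel})
        (sigma_sets (space M) {(\<lambda>\<omega>. e (EE \<omega>)) -` A \<inter> space M |A. A \<in> sets borel})"
      unfolding M.indep_set_def
      by (rule M.indep_sets_mono_sets) (use 1 2 in \<open>simp split: bool.split\<close>)
  qed
  have gi: "integrable M (\<lambda>\<omega>. g (XX \<omega>))"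
    using measurable_compose[OF XX_measurable g] bd measurable_space[OF XX_measurable]
    by (intro M.integrable_const_bound[of _ C] AE_I2) auto
  show "integrable M (\<lambda>\<omega>. g (XX \<omega>) * e (EE \<omega>))"
    "(LINT \<omega>|M. g (XX \<omega>) * e (EE \<omega>)) = (LINT \<omega>|M. g (XX \<omega>)) * (LINT \<omega>|M. e (EE \<omega>))"
    using M.indep_var_integrable[OF iv gi int] M.indep_var_lebesgue_integral[OF iv gi int] .
qed

lemma component_measurable: "(\<lambda>x. x (Suc i)) \<in> measurable design_space \<rho>"
  by (intro measurable_component_singleton) simp

lemma gram_measurable: "(\<lambda>x. gram x i j) \<in> borel_measurable design_space"
proof -
  have "(\<lambda>x. (x (Suc i), x (Suc j))) \<in> measurable design_space (\<rho> \<Otimes>\<^sub>M \<rho>)"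
    by (intro measurable_Pair component_measurable)
  moreover have "(\<lambda>z. K (fst z) (snd z)) \<in> borel_measurable (\<rho> \<Otimes>\<^sub>M \<rho>)"
    using K_measurable_pair measurable_cong_sets[OF sets_pair_measure_cong[OF sets_\<rho> sets_\<rho>] refl] by blast
  ultimately have "(\<lambda>x. K (fst (x (Suc i), x (Suc j))) (snd (x (Suc i), x (Suc j)))) \<in> borel_measurable design_space"
    by (rule measurable_compose)
  then show ?thesis by simp
qed

lemma f_measurable: "f \<in> borel_measurable \<rho>"
  using f_rkhs measurable_cong_sets[OF sets_\<rho> refl] by (auto simp: rkhs_def square_integrable_def)

lemma design_space_D: "x \<in> space design_space \<Longrightarrow> x (Suc i) \<in> D"
  by (auto simp: space_PiM space_\<rho>)

text \<open>The cross term between bias and noise has mean zero because the noise is centred and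
  independent of the design; distinct noise variables are uncorrelated, which leaves the squared
  Frobenius norm of the hat matrix. \<open>F\<close> and \<open>B\<close> are parameters so that
  they can be fixed before \<open>n\<close>, \<open>reg\<close> and \<open>N\<close> vary.\<close>

theorem krr_risk_le:
  assumes n: "n \<ge> 1" and reg: "reg > 0"
    and F_nonneg: "F \<ge> 0"
    and F: "\<And>(n::nat) z c. (\<And>i. i < n \<Longrightarrow> z i \<in> D) \<Longrightarrow>
      (\<Sum>i<n. c i * f (z i))\<^sup>2 \<le> F * (\<Sum>i<n. \<Sum>j<n. c i * c j * K (z i) (z j))"
    and B_nonneg: "B \<ge> 0"
    and B: "\<And>g. continuous_on D g \<Longrightarrow> (\<And>x. x \<in> D \<Longrightarrow> 0 \<le> g x) \<Longrightarrow> (LINT x|\<rho>. g x) \<le> B * (LINT x|P. g x)"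
  shows "krr_risk M K f X eps n reg \<le>
    reg * F + \<sigma>\<^sup>2 / real n * (real N + B * (\<Sum>k. lam (Suc (k + N))) / reg)"
proof -
  define \<mu> where "\<mu> = real n * reg"
  have \<mu>: "\<mu> > 0" using n reg by (simp add: \<mu>_def)
  define U where "U x = ridge_inv n (gram x) \<mu>" for x
  define H where "H i j x = (if i = j then 1 else 0) - \<mu> * U x i j" for i j :: nat and x
  define b where "b i x = \<mu> * (\<Sum>j<n. U x i j * f (x (Suc j)))" for i :: nat and x
  have ridge: "ridge n (gram x) \<mu>" if "x \<in> space design_space" for x
    using design_space_D[OF that] \<mu> by (intro ridge_gram) auto
  have U_meas: "(\<lambda>x. U x i j) \<in> borel_measurable design_space" if "i < n" "j < n" for i j
    unfolding U_def using that by (intro ridge_inv_borel_measurable gram_measurable)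
  have H_meas: "H i j \<in> borel_measurable design_space" if "i < n" "j < n" for i j
    unfolding H_def using U_meas[OF that] by measurable
  have b_meas: "b i \<in> borel_measurable design_space" if "i < n" for i
    unfolding b_def using that
    by (intro borel_measurable_times borel_measurable_sum borel_measurable_const U_meas
        measurable_compose[OF component_measurable f_measurable]) auto
  have H_bd: "\<bar>H i j x\<bar> \<le> real n" if "x \<in> space design_space" "i < n" "j < n" for i j x
    unfolding H_def U_def using ridge.hat_bounded[OF ridge] that by blast
  have b_sum: "(\<Sum>i<n. (b i x)\<^sup>2) \<le> \<mu> * F / 4" if x: "x \<in> space design_space" for x
    unfolding b_def U_def using design_space_D[OF x]
    by (intro ridge.bias_bound[OF ridge[OF x]] F F_nonneg)
  define C where "C = sqrt (\<mu> * F / 4)"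
  have b_bd: "\<bar>b i x\<bar> \<le> C" if x: "x \<in> space design_space" and i: "i < n" for i x
  proof -
    have "(b i x)\<^sup>2 \<le> (\<Sum>i<n. (b i x)\<^sup>2)" using i by (intro member_le_sum) auto
    with b_sum[OF x] have "(b i x)\<^sup>2 \<le> \<mu> * F / 4" by linarith
    then show ?thesis unfolding C_def by (metis real_sqrt_abs real_sqrt_le_iff)
  qed
  have XX: "XX \<omega> \<in> space design_space" if "\<omega> \<in> space M" for \<omega>
    using measurable_space[OF XX_measurable that] .
  have EE_Suc: "(\<lambda>e. e (Suc j)) \<in> borel_measurable (PiM {1..} (\<lambda>_. borel :: real measure))" for j
    by (intro measurable_component_singleton) simp
  have C_nonneg: "C \<ge> 0" using \<mu> F_nonneg by (simp add: C_def)

  have bH: "integrable M (\<lambda>\<omega>. b i (XX \<omega>) * H i j (XX \<omega>) * eps (Suc j) \<omega>)"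
      "(LINT \<omega>|M. b i (XX \<omega>) * H i j (XX \<omega>) * eps (Suc j) \<omega>) = 0" if ij: "i < n" "j < n" for i j
  proof -
    have "\<bar>b i x * H i j x\<bar> \<le> C * real n" if "x \<in> space design_space" for x
      unfolding abs_mult using b_bd[OF that ij(1)] H_bd[OF that ij] C_nonneg by (intro mult_mono) auto
    note * = expectation_design_noise[OF borel_measurable_times[OF b_meas H_meas] this EE_Suc[of j]]
    show "integrable M (\<lambda>\<omega>. b i (XX \<omega>) * H i j (XX \<omega>) * eps (Suc j) \<omega>)"
      "(LINT \<omega>|M. b i (XX \<omega>) * H i j (XX \<omega>) * eps (Suc j) \<omega>) = 0"
      using * ij eps_integrable[of "Suc j"] eps_mean[of "Suc j"] by simp_all
  qed
  have HH_int: "integrable M (\<lambda>\<omega>. H i j (XX \<omega>) * H i k (XX \<omega>) * (eps (Suc j) \<omega> * eps (Suc k) \<omega>))"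
    and HH: "(LINT \<omega>|M. H i j (XX \<omega>) * H i k (XX \<omega>) * (eps (Suc j) \<omega> * eps (Suc k) \<omega>)) =
        (if j = k then \<sigma>\<^sup>2 * (LINT \<omega>|M. (H i j (XX \<omega>))\<^sup>2) else 0)"
    if ij: "i < n" "j < n" "k < n" for i j k
  proof -
    have "\<bar>H i j x * H i k x\<bar> \<le> real n * real n" if "x \<in> space design_space" for x
      unfolding abs_mult using H_bd[OF that] ij by (intro mult_mono) auto
    note * = expectation_design_noise[OF borel_measurable_times[OF H_meas H_meas] this
        borel_measurable_times[OF EE_Suc[of j] EE_Suc[of k]]]
    show "integrable M (\<lambda>\<omega>. H i j (XX \<omega>) * H i k (XX \<omega>) * (eps (Suc j) \<omega> * eps (Suc k) \<omega>))"
      "(LINT \<omega>|M. H i j (XX \<omega>) * H i k (XX \<omega>) * (eps (Suc j) \<omega> * eps (Suc k) \<omega>)) =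
        (if j = k then \<sigma>\<^sup>2 * (LINT \<omega>|M. (H i j (XX \<omega>))\<^sup>2) else 0)"
      using * ij eps_product[of "Suc j" "Suc k"] by (simp_all add: power2_eq_square mult.commute)
  qed
  have b_int: "integrable M (\<lambda>\<omega>. (b i (XX \<omega>))\<^sup>2)" if i: "i < n" for i
  proof (rule M.integrable_const_bound[of _ "C\<^sup>2"])
    show "AE \<omega> in M. norm ((b i (XX \<omega>))\<^sup>2) \<le> C\<^sup>2"
      using b_bd[OF XX i] C_nonneg by (intro AE_I2) (auto simp: abs_le_square_iff[symmetric])
    show "(\<lambda>\<omega>. (b i (XX \<omega>))\<^sup>2) \<in> borel_measurable M"
      using measurable_compose[OF XX_measurable b_meas[OF i]] by measurable
  qed
  have H_int: "integrable M (\<lambda>\<omega>. (H i j (XX \<omega>))\<^sup>2)" if ij: "i < n" "j < n" for i j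
  proof (rule M.integrable_const_bound[of _ "(real n)\<^sup>2"])
    show "AE \<omega> in M. norm ((H i j (XX \<omega>))\<^sup>2) \<le> (real n)\<^sup>2"
      using H_bd[OF XX ij] by (intro AE_I2) (auto simp: abs_le_square_iff[symmetric])
    show "(\<lambda>\<omega>. (H i j (XX \<omega>))\<^sup>2) \<in> borel_measurable M"
      using measurable_compose[OF XX_measurable H_meas[OF ij]] by measurable
  qed

  have res: "krr_estimator K n reg (\<lambda>j. X j \<omega>) (\<lambda>j. f (X j \<omega>) + eps j \<omega>) (X (Suc i) \<omega>) - f (X (Suc i) \<omega>) =
      (\<Sum>j<n. H i j (XX \<omega>) * eps (Suc j) \<omega>) - b i (XX \<omega>)" if \<omega>: "\<omega> \<in> space M" and i: "i < n" for \<omega> i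
  proof -
    \<comment> \<open>The Gram matrix reads positive indices only, where the restricted sequence
      agrees with the original one.\<close>
    have "U (XX \<omega>) = ridge_inv n (gram (\<lambda>j. X j \<omega>)) \<mu>" by (simp add: U_def)
    then show ?thesis
      using krr_residual[of n "\<lambda>j. X j \<omega>" reg i f "\<lambda>j. eps j \<omega>"] X_in_D[OF _ \<omega>] \<mu> i
      by (simp add: H_def b_def \<mu>_def)
  qed
  let ?Q = "\<lambda>i \<omega>. (b i (XX \<omega>))\<^sup>2 - 2 * (\<Sum>j<n. b i (XX \<omega>) * H i j (XX \<omega>) * eps (Suc j) \<omega>) +
      (\<Sum>j<n. \<Sum>k<n. H i j (XX \<omega>) * H i k (XX \<omega>) * (eps (Suc j) \<omega> * eps (Suc k) \<omega>))"
  have sq: "(krr_estimator K n reg (\<lambda>j. X j \<omega>) (\<lambda>j. f (X j \<omega>) + eps j \<omega>) (X (Suc i) \<omega>) - f (X (Suc i) \<omega>))\<^sup>2 = ?Q i \<omega>"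
    if "\<omega> \<in> space M" "i < n" for \<omega> i
    unfolding res[OF that] power2_diff
    by (simp add: power2_eq_square sum_product sum_distrib_left mult_ac)
  have Q_int: "integrable M (?Q i)" if i: "i < n" for i
    using i by (intro Bochner_Integration.integrable_add Bochner_Integration.integrable_diff
        integrable_mult_right Bochner_Integration.integrable_sum b_int bH(1) HH_int) auto
  have Q: "(LINT \<omega>|M. ?Q i \<omega>) = (LINT \<omega>|M. (b i (XX \<omega>))\<^sup>2) + \<sigma>\<^sup>2 * (\<Sum>j<n. LINT \<omega>|M. (H i j (XX \<omega>))\<^sup>2)"
    if i: "i < n" for i
  proof -
    let ?R = "\<lambda>\<omega>. \<Sum>j<n. b i (XX \<omega>) * H i j (XX \<omega>) * eps (Suc j) \<omega>"
    let ?S = "\<lambda>\<omega>. \<Sum>j<n. \<Sum>k<n. H i j (XX \<omega>) * H i k (XX \<omega>) * (eps (Suc j) \<omega> * eps (Suc k) \<omega>)"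
    have R: "integrable M ?R" "(LINT \<omega>|M. ?R \<omega>) = 0"
      using bH i by (auto intro!: Bochner_Integration.integrable_sum simp: Bochner_Integration.integral_sum)
    have S: "integrable M ?S" using HH_int i by (intro Bochner_Integration.integrable_sum) auto
    have "(LINT \<omega>|M. ?S \<omega>) =
        (\<Sum>j<n. LINT \<omega>|M. (\<Sum>k<n. H i j (XX \<omega>) * H i k (XX \<omega>) * (eps (Suc j) \<omega> * eps (Suc k) \<omega>)))"
      using HH_int i by (intro Bochner_Integration.integral_sum Bochner_Integration.integrable_sum) auto
    also have "\<dots> = (\<Sum>j<n. \<Sum>k<n. LINT \<omega>|M. H i j (XX \<omega>) * H i k (XX \<omega>) * (eps (Suc j) \<omega> * eps (Suc k) \<omega>))"
      using HH_int i by (intro sum.cong refl Bochner_Integration.integral_sum) auto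
    also have "\<dots> = (\<Sum>j<n. \<Sum>k<n. if j = k then \<sigma>\<^sup>2 * (LINT \<omega>|M. (H i j (XX \<omega>))\<^sup>2) else 0)"
      using HH i by (intro sum.cong refl) auto
    also have "\<dots> = \<sigma>\<^sup>2 * (\<Sum>j<n. LINT \<omega>|M. (H i j (XX \<omega>))\<^sup>2)"
      by (simp add: sum.delta sum_distrib_left)
    finally have S_eq: "(LINT \<omega>|M. ?S \<omega>) = \<sigma>\<^sup>2 * (\<Sum>j<n. LINT \<omega>|M. (H i j (XX \<omega>))\<^sup>2)" .
    have "(LINT \<omega>|M. ?Q i \<omega>) = (LINT \<omega>|M. (b i (XX \<omega>))\<^sup>2) - 2 * (LINT \<omega>|M. ?R \<omega>) + (LINT \<omega>|M. ?S \<omega>)"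
      using b_int[OF i] R(1) S by simp
    then show ?thesis unfolding R(2) S_eq by simp
  qed

  have "krr_risk M K f X eps n reg = (LINT \<omega>|M. 1 / real n * (\<Sum>i<n. ?Q i \<omega>))"
    unfolding krr_risk_def
  proof (rule Bochner_Integration.integral_cong[OF refl])
    fix \<omega> assume \<omega>: "\<omega> \<in> space M"
    let ?e = "\<lambda>i. (krr_estimator K n reg (\<lambda>j. X j \<omega>) (\<lambda>j. f (X j \<omega>) + eps j \<omega>) (X i \<omega>) - f (X i \<omega>))\<^sup>2"
    have "(\<Sum>i = 1..n. ?e i) = (\<Sum>i<n. ?e (Suc i))"
      by (simp add: sum.atLeast1_atMost_eq)
    also have "\<dots> = (\<Sum>i<n. ?Q i \<omega>)" using sq[OF \<omega>] by (intro sum.cong refl) auto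
    finally show "1 / real n * (\<Sum>i = 1..n. ?e i) = 1 / real n * (\<Sum>i<n. ?Q i \<omega>)" by simp
  qed
  also have "\<dots> = 1 / real n * (\<Sum>i<n. LINT \<omega>|M. ?Q i \<omega>)"
    using Q_int by (subst integral_mult_right_zero, subst Bochner_Integration.integral_sum) auto
  also have "(\<Sum>i<n. LINT \<omega>|M. ?Q i \<omega>) =
      (\<Sum>i<n. LINT \<omega>|M. (b i (XX \<omega>))\<^sup>2) + \<sigma>\<^sup>2 * (\<Sum>i<n. \<Sum>j<n. LINT \<omega>|M. (H i j (XX \<omega>))\<^sup>2)"
    using Q by (simp add: sum.distrib sum_distrib_left)
  also have "(\<Sum>i<n. LINT \<omega>|M. (b i (XX \<omega>))\<^sup>2) = (LINT \<omega>|M. (\<Sum>i<n. (b i (XX \<omega>))\<^sup>2))"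
    using b_int by (subst Bochner_Integration.integral_sum) auto
  also have "(\<Sum>i<n. \<Sum>j<n. LINT \<omega>|M. (H i j (XX \<omega>))\<^sup>2) = (\<Sum>i<n. LINT \<omega>|M. (\<Sum>j<n. (H i j (XX \<omega>))\<^sup>2))"
    using H_int by (intro sum.cong refl Bochner_Integration.integral_sum[symmetric]) auto
  also have "\<dots> = (LINT \<omega>|M. (\<Sum>i<n. \<Sum>j<n. (H i j (XX \<omega>))\<^sup>2))"
    using H_int by (intro Bochner_Integration.integral_sum[symmetric] Bochner_Integration.integrable_sum) auto
  finally have risk: "krr_risk M K f X eps n reg = 1 / real n *
      ((LINT \<omega>|M. (\<Sum>i<n. (b i (XX \<omega>))\<^sup>2)) + \<sigma>\<^sup>2 * (LINT \<omega>|M. (\<Sum>i<n. \<Sum>j<n. (H i j (XX \<omega>))\<^sup>2)))" .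

  have "(LINT \<omega>|M. (\<Sum>i<n. (b i (XX \<omega>))\<^sup>2)) \<le> (LINT \<omega>|M. \<mu> * F / 4)"
    using b_int b_sum[OF XX] by (intro integral_mono Bochner_Integration.integrable_sum) auto
  also have "\<dots> = \<mu> * F / 4" by (simp add: M.prob_space)
  also have "\<dots> \<le> \<mu> * F" using \<mu> F_nonneg by simp
  finally have bias: "(LINT \<omega>|M. (\<Sum>i<n. (b i (XX \<omega>))\<^sup>2)) \<le> \<mu> * F" .

  let ?t = "\<Sum>k. lam (Suc (k + N))"
  have tail: "integrable M (\<lambda>\<omega>. tail_diag N (X (Suc i) \<omega>))"
    "(LINT \<omega>|M. tail_diag N (X (Suc i) \<omega>)) \<le> B * ?t" for i
  proof -
    have m: "tail_diag N \<in> borel_measurable \<rho>" by (rule measurable_\<rho>[OF tail_diag_cont])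
    have Xm: "X (Suc i) \<in> measurable M \<rho>" by (rule X_measurable) simp
    have "\<exists>C>0. \<forall>x\<in>D. \<bar>tail_diag N x\<bar> \<le> C" by (rule bounded_cont[OF tail_diag_cont])
    then obtain C where "\<forall>x\<in>D. \<bar>tail_diag N x\<bar> \<le> C" by blast
    then show "integrable M (\<lambda>\<omega>. tail_diag N (X (Suc i) \<omega>))"
      using X_in_D[of "Suc i"] measurable_compose[OF Xm m]
      by (intro M.integrable_const_bound[of _ C] AE_I2) auto
    have "(LINT \<omega>|M. tail_diag N (X (Suc i) \<omega>)) = (LINT x|distr M \<rho> (X (Suc i)). tail_diag N x)"
      by (rule integral_distr[OF Xm m, symmetric])
    also have "\<dots> = (LINT x|\<rho>. tail_diag N x)" by (simp add: X_distr)
    also have "\<dots> \<le> B * (LINT x|P. tail_diag N x)" by (rule B[OF tail_diag_cont tail_diag_nonneg])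
    finally show "(LINT \<omega>|M. tail_diag N (X (Suc i) \<omega>)) \<le> B * ?t" unfolding integral_tail_diag .
  qed
  \<comment> \<open>The trace bound holds for each outcome; expectation enters afterwards and
    affects only the diagonal remainder.\<close>
  have "(\<Sum>i<n. \<Sum>j<n. (H i j (XX \<omega>))\<^sup>2) \<le> real N + (\<Sum>i<n. tail_diag N (X (Suc i) \<omega>)) / \<mu>"
    if \<omega>: "\<omega> \<in> space M" for \<omega>
  proof -
    note x = XX[OF \<omega>]
    have "(\<Sum>i<n. \<Sum>j<n. (H i j (XX \<omega>))\<^sup>2) \<le> (\<Sum>i<n. H i i (XX \<omega>))"
      unfolding H_def U_def by (rule ridge.hat_frobenius_le_trace[OF ridge[OF x]])
    also have "\<dots> \<le> N + (\<Sum>i<n. gram (XX \<omega>) i i - (\<Sum>k<N. lam (Suc k) * (phi (Suc k) (XX \<omega> (Suc i)))\<^sup>2)) / \<mu>"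
      unfolding H_def U_def
      by (rule ridge.trace_hat_le[OF ridge[OF x], of "\<lambda>k. lam (Suc k)" "\<lambda>k i. phi (Suc k) (XX \<omega> (Suc i))"])
        (use lam_pos mercer design_space_D[OF x] in \<open>auto simp: less_imp_le\<close>)
    finally show ?thesis by (simp add: tail_diag_def)
  qed
  then have "(LINT \<omega>|M. (\<Sum>i<n. \<Sum>j<n. (H i j (XX \<omega>))\<^sup>2)) \<le>
      (LINT \<omega>|M. real N + (\<Sum>i<n. tail_diag N (X (Suc i) \<omega>)) / \<mu>)"
    using H_int tail(1)
    by (intro integral_mono Bochner_Integration.integrable_sum Bochner_Integration.integrable_add
        integrable_divide_zero) auto
  also have "\<dots> = real N + (\<Sum>i<n. LINT \<omega>|M. tail_diag N (X (Suc i) \<omega>)) / \<mu>"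
    using tail(1) by (simp add: M.prob_space)
  also have "\<dots> \<le> real N + (\<Sum>i<n. B * ?t) / \<mu>"
    using \<mu> tail(2) by (intro add_left_mono divide_right_mono sum_mono) auto
  also have "\<dots> = real N + B * ?t / reg" using n reg by (simp add: \<mu>_def)
  finally have var: "(LINT \<omega>|M. (\<Sum>i<n. \<Sum>j<n. (H i j (XX \<omega>))\<^sup>2)) \<le> real N + B * ?t / reg" .

  have "krr_risk M K f X eps n reg \<le> 1 / real n * (\<mu> * F + \<sigma>\<^sup>2 * (real N + B * ?t / reg))"
    unfolding risk by (intro mult_left_mono add_mono bias var) auto
  also have "\<dots> = reg * F + \<sigma>\<^sup>2 / real n * (real N + B * ?t / reg)"
    using n by (simp add: \<mu>_def field_simps)
  finally show ?thesis .
qed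

section \<open>Choice of truncation and regularisation; rates\<close>

text \<open>The order of quantifiers matters: \<open>F\<close> and \<open>B\<close> precede
  \<open>n\<close>, \<open>reg\<close> and \<open>N\<close>, so the latter can be tuned with
  \<open>n\<close> at a fixed constant.\<close>

lemma krr_risk_oracle:
  "\<exists>F\<ge>0. \<exists>B\<ge>0. \<forall>n\<ge>1. \<forall>reg>0. \<forall>N. krr_risk M K f X eps n reg \<le>
    reg * F + \<sigma>\<^sup>2 / real n * (real N + B * (\<Sum>k. lam (Suc (k + N))) / reg)"
proof -
  from rkhs_dominated[OF f_rkhs] obtain F where F: "F \<ge> 0"
    "\<forall>(n::nat) z c. (\<forall>i<n. z i \<in> D) \<longrightarrow>
      (\<Sum>i<n. c i * f (z i))\<^sup>2 \<le> F * (\<Sum>i<n. \<Sum>j<n. c i * c j * K (z i) (z j))"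
    by (elim exE conjE)
  from integral_\<rho>_le obtain B where B: "B \<ge> 0"
    "\<forall>g :: 'a \<Rightarrow> real. continuous_on D g \<longrightarrow> (\<forall>x\<in>D. 0 \<le> g x) \<longrightarrow> (LINT x|\<rho>. g x) \<le> B * (LINT x|P. g x)"
    by (elim exE conjE)
  show ?thesis
    by (intro exI[of _ F] exI[of _ B] conjI allI impI krr_risk_le F(1) B(1)
        F(2)[rule_format] B(2)[rule_format])
qed

lemma lam_tail_summable: "summable (\<lambda>k. lam (Suc (k + N)))"
  using summable_ignore_initial_segment[OF lam_summable, of N] .

lemma lam_tail_nonneg: "0 \<le> (\<Sum>k. lam (Suc (k + N)))"
  using lam_pos by (intro suminf_nonneg lam_tail_summable) (simp add: less_imp_le)

text \<open>Regularisation \<open>1 / n\<close> makes the bias of order \<open>1 / n\<close>, and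
  \<open>m / n\<close> dominates this. With \<open>N\<close> of order \<open>ln n / b\<close> the
  tail divided by \<open>reg\<close> stays bounded, so the variance is governed by
  \<open>N / n\<close>.\<close>

theorem krr_risk_exponential:
  assumes \<sigma>: "\<sigma> > 0" and b: "b > 0" and m: "m \<ge> 1" and C0: "C0 > 0" "\<And>k. k \<ge> m \<Longrightarrow> lam k \<le> C0 * exp (- b * real k)"
  shows "\<exists>C>0. \<forall>n\<ge>1. krr_risk M K f X eps n (1 / real n) \<le>
    C * (\<sigma>\<^sup>2 * max (real m / real n) (1 / (b * real n) * ln (real n / \<sigma>\<^sup>2)))"
proof -
  from krr_risk_oracle obtain F B where FB: "F \<ge> 0" "B \<ge> 0"
    and R: "\<And>n reg N. n \<ge> 1 \<Longrightarrow> reg > 0 \<Longrightarrow> krr_risk M K f X eps n reg \<le>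
      reg * F + \<sigma>\<^sup>2 / real n * (real N + B * (\<Sum>k. lam (Suc (k + N))) / reg)"
    by blast
  define C1 where "C1 = C0 / (1 - exp (- b))"
  have C1: "C1 > 0" using C0(1) b by (simp add: C1_def)
  define C where "C = F / \<sigma>\<^sup>2 + 3 + \<bar>ln (\<sigma>\<^sup>2)\<bar> / b + B * C1"
  have s2: "\<sigma>\<^sup>2 > 0" using \<sigma> by simp
  have "C > 0" unfolding C_def using FB C1 b s2 by (intro add_nonneg_pos add_pos_nonneg) auto
  moreover have "krr_risk M K f X eps n (1 / real n) \<le>
      C * (\<sigma>\<^sup>2 * max (real m / real n) (1 / (b * real n) * ln (real n / \<sigma>\<^sup>2)))" (is "_ \<le> C * (\<sigma>\<^sup>2 * ?x)")
    if n: "n \<ge> 1" for n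
  proof -
    have n0: "real n > 0" using n by simp
    \<comment> \<open>Adding \<open>m\<close> places the tail where the decay hypothesis holds; the
      second summand makes \<open>exp (- b * real N)\<close> at most \<open>1 / n\<close>.\<close>
    define N where "N = m + nat \<lceil>ln (real n) / b\<rceil>"
    have mN: "N \<ge> m" unfolding N_def by (rule le_add1)
    have "ln (real n) / b \<ge> 0" using n b by simp
    then have N: "real N \<le> real m + ln (real n) / b + 1" "ln (real n) / b \<le> real N"
      unfolding N_def by linarith+
    have "(\<Sum>k. lam (Suc (k + N))) \<le> C1 * exp (- b * real N)"
      unfolding C1_def by (rule suminf_exp_tail_le[OF C0(2) lam_tail_summable mN b C0(1)])
    also have "- b * real N \<le> - ln (real n)" using N(2) b by (simp add: field_simps)
    then have "C1 * exp (- b * real N) \<le> C1 * exp (- ln (real n))" using C1 by simp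
    also have "exp (- ln (real n)) = 1 / real n" using n0 by (simp add: exp_minus inverse_eq_divide)
    finally have t: "(\<Sum>k. lam (Suc (k + N))) * real n \<le> C1" using n0 by (simp add: field_simps)
    have x1: "1 / real n \<le> ?x" "real m / real n \<le> ?x"
    proof -
      have "1 / real n \<le> real m / real n" using m n0 by (intro divide_right_mono) auto
      then show "1 / real n \<le> ?x" "real m / real n \<le> ?x" by linarith+
    qed
    \<comment> \<open>\<open>N\<close> was chosen with \<open>ln n\<close>, whereas the rate has
      \<open>ln (n / \<sigma>\<^sup>2)\<close>. The difference is a multiple of \<open>1 / n\<close>
      and is absorbed by \<open>m / n\<close>, which also covers small \<open>n\<close> with a
      negative logarithm.\<close>
    have "ln (real n) / b / real n = 1 / (b * real n) * ln (real n / \<sigma>\<^sup>2) + ln (\<sigma>\<^sup>2) / b * (1 / real n)"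
      using n0 s2 b by (simp add: ln_div field_simps)
    also have "\<dots> \<le> ?x + \<bar>ln (\<sigma>\<^sup>2)\<bar> / b * (1 / real n)"
      using b n0 by (intro add_mono mult_right_mono divide_right_mono) auto
    also have "\<dots> \<le> ?x + \<bar>ln (\<sigma>\<^sup>2)\<bar> / b * ?x"
      using b x1 by (intro add_left_mono mult_left_mono) auto
    finally have x2: "ln (real n) / b / real n \<le> ?x + \<bar>ln (\<sigma>\<^sup>2)\<bar> / b * ?x" .
    have "krr_risk M K f X eps n (1 / real n) \<le>
        1 / real n * F + \<sigma>\<^sup>2 / real n * (real N + B * (\<Sum>k. lam (Suc (k + N))) / (1 / real n))"
      using n by (intro R) auto
    also have "\<dots> \<le> 1 / real n * F + \<sigma>\<^sup>2 / real n * ((real m + ln (real n) / b + 1) + B * C1)"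
    proof -
      have "B * (\<Sum>k. lam (Suc (k + N))) / (1 / real n) \<le> B * C1"
        using mult_left_mono[OF t FB(2)] by (simp add: mult.assoc)
      then show ?thesis using N(1) n0 by (intro add_left_mono mult_left_mono add_mono) auto
    qed
    also have "\<dots> = F * (1 / real n) + \<sigma>\<^sup>2 * (real m / real n + ln (real n) / b / real n + 1 / real n + B * C1 * (1 / real n))"
      using n0 by (simp add: field_simps)
    also have "\<dots> \<le> F * ?x + \<sigma>\<^sup>2 * (?x + (?x + \<bar>ln (\<sigma>\<^sup>2)\<bar> / b * ?x) + ?x + B * C1 * ?x)"
      using FB C1 by (intro add_mono mult_left_mono x1 x2) auto
    also have "\<dots> = C * (\<sigma>\<^sup>2 * ?x)"
    proof -
      have "F * ?x = F / \<sigma>\<^sup>2 * (\<sigma>\<^sup>2 * ?x)" using s2 by simp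
      then show ?thesis unfolding C_def by (simp only: algebra_simps)
    qed
    finally show ?thesis .
  qed
  ultimately show ?thesis by blast
qed

text \<open>
  If \<open>2 * s \<le> 1\<close>, the bound on \<open>lam\<close> is not even summable, but then the trace formula alone (\<open>N = 0\<close>)
  already gives the rate.
\<close>
lemma krr_risk_polynomial_aux:
  assumes s: "s > 0" and m: "m \<ge> 1" and C0: "C0 > 0" "\<And>k. k \<ge> m \<Longrightarrow> lam k \<le> C0 * real k powr (- (2 * s))"
  defines "e \<equiv> 2 * s / (2 * s + 1)"
  shows "\<exists>A\<ge>0. \<forall>n\<ge>1. krr_risk M K f X eps n (real n powr - e) \<le> A * real n powr - e"
proof -
  from krr_risk_oracle obtain F B where FB: "F \<ge> 0" "B \<ge> 0"
    and R: "\<And>n reg N. n \<ge> 1 \<Longrightarrow> reg > 0 \<Longrightarrow> krr_risk M K f X eps n reg \<le>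
      reg * F + \<sigma>\<^sup>2 / real n * (real N + B * (\<Sum>k. lam (Suc (k + N))) / reg)"
    by blast
  have R': "krr_risk M K f X eps n (real n powr - e) \<le> real n powr - e * F +
      \<sigma>\<^sup>2 * (real N * real n powr -1 + B * (\<Sum>k. lam (Suc (k + N))) * real n powr (e - 1))" if n: "n \<ge> 1" for n N
  proof -
    have n0: "real n > 0" using n by simp
    define Z where "Z = real n powr e"
    have Z: "Z > 0" using n0 by (simp add: Z_def)
    have 1: "real n powr (e - 1) = Z / real n" using n0 by (simp add: Z_def powr_diff)
    have 2: "real n powr -1 = 1 / real n" using n0 by (simp add: powr_minus_divide)
    have 3: "real n powr - e = 1 / Z" unfolding Z_def by (rule powr_minus_divide)
    have "\<sigma>\<^sup>2 / real n * (real N + B * (\<Sum>k. lam (Suc (k + N))) / (real n powr - e)) =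
        \<sigma>\<^sup>2 * (real N * real n powr -1 + B * (\<Sum>k. lam (Suc (k + N))) * real n powr (e - 1))"
      unfolding 1 2 3 using n0 Z by (simp add: field_simps)
    moreover have "real n powr - e > 0" using n0 by simp
    ultimately show ?thesis using R[OF n, of "real n powr - e" N] by simp
  qed
  show ?thesis
  proof (cases "2 * s > 1")
    case False
    define t where "t = (\<Sum>k. lam (Suc (k + 0)))"
    have t: "t \<ge> 0" unfolding t_def by (rule lam_tail_nonneg)
    \<comment> \<open>For this range of \<open>s\<close> the bounded trace divided by
      \<open>n * reg\<close>, of order n^(e - 1), is already at most n^(-e).\<close>
    have "e \<le> 1 / 2" unfolding e_def using False s by (subst pos_divide_le_eq) auto
    then have e: "e - 1 \<le> - e" by simp
    have "krr_risk M K f X eps n (real n powr - e) \<le> (F + \<sigma>\<^sup>2 * (B * t)) * real n powr - e" if n: "n \<ge> 1" for n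
    proof -
      have "real n powr (e - 1) \<le> real n powr - e" using e n by (intro powr_mono) auto
      then have "\<sigma>\<^sup>2 * (B * t * real n powr (e - 1)) \<le> \<sigma>\<^sup>2 * (B * t * real n powr - e)"
        using FB t by (intro mult_left_mono) auto
      with R'[OF n, of 0, folded t_def] show ?thesis by (simp add: algebra_simps)
    qed
    then show ?thesis using FB t by (intro exI[of _ "F + \<sigma>\<^sup>2 * (B * t)"]) auto
  next
    case True
    define q where "q = 1 / (2 * s + 1)"
    define C1 where "C1 = C0 / (2 * s - 1)"
    have C1: "C1 > 0" using C0(1) True by (simp add: C1_def)
    have q: "q > 0" using s by (simp add: q_def)
    \<comment> \<open>The balance that determines \<open>q\<close> and \<open>e\<close>: with
      \<open>N\<close> near n^q, both \<open>N / n\<close> and the tail N^(1 - 2s) divided by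
      \<open>n * reg\<close> are of order n^(-e).\<close>
    have q_e: "q + -1 = - e" "q * (1 - 2 * s) + (e - 1) = - e"
    proof -
      have "e = 2 * s * q" "2 * s * q + q = 1"
        unfolding q_def e_def using s by (simp_all add: add_divide_distrib[symmetric])
      then show "q + -1 = - e" "q * (1 - 2 * s) + (e - 1) = - e" by (simp_all add: algebra_simps)
    qed
    have "krr_risk M K f X eps n (real n powr - e) \<le>
        (F + \<sigma>\<^sup>2 * ((real m + 2) + B * C1)) * real n powr - e" if n: "n \<ge> 1" for n
    proof -
      have n0: "real n > 0" using n by simp
      have nq: "real n powr q \<ge> 1" using n q by (simp add: ge_one_powr_ge_zero)
      \<comment> \<open>The summand \<open>m\<close> again puts the tail into the range of the decay
        hypothesis; \<open>N\<close> lies between n^q and (m + 2) n^q.\<close>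
      define N where "N = m + nat \<lceil>real n powr q\<rceil>"
      have N: "real N \<le> real m + real n powr q + 1" "real n powr q \<le> real N"
        unfolding N_def using nq by linarith+
      have N1: "real N \<le> (real m + 2) * real n powr q"
      proof -
        have "real m * 1 \<le> real m * real n powr q" using nq by (intro mult_left_mono) auto
        then show ?thesis using N(1) nq by (simp add: algebra_simps)
      qed
      have "(\<Sum>k. lam (Suc (k + N))) \<le> C1 * real N powr (1 - 2 * s)"
        unfolding C1_def using m True
        by (intro suminf_powr_tail_le[OF C0(2) lam_tail_summable] C0(1)) (auto simp: N_def)
      also have "\<dots> \<le> C1 * (real n powr q) powr (1 - 2 * s)"
        using C1 n nq N(2) True by (intro mult_left_mono powr_mono2') auto
      also have "\<dots> = C1 * real n powr (q * (1 - 2 * s))" by (simp add: powr_powr)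
      finally have t: "(\<Sum>k. lam (Suc (k + N))) \<le> C1 * real n powr (q * (1 - 2 * s))" .
      have "real N * real n powr -1 \<le> (real m + 2) * real n powr q * real n powr -1"
        by (intro mult_right_mono N1) simp
      also have "\<dots> = (real m + 2) * real n powr - e"
        unfolding q_e(1)[symmetric] powr_add by simp
      finally have a: "real N * real n powr -1 \<le> (real m + 2) * real n powr - e" .
      have "B * (\<Sum>k. lam (Suc (k + N))) * real n powr (e - 1) \<le>
          B * (C1 * real n powr (q * (1 - 2 * s))) * real n powr (e - 1)"
        using FB by (intro mult_right_mono mult_left_mono t) auto
      also have "\<dots> = B * C1 * real n powr - e"
        unfolding q_e(2)[symmetric] powr_add by simp
      finally have b: "B * (\<Sum>k. lam (Suc (k + N))) * real n powr (e - 1) \<le> B * C1 * real n powr - e" .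
      have "\<sigma>\<^sup>2 * (real N * real n powr -1 + B * (\<Sum>k. lam (Suc (k + N))) * real n powr (e - 1)) \<le>
          \<sigma>\<^sup>2 * ((real m + 2) * real n powr - e + B * C1 * real n powr - e)"
        by (intro mult_left_mono add_mono a b) simp
      with R'[OF n, of N] show ?thesis by (simp add: algebra_simps)
    qed
    then show ?thesis using FB C1 by (intro exI[of _ "F + \<sigma>\<^sup>2 * ((real m + 2) + B * C1)"]) auto
  qed
qed

text \<open>The exponent 2s / (2s + 1) is obtained for every \<open>a\<close>. It is at least the
  stated one, as 1 - 1 / (2s + \<gamma>) increases with \<gamma> and \<gamma> is at most 1; the
  change from \<open>n\<close> to \<open>n / \<sigma>\<^sup>2\<close> costs a constant power of the
  noise level.\<close>

theorem krr_risk_polynomial: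
  assumes \<sigma>: "\<sigma> > 0" and a: "a \<ge> 0" and s: "s > a" and m: "m \<ge> 1"
    and C0: "C0 > 0" "\<And>k. k \<ge> m \<Longrightarrow> lam k \<le> C0 * real k powr (- 2 * s)"
  defines "\<gamma> \<equiv> min 1 (2 - a)"
  shows "\<exists>C>0. \<forall>n\<ge>1. krr_risk M K f X eps n (real n powr - (2 * s / (2 * s + 1))) \<le>
    C * max (\<sigma>\<^sup>2 * (real m / real n)) ((real n / \<sigma>\<^sup>2) powr (- ((2 * s + \<gamma> - 1) / (2 * s + \<gamma>))))"
proof -
  define e e' where "e = 2 * s / (2 * s + 1)" and "e' = (2 * s + \<gamma> - 1) / (2 * s + \<gamma>)"
  have "\<exists>A\<ge>0. \<forall>n\<ge>1. krr_risk M K f X eps n (real n powr - e) \<le> A * real n powr - e"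
    unfolding e_def using a s m C0 by (intro krr_risk_polynomial_aux[of s m C0]) auto
  then obtain A where A: "A \<ge> 0" "\<And>n. n \<ge> 1 \<Longrightarrow> krr_risk M K f X eps n (real n powr - e) \<le> A * real n powr - e"
    by blast
  have pos: "2 * s + \<gamma> > 0" "\<gamma> \<le> 1" using a s by (auto simp: \<gamma>_def)
  have "e = 1 - 1 / (2 * s + 1)" "e' = 1 - 1 / (2 * s + \<gamma>)"
    unfolding e_def e'_def using pos a s by (simp_all add: field_simps)
  moreover have "1 / (2 * s + 1) \<le> 1 / (2 * s + \<gamma>)" using pos by (intro divide_left_mono) auto
  ultimately have le: "e' \<le> e" by linarith
  have s2: "\<sigma>\<^sup>2 > 0" using \<sigma> by simp
  define C where "C = A * (\<sigma>\<^sup>2) powr - e' + 1"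
  have "C > 0" unfolding C_def using A(1) by (intro add_nonneg_pos) auto
  moreover have "krr_risk M K f X eps n (real n powr - e) \<le>
      C * max (\<sigma>\<^sup>2 * (real m / real n)) ((real n / \<sigma>\<^sup>2) powr - e')" if n: "n \<ge> 1" for n
  proof -
    have n0: "real n > 0" using n by simp
    have "krr_risk M K f X eps n (real n powr - e) \<le> A * real n powr - e" by (rule A(2)[OF n])
    also have "\<dots> \<le> A * real n powr - e'" using A(1) n le by (intro mult_left_mono powr_mono) auto
    also have "real n powr - e' = (\<sigma>\<^sup>2) powr - e' * (real n / \<sigma>\<^sup>2) powr - e'"
      using n0 s2 by (subst powr_mult[symmetric]) auto
    also have "A * \<dots> \<le> C * (real n / \<sigma>\<^sup>2) powr - e'"
      unfolding C_def by (simp add: algebra_simps)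
    also have "\<dots> \<le> C * max (\<sigma>\<^sup>2 * (real m / real n)) ((real n / \<sigma>\<^sup>2) powr - e')"
      using \<open>C > 0\<close> by (intro mult_left_mono) auto
    finally show ?thesis .
  qed
  ultimately show ?thesis unfolding e_def e'_def by blast
qed

end

theorem proposition2:
  fixes D :: "'a::euclidean_space set"
    and K :: "'a \<Rightarrow> 'a \<Rightarrow> real"
    and P \<rho> :: "'a measure"
    and lam :: "nat \<Rightarrow> real"
    and phi :: "nat \<Rightarrow> 'a \<Rightarrow> real"
    and f :: "'a \<Rightarrow> real"
    and M :: "'w measure"
    and X :: "nat \<Rightarrow> 'w \<Rightarrow> 'a"
    and eps :: "nat \<Rightarrow> 'w \<Rightarrow> real"
    and \<sigma> a :: real
  assumes "compact D"
    and "mercer_kernel D K"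
    and "prob_on D P" and "measure_support P = D"
    and "prob_on D \<rho>"
    and "eigensystem D P K lam phi"
    and "f \<in> rkhs D P lam phi"
    and "prob_space M"
    and "iid_design M \<rho> X"
    and "\<sigma> > 0" and "iid_noise M \<sigma> eps"
    and "design_indep_noise M \<rho> X eps"
    and H0: "kernel_op_one_to_one P K"
    and H1: "absolutely_continuous P \<rho>" "\<exists>B. AE x in P. RN_deriv P \<rho> x \<le> ennreal B"
    and "\<And>k. k \<ge> 1 \<Longrightarrow>
      (\<lambda>i. real (i - k + 1) * lam i * L2_norm_sq \<rho> (phi i) / (lam k * L2_norm_sq \<rho> (phi k)))
        summable_on {k..}"
    and "a \<ge> 0"
    and "\<exists>C>0. \<forall>k\<ge>1. sup_norm_on D (phi k) \<le> C * real k powr (a / 2)"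
  defines "H2 \<equiv> \<lambda>n. \<forall>N\<in>{1..n}. AE \<omega> in M. full_rank_design phi n N (\<lambda>j. X j \<omega>)"
    and "H3 \<equiv> \<lambda>n. \<forall>N\<in>{1..n}. AE \<omega> in M. bounded_coefficients P K lam phi f n N (\<lambda>j. X j \<omega>)"
  shows
    "(\<forall>b N\<^sub>b. b > 0 \<longrightarrow> N\<^sub>b \<ge> 1 \<longrightarrow>
        (\<exists>C>0. \<forall>k\<ge>N\<^sub>b. lam k \<le> C * exp (- b * real k)) \<longrightarrow>
        (\<exists>reg. (\<forall>n\<ge>1. reg n > 0) \<and>
          (\<exists>C>0. \<forall>n\<ge>1. H2 n \<longrightarrow> H3 n \<longrightarrow>
            krr_risk M K f X eps n (reg n)
              \<le> C * (\<sigma>\<^sup>2 * max (real N\<^sub>b / real n) (1 / (b * real n) * ln (real n / \<sigma>\<^sup>2))))))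
     \<and> (\<forall>s N\<^sub>s. s > a \<longrightarrow> N\<^sub>s \<ge> 1 \<longrightarrow>
        (\<exists>C>0. \<forall>k\<ge>N\<^sub>s. lam k \<le> C * real k powr (- 2 * s)) \<longrightarrow>
        (let \<gamma> = min 1 (2 - a) in
         \<exists>reg. (\<forall>n\<ge>1. reg n > 0) \<and>
          (\<exists>C>0. \<forall>n\<ge>1. H2 n \<longrightarrow> H3 n \<longrightarrow>
            krr_risk M K f X eps n (reg n)
              \<le> C * max (\<sigma>\<^sup>2 * (real N\<^sub>s / real n))
                        ((real n / \<sigma>\<^sup>2) powr (- ((2 * s + \<gamma> - 1) / (2 * s + \<gamma>)))))))"
  proof -
  interpret krr_model D P K lam phi M \<rho> f X eps \<sigma>
    using assms by (intro krr_model.intro mercer_eigensystem.intro mercer_space.intro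
      mercer_eigensystem_axioms.intro krr_model_axioms.intro)
  show ?thesis
    unfolding Let_def
  proof (intro conjI allI impI; elim exE conjE)
    fix b C0 :: real and N\<^sub>b :: nat
    assume b: "b > 0" "N\<^sub>b \<ge> 1" and C0: "C0 > 0" "\<forall>k\<ge>N\<^sub>b. lam k \<le> C0 * exp (- b * real k)"
    from krr_risk_exponential[OF \<open>\<sigma> > 0\<close> b C0(1) C0(2)[rule_format]]
    show "\<exists>reg. (\<forall>n\<ge>1. reg n > 0) \<and>
          (\<exists>C>0. \<forall>n\<ge>1. H2 n \<longrightarrow> H3 n \<longrightarrow>
            krr_risk M K f X eps n (reg n)
              \<le> C * (\<sigma>\<^sup>2 * max (real N\<^sub>b / real n) (1 / (b * real n) * ln (real n / \<sigma>\<^sup>2))))"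
      by (intro exI[of _ "\<lambda>n. 1 / real n"]) auto
  next
    fix s C0 :: real and N\<^sub>s :: nat
    assume s: "s > a" "N\<^sub>s \<ge> 1" and C0: "C0 > 0" "\<forall>k\<ge>N\<^sub>s. lam k \<le> C0 * real k powr (- 2 * s)"
    from krr_risk_polynomial[OF \<open>\<sigma> > 0\<close> \<open>a \<ge> 0\<close> s C0(1) C0(2)[rule_format]]
    show "\<exists>reg. (\<forall>n\<ge>1. reg n > 0) \<and>
          (\<exists>C>0. \<forall>n\<ge>1. H2 n \<longrightarrow> H3 n \<longrightarrow>
            krr_risk M K f X eps n (reg n)
              \<le> C * max (\<sigma>\<^sup>2 * (real N\<^sub>s / real n))
                ((real n / \<sigma>\<^sup>2) powr (- ((2 * s + min 1 (2 - a) - 1) / (2 * s + min 1 (2 - a))))))"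
      by (intro exI[of _ "\<lambda>n. real n powr - (2 * s / (2 * s + 1))"]) auto
  qed
qed

end
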